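(* Let $\Omega$, $X=(X_1,\dots,X_m)$, $1<p<\infty$ be as in the context. The first (smallest) eigenvalue $\lambda_1=\inf_{v\in \mathcal{W}^{1,p}_{X,0}(\Omega)\setminus\{0\}}\frac{\int_\Omega |Xv|^p\,dx}{\int_\Omega |v|^p\,dx}$ is simple in the following sense: if $u_1$ and $\tilde u_1$ are two positive (in $\Omega$) eigenfunctions associated with $\lambda_1$, then they are proportional, i.e. there is a constant $c\neq0$ with $u_1=c\,\tilde u_1$ in $\Omega$.
   Context: Setting. Let $1<p<\infty$, $m,n\in\mathbb{N}$ with $n\ge 2$ and $m\le n$. Let $U\subset\mathbb{R}^n$ be a bounded domain and let $X_i=\sum_{k=1}^n b_{ik}(x)\partial_{x_k}$, $i=1,\dots,m$, be smooth vector fields on $U$ satisfying the Hörmander condition at step $s$: $s\in\mathbb{N}$ is the smallest integer such that the iterated commutators $X_J=[X_{j_1},\dots[X_{j_{k-1}},X_{j_k}]\dots]$, $J=(j_1,\dots,j_k)\in\{1,\dots,m\}^k$, of length $|J|=k\le s$ span $\mathbb{R}^n$ at each $x\in U$. Let $\Omega\Subset U$ be open and connected (i.e. $\bar\Omega$ is compact and contained in $U$). Sobolev spaces. The formal adjoint of $X_i$ is $X_i^*\varphi=-\sum_k\partial_{x_k}(b_{ik}\varphi)$. For $f\in L^1_{loc}(\Omega)$, $X_if=g\in L^1_{loc}(\Omega)$ means $\int_\Omega g\varphi\,dx=\int_\Omega f X_i^*\varphi\,dx$ for all $\varphi\in C_0^\infty(\Omega)$. $Xf=(X_1f,\dots,X_mf)$,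 $|Xf|=(\sum_i (X_if)^2)^{1/2}$. $\mathcal{W}^{1,p}_X(\Omega)=\{f\in L^p(\Omega): X_if\in L^p(\Omega),\ i=1,\dots,m\}$ with norm $(\int_\Omega(|u|^p+|Xu|^p)dx)^{1/p}$, and $\mathcal{W}^{1,p}_{X,0}(\Omega)$ is the closure of $C_0^\infty(\Omega)$ in $\mathcal{W}^{1,p}_X(\Omega)$. All functions are real-valued. Eigenpairs. $u\in \mathcal{W}^{1,p}_{X,0}(\Omega)\setminus\{0\}$ is an eigenfunction with eigenvalue $\lambda\in\mathbb{R}$ (of the Dirichlet problem $\sum_i X_i^*(|Xu|^{p-2}X_iu)=\lambda|u|^{p-2}u$ in $\Omega$, $u=0$ on $\partial\Omega$) if $\int_\Omega |Xu|^{p-2}Xu\cdot X\varphi\,dx=\lambda\int_\Omega|u|^{p-2}u\varphi\,dx$ for all $\varphi\in \mathcal{W}^{1,p}_{X,0}(\Omega)$. Expressions $|w|^{p-2}w$ are read as $0$ where $w=0$. Convention: eigenfunctions are identified with their continuous representatives in $\Omega$. *)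

theory Defs
  imports "HOL-Analysis.Analysis"
begin

definition partial :: "'n \<Rightarrow> (real ^ 'n \<Rightarrow> real) \<Rightarrow> real ^ 'n \<Rightarrow> real" where
  "partial k f x = frechet_derivative f (at x) (axis k 1)"

text \<open>Intended for open \<open>S\<close>, since \<^const>\<open>partial\<close> is the derivative at a point of the whole space.\<close>

primrec Ck_on :: "nat \<Rightarrow> (real ^ 'n) set \<Rightarrow> (real ^ 'n \<Rightarrow> real) \<Rightarrow> bool" where
  "Ck_on 0 S f \<longleftrightarrow> continuous_on S f"
| "Ck_on (Suc r) S f \<longleftrightarrow> (\<forall>x\<in>S. f differentiable (at x)) \<and> (\<forall>k. Ck_on r S (partial k f))"

definition smooth_on :: "(real ^ 'n) set \<Rightarrow> (real ^ 'n \<Rightarrow> real) \<Rightarrow> bool" where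
  "smooth_on S f \<longleftrightarrow> (\<forall>r. Ck_on r S f)"

text \<open>
  A family \<open>X\<^sub>i = (\<Sum>k. b\<^sub>i\<^sub>k \<partial>\<^sub>k)\<close> of vector fields, indexed by a finite type \<open>'m\<close>, is given by
  its coefficients \<open>b i x $ k\<close>.
\<close>

type_synonym ('m, 'n) vfields = "'m \<Rightarrow> real ^ 'n \<Rightarrow> real ^ 'n"

definition smooth_fields :: "(real ^ 'n) set \<Rightarrow> ('m, 'n) vfields \<Rightarrow> bool" where
  "smooth_fields U b \<longleftrightarrow> (\<forall>i k. smooth_on U (\<lambda>x. b i x $ k))"

text \<open>
  The \<open>k\<close>-th coefficient of \<open>[Y, Z]\<close> is \<open>Y(Z\<^sub>k) - Z(Y\<^sub>k)\<close>.
\<close>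

definition lie_bracket ::
  "(real ^ 'n \<Rightarrow> real ^ 'n) \<Rightarrow> (real ^ 'n \<Rightarrow> real ^ 'n) \<Rightarrow> real ^ 'n \<Rightarrow> real ^ 'n" where
  "lie_bracket Y Z x = (\<chi> k. (\<Sum>l\<in>UNIV. Y x $ l * partial l (\<lambda>y. Z y $ k) x)
                          - (\<Sum>l\<in>UNIV. Z x $ l * partial l (\<lambda>y. Y y $ k) x))"

text \<open>The value on the empty list is never used: only nonempty multi-indices occur below.\<close>

fun iter_comm :: "('m, 'n) vfields \<Rightarrow> 'm list \<Rightarrow> real ^ 'n \<Rightarrow> real ^ 'n" where
  "iter_comm b [] = (\<lambda>x. 0)"
| "iter_comm b [j] = b j"
| "iter_comm b (j # j' # J) = lie_bracket (b j) (iter_comm b (j' # J))"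

definition commutators_span :: "(real ^ 'n) set \<Rightarrow> ('m, 'n) vfields \<Rightarrow> nat \<Rightarrow> bool" where
  "commutators_span U b r \<longleftrightarrow>
     (\<forall>x\<in>U. span {iter_comm b J x | J. J \<noteq> [] \<and> length J \<le> r} = UNIV)"

definition hormander_step :: "(real ^ 'n) set \<Rightarrow> ('m, 'n) vfields \<Rightarrow> nat \<Rightarrow> bool" where
  "hormander_step U b s \<longleftrightarrow> commutators_span U b s \<and> (\<forall>r<s. \<not> commutators_span U b r)"

definition test_fun :: "(real ^ 'n) set \<Rightarrow> (real ^ 'n \<Rightarrow> real) \<Rightarrow> bool" where
  "test_fun \<Omega> \<phi> \<longleftrightarrow> smooth_on UNIV \<phi> \<and> (\<exists>K. compact K \<and> K \<subseteq> \<Omega> \<and> (\<forall>x. x \<notin> K \<longrightarrow> \<phi> x = 0))"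

definition adjoint_X :: "('m, 'n::finite) vfields \<Rightarrow> 'm \<Rightarrow> (real ^ 'n \<Rightarrow> real) \<Rightarrow> real ^ 'n \<Rightarrow> real" where
  "adjoint_X b i \<phi> x = - (\<Sum>k\<in>UNIV. partial k (\<lambda>y. b i y $ k * \<phi> y) x)"

definition L1_loc :: "(real ^ 'n) set \<Rightarrow> (real ^ 'n \<Rightarrow> real) \<Rightarrow> bool" where
  "L1_loc \<Omega> f \<longleftrightarrow> (\<forall>K. compact K \<and> K \<subseteq> \<Omega> \<longrightarrow> set_integrable lebesgue K f)"

definition Lp :: "real \<Rightarrow> (real ^ 'n) set \<Rightarrow> (real ^ 'n \<Rightarrow> real) \<Rightarrow> bool" where
  "Lp p \<Omega> f \<longleftrightarrow> set_borel_measurable lebesgue \<Omega> f \<and>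
     set_integrable lebesgue \<Omega> (\<lambda>x. \<bar>f x\<bar> powr p)"

definition has_weak_X ::
  "('m, 'n::finite) vfields \<Rightarrow> (real ^ 'n) set \<Rightarrow> 'm \<Rightarrow> (real ^ 'n \<Rightarrow> real) \<Rightarrow> (real ^ 'n \<Rightarrow> real) \<Rightarrow> bool"
where
  "has_weak_X b \<Omega> i f g \<longleftrightarrow> L1_loc \<Omega> f \<and> L1_loc \<Omega> g \<and>
     (\<forall>\<phi>. test_fun \<Omega> \<phi> \<longrightarrow>
        (LINT x:\<Omega>|lebesgue. g x * \<phi> x) = (LINT x:\<Omega>|lebesgue. f x * adjoint_X b i \<phi> x))"

text \<open>
  Functions are not identified when they agree almost everywhere, so \<open>X\<^sub>i f\<close> is some
  representative; every notion below is insensitive to the choice. It is only meaningful if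
  \<open>f\<close> has a weak derivative along \<open>X\<^sub>i\<close>.
\<close>

definition weak_X ::
  "('m, 'n::finite) vfields \<Rightarrow> (real ^ 'n) set \<Rightarrow> 'm \<Rightarrow> (real ^ 'n \<Rightarrow> real) \<Rightarrow> real ^ 'n \<Rightarrow> real" where
  "weak_X b \<Omega> i f = (SOME g. has_weak_X b \<Omega> i f g)"

definition grad_X ::
  "('m::finite, 'n::finite) vfields \<Rightarrow> (real ^ 'n) set \<Rightarrow> (real ^ 'n \<Rightarrow> real) \<Rightarrow> real ^ 'n \<Rightarrow> real ^ 'm"
where
  "grad_X b \<Omega> f x = (\<chi> i. weak_X b \<Omega> i f x)"

definition W1p :: "('m, 'n::finite) vfields \<Rightarrow> real \<Rightarrow> (real ^ 'n) set \<Rightarrow> (real ^ 'n \<Rightarrow> real) set" where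
  "W1p b p \<Omega> = {f. Lp p \<Omega> f \<and> (\<forall>i. \<exists>g. has_weak_X b \<Omega> i f g \<and> Lp p \<Omega> g)}"

definition W1p_norm ::
  "('m::finite, 'n::finite) vfields \<Rightarrow> real \<Rightarrow> (real ^ 'n) set \<Rightarrow> (real ^ 'n \<Rightarrow> real) \<Rightarrow> real" where
  "W1p_norm b p \<Omega> u =
     (LINT x:\<Omega>|lebesgue. \<bar>u x\<bar> powr p + norm (grad_X b \<Omega> u x) powr p) powr (1 / p)"

definition W1p0 ::
  "('m::finite, 'n::finite) vfields \<Rightarrow> real \<Rightarrow> (real ^ 'n) set \<Rightarrow> (real ^ 'n \<Rightarrow> real) set" where
  "W1p0 b p \<Omega> = {f \<in> W1p b p \<Omega>.
     \<forall>\<epsilon>>0. \<exists>\<phi>. test_fun \<Omega> \<phi> \<and> W1p_norm b p \<Omega> (\<lambda>x. f x - \<phi> x) < \<epsilon>}"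

definition nonzero_on :: "(real ^ 'n) set \<Rightarrow> (real ^ 'n \<Rightarrow> real) \<Rightarrow> bool" where
  "nonzero_on \<Omega> u \<longleftrightarrow> \<not> (AE x in lebesgue. x \<in> \<Omega> \<longrightarrow> u x = 0)"

text \<open>
  Since \<open>0 powr a = 0\<close> for every \<open>a\<close>, the expressions \<open>|w|\<^sup>p\<^sup>-\<^sup>2 w\<close> are \<open>0\<close> where \<open>w = 0\<close>,
  also for \<open>p < 2\<close>.
\<close>

definition eigenfunction ::
  "('m::finite, 'n::finite) vfields \<Rightarrow> real \<Rightarrow> (real ^ 'n) set \<Rightarrow> real \<Rightarrow> (real ^ 'n \<Rightarrow> real) \<Rightarrow> bool" where
  "eigenfunction b p \<Omega> ev u \<longleftrightarrow> u \<in> W1p0 b p \<Omega> \<and> nonzero_on \<Omega> u \<and>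
     (\<forall>\<phi>\<in>W1p0 b p \<Omega>.
        (LINT x:\<Omega>|lebesgue.
           norm (grad_X b \<Omega> u x) powr (p - 2) * (grad_X b \<Omega> u x \<bullet> grad_X b \<Omega> \<phi> x))
        = ev * (LINT x:\<Omega>|lebesgue. \<bar>u x\<bar> powr (p - 2) * u x * \<phi> x))"

definition lambda1 ::
  "('m::finite, 'n::finite) vfields \<Rightarrow> real \<Rightarrow> (real ^ 'n) set \<Rightarrow> real" where
  "lambda1 b p \<Omega> =
     (INF v \<in> {v \<in> W1p0 b p \<Omega>. nonzero_on \<Omega> v}.
        (LINT x:\<Omega>|lebesgue. norm (grad_X b \<Omega> v x) powr p) / (LINT x:\<Omega>|lebesgue. \<bar>v x\<bar> powr p))"

end

theory Submission
  imports Defs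
begin

text \<open>
  The energy \<open>E(u) = \<integral>|Xu|\<^sup>p\<close> is convex along the curves \<open>w = (u\<^sup>p + v\<^sup>p)\<^sup>1\<^sup>/\<^sup>p\<close>: pointwise
  \<open>|Xw|\<^sup>p \<le> |Xu|\<^sup>p + |Xv|\<^sup>p\<close>, with equality only where \<open>Xu / u = Xv / v\<close>. If \<open>u\<close> and \<open>v\<close> are
  first eigenfunctions, then
  \<open>E(u) + E(v) = \<lambda>\<^sub>1 \<integral>(u\<^sup>p + v\<^sup>p) = \<lambda>\<^sub>1 \<integral>w\<^sup>p \<le> E(w)\<close>, so equality holds almost everywhere and
  \<open>h = ln u - ln v\<close> satisfies \<open>X\<^sub>i h = 0\<close> weakly for all \<open>i\<close>. The fields annihilating \<open>h\<close> weakly are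
  closed under Lie brackets and under multiplication by smooth functions; by the Hoermander
  condition they contain \<open>\<partial>\<^sub>1, \<dots>, \<partial>\<^sub>n\<close> locally, hence \<open>h\<close> is constant on the connected set \<open>\<Omega>\<close>.

  Nothing is needed about \<open>w\<close> as a Sobolev function: the inequality \<open>\<lambda>\<^sub>1 \<integral>w\<^sup>p \<le> E(w)\<close> is the limit of
  the same inequality for smooth regularisations of \<open>w\<close> built from test functions approximating
  \<open>u\<close> and \<open>v\<close>.
\<close>

section \<open>Smooth functions and test functions\<close>

text \<open>The eigenvalue equation enters only through the energy identity, that is, each
  eigenfunction tested with itself; everything else about \<lambda>_1 is minimality. A comparison by
  quotients such as v^p / u^(p-1) would need control of u near the boundary of \<Omega>, whereas w
  involves no division by u or v. Division occurs only afterwards, in ln u and ln v, and there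
  compact subsets of \<Omega> suffice, on which continuity bounds u and v away from 0. The energy is
  strictly convex only up to proportionality: its equality case compares Xu / u with Xv / v, which
  is why logarithms appear. The difference h of the logarithms is continuous, but nothing is known
  about its derivatives beyond the weak X_i h, so a commutator cannot be applied to h itself. A
  field Y is said to annihilate h if the integral of h div(\<psi> Y) vanishes for every test
  function \<psi>; in this dual form brackets and smooth factors act on smooth functions
  only.\<close>

lemma partial_eqI: "(f has_derivative f') (at x) \<Longrightarrow> partial k f x = f' (axis k 1)"
  unfolding partial_def by (metis frechet_derivative_at)

lemma partial_cong:
  fixes f :: "real ^ 'n::finite \<Rightarrow> real"
  assumes "open S" "x \<in> S" "\<And>y. y \<in> S \<Longrightarrow> f y = g y" "f differentiable (at x)"
  shows "partial k f x = partial k g x" "g differentiable (at x)"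
proof -
  obtain f' where f': "(f has_derivative f') (at x)"
    using assms(4) unfolding differentiable_def by blast
  then have "(g has_derivative f') (at x)"
    using assms has_derivative_transform_within_open by blast
  then show "partial k f x = partial k g x" "g differentiable (at x)"
    using f' by (auto simp: partial_eqI differentiable_def)
qed

lemma partial_const [simp]: "partial k (\<lambda>x. c) = (\<lambda>x::real ^ 'n::finite. 0)"
  by (rule ext, subst partial_eqI[where f' = "\<lambda>_. 0"]) auto

lemma partial_add:
  fixes f :: "real ^ 'n::finite \<Rightarrow> real"
  assumes "f differentiable (at x)" "g differentiable (at x)"
  shows "partial k (\<lambda>y. f y + g y) x = partial k f x + partial k g x"
proof -
  obtain f' g' where *: "(f has_derivative f') (at x)" "(g has_derivative g') (at x)"
    using assms unfolding differentiable_def by blast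
  show ?thesis
    by (simp add: partial_eqI[OF has_derivative_add[OF *]] partial_eqI[OF *(1)] partial_eqI[OF *(2)])
qed

lemma partial_mult:
  fixes f :: "real ^ 'n::finite \<Rightarrow> real"
  assumes "f differentiable (at x)" "g differentiable (at x)"
  shows "partial k (\<lambda>y. f y * g y) x = f x * partial k g x + partial k f x * g x"
proof -
  obtain f' g' where *: "(f has_derivative f') (at x)" "(g has_derivative g') (at x)"
    using assms unfolding differentiable_def by blast
  show ?thesis
    by (simp add: partial_eqI[OF has_derivative_mult[OF *]] partial_eqI[OF *(1)] partial_eqI[OF *(2)])
qed

lemma has_derivative_comp_real:
  fixes f :: "real ^ 'n::finite \<Rightarrow> real"
  assumes "f differentiable (at x)" "(g has_real_derivative D) (at (f x))"
  shows "((\<lambda>y. g (f y)) has_derivative (\<lambda>v. D * frechet_derivative f (at x) v)) (at x)"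
proof -
  have "(f has_derivative frechet_derivative f (at x)) (at x)"
    using assms(1) by (simp add: frechet_derivative_works)
  from has_derivative_compose[OF this, of g "\<lambda>h. D * h"] assms(2)
  show ?thesis by (simp add: has_field_derivative_def)
qed

lemma partial_comp:
  fixes f :: "real ^ 'n::finite \<Rightarrow> real"
  assumes "f differentiable (at x)" "(g has_real_derivative D) (at (f x))"
  shows "partial k (\<lambda>y. g (f y)) x = D * partial k f x"
  using partial_eqI[OF has_derivative_comp_real[OF assms]] by (simp add: partial_def)

lemma differentiable_comp_real:
  fixes f :: "real ^ 'n::finite \<Rightarrow> real"
  assumes "f differentiable (at x)" "(g has_real_derivative D) (at (f x))"
  shows "(\<lambda>y. g (f y)) differentiable (at x)"
  using has_derivative_comp_real[OF assms] unfolding differentiable_def by blast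

lemma Ck_on_cong:
  fixes f :: "real ^ 'n::finite \<Rightarrow> real"
  assumes "open S" "\<And>x. x \<in> S \<Longrightarrow> f x = g x" "Ck_on r S f"
  shows "Ck_on r S g"
  using assms(2,3)
proof (induction r arbitrary: f g)
  case 0
  then show ?case using continuous_on_cong by force
next
  case (Suc r)
  have "g differentiable (at x)" "partial k f x = partial k g x" if "x \<in> S" for x k
    using partial_cong[OF assms(1) that, of f g] Suc.prems that by auto
  moreover have "Ck_on r S (partial k g)" for k
    using calculation Suc.IH[of "partial k f" "partial k g"] Suc.prems by simp
  ultimately show ?case by simp
qed

lemma Ck_on_pred:
  fixes f :: "real ^ 'n::finite \<Rightarrow> real"
  shows "Ck_on (Suc r) S f \<Longrightarrow> Ck_on r S f"
proof (induction r arbitrary: f)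
  case 0
  then show ?case
    by (simp add: continuous_at_imp_continuous_on differentiable_imp_continuous_within)
next
  case (Suc r)
  then show ?case by simp
qed

lemma Ck_on_subset:
  fixes f :: "real ^ 'n::finite \<Rightarrow> real"
  shows "Ck_on r S f \<Longrightarrow> T \<subseteq> S \<Longrightarrow> Ck_on r T f"
  by (induction r arbitrary: f) (auto intro: continuous_on_subset)

lemma Ck_on_Un:
  fixes f :: "real ^ 'n::finite \<Rightarrow> real"
  assumes "open S" "open T"
  shows "Ck_on r S f \<Longrightarrow> Ck_on r T f \<Longrightarrow> Ck_on r (S \<union> T) f"
  by (induction r arbitrary: f) (use assms in \<open>auto intro: continuous_on_open_Un\<close>)

lemma Ck_on_const: "Ck_on r S (\<lambda>x::real ^ 'n::finite. c)"
  by (induction r arbitrary: c) auto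

lemma Ck_on_add:
  fixes f :: "real ^ 'n::finite \<Rightarrow> real"
  assumes "open S"
  shows "Ck_on r S f \<Longrightarrow> Ck_on r S g \<Longrightarrow> Ck_on r S (\<lambda>x. f x + g x)"
proof (induction r arbitrary: f g)
  case (Suc r)
  have "Ck_on r S (partial k (\<lambda>x. f x + g x))" for k
    by (rule Ck_on_cong[OF assms, of "\<lambda>x. partial k f x + partial k g x"])
      (use Suc in \<open>auto simp: partial_add\<close>)
  then show ?case using Suc.prems by auto
qed (auto intro: continuous_intros)

lemma Ck_on_mult:
  fixes f :: "real ^ 'n::finite \<Rightarrow> real"
  assumes "open S"
  shows "Ck_on r S f \<Longrightarrow> Ck_on r S g \<Longrightarrow> Ck_on r S (\<lambda>x. f x * g x)"
proof (induction r arbitrary: f g)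
  case (Suc r)
  have "Ck_on r S f" "Ck_on r S g"
    using Suc.prems Ck_on_pred by blast+
  then have *: "Ck_on r S (\<lambda>x. f x * partial k g x + partial k f x * g x)" for k
    using Suc.prems Ck_on_add[OF assms Suc.IH[of f "partial k g"] Suc.IH[of "partial k f" g]] by simp
  have "Ck_on r S (partial k (\<lambda>x. f x * g x))" for k
    by (rule Ck_on_cong[OF assms _ *[of k]]) (use Suc.prems in \<open>simp add: partial_mult\<close>)
  then show ?case using Suc.prems by auto
qed (auto intro: continuous_intros)

text \<open>The whole sequence of derivatives is carried as a witness, so that the chain rule can
  pass from one member to the next without iterating a derivative operator on a proper subset of the
  line.\<close>

definition smooth_real :: "real set \<Rightarrow> (real \<Rightarrow> real) \<Rightarrow> bool" where
  "smooth_real I g \<longleftrightarrow> (\<exists>D. D 0 = g \<and> (\<forall>n. \<forall>x\<in>I. (D n has_real_derivative D (Suc n) x) (at x)))"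

text \<open>The derivative of \<open>D n (f x)\<close> is \<open>D (Suc n) (f x)\<close> times a
  partial derivative of f: the index in the sequence rises while the number of required derivatives
  falls, so the induction on r leaves n arbitrary. The assumption on f is kept at all orders, since
  f is the inner function at every stage.\<close>

lemma Ck_on_comp:
  fixes f :: "real ^ 'n::finite \<Rightarrow> real"
  assumes "open S" "\<And>n x. x \<in> I \<Longrightarrow> (D n has_real_derivative D (Suc n) x) (at x)"
    "\<And>x. x \<in> S \<Longrightarrow> f x \<in> I"
  shows "(\<And>r. Ck_on r S f) \<Longrightarrow> Ck_on r S (\<lambda>x. D n (f x))"
proof (induction r arbitrary: n)
  case 0
  have "\<forall>x\<in>S. isCont f x" using "0.prems"[of 1] by (auto intro: differentiable_imp_continuous_within)
  moreover have "\<forall>x\<in>S. isCont (D n) (f x)"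
    using assms(2,3) DERIV_isCont by blast
  ultimately have "\<forall>x\<in>S. isCont (\<lambda>x. D n (f x)) x"
    using continuous_within_compose2 isCont_o2 by fast
  then show ?case by (auto simp: continuous_at_imp_continuous_on)
next
  case (Suc r)
  have df: "f differentiable (at x)" if "x \<in> S" for x
    using Suc.prems[of 1] that by auto
  have "Ck_on r S (partial k (\<lambda>x. D n (f x)))" for k
  proof (rule Ck_on_cong[OF assms(1), of "\<lambda>x. D (Suc n) (f x) * partial k f x"])
    show "D (Suc n) (f x) * partial k f x = partial k (\<lambda>x. D n (f x)) x" if "x \<in> S" for x
      using partial_comp[OF df[OF that] assms(2)[OF assms(3)[OF that], of n], of k] by simp
    show "Ck_on r S (\<lambda>x. D (Suc n) (f x) * partial k f x)"
      using Suc.prems[of "Suc r"] by (intro Ck_on_mult assms Suc.IH Suc.prems) auto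
  qed
  moreover have "(\<lambda>x. D n (f x)) differentiable (at x)" if "x \<in> S" for x
    by (rule differentiable_comp_real[OF df[OF that] assms(2)[OF assms(3)[OF that]]])
  ultimately show ?case by auto
qed

lemma smooth_on_cong:
  fixes f :: "real ^ 'n::finite \<Rightarrow> real"
  shows "open S \<Longrightarrow> (\<And>x. x \<in> S \<Longrightarrow> f x = g x) \<Longrightarrow> smooth_on S f \<Longrightarrow> smooth_on S g"
  unfolding smooth_on_def using Ck_on_cong by blast

lemma smooth_on_subset:
  fixes f :: "real ^ 'n::finite \<Rightarrow> real"
  shows "smooth_on S f \<Longrightarrow> T \<subseteq> S \<Longrightarrow> smooth_on T f"
  unfolding smooth_on_def using Ck_on_subset by blast

lemma smooth_on_Un:
  fixes f :: "real ^ 'n::finite \<Rightarrow> real"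
  shows "open S \<Longrightarrow> open T \<Longrightarrow> smooth_on S f \<Longrightarrow> smooth_on T f \<Longrightarrow> smooth_on (S \<union> T) f"
  unfolding smooth_on_def using Ck_on_Un by blast

lemma smooth_on_const: "smooth_on S (\<lambda>x::real ^ 'n::finite. c)"
  unfolding smooth_on_def using Ck_on_const by blast

lemma smooth_on_add:
  fixes f :: "real ^ 'n::finite \<Rightarrow> real"
  shows "open S \<Longrightarrow> smooth_on S f \<Longrightarrow> smooth_on S g \<Longrightarrow> smooth_on S (\<lambda>x. f x + g x)"
  unfolding smooth_on_def using Ck_on_add by blast

lemma smooth_on_mult:
  fixes f :: "real ^ 'n::finite \<Rightarrow> real"
  shows "open S \<Longrightarrow> smooth_on S f \<Longrightarrow> smooth_on S g \<Longrightarrow> smooth_on S (\<lambda>x. f x * g x)"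
  unfolding smooth_on_def using Ck_on_mult by blast

lemma smooth_on_uminus:
  fixes f :: "real ^ 'n::finite \<Rightarrow> real"
  shows "open S \<Longrightarrow> smooth_on S f \<Longrightarrow> smooth_on S (\<lambda>x. - f x)"
  using smooth_on_mult[of S "\<lambda>_. -1" f] by (simp add: smooth_on_const)

lemma smooth_on_diff:
  fixes f :: "real ^ 'n::finite \<Rightarrow> real"
  shows "open S \<Longrightarrow> smooth_on S f \<Longrightarrow> smooth_on S g \<Longrightarrow> smooth_on S (\<lambda>x. f x - g x)"
  using smooth_on_add[of S f "\<lambda>x. - g x"] by (simp add: smooth_on_uminus)

lemma smooth_on_sum:
  fixes f :: "'a \<Rightarrow> real ^ 'n::finite \<Rightarrow> real"
  assumes "open S"
  shows "(\<And>i. i \<in> I \<Longrightarrow> smooth_on S (f i)) \<Longrightarrow> smooth_on S (\<lambda>x. \<Sum>i\<in>I. f i x)"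
  by (induction I rule: infinite_finite_induct) (auto intro: smooth_on_const smooth_on_add assms)

lemma smooth_on_prod:
  fixes f :: "'a \<Rightarrow> real ^ 'n::finite \<Rightarrow> real"
  assumes "open S"
  shows "(\<And>i. i \<in> I \<Longrightarrow> smooth_on S (f i)) \<Longrightarrow> smooth_on S (\<lambda>x. \<Prod>i\<in>I. f i x)"
  by (induction I rule: infinite_finite_induct) (auto intro: smooth_on_const smooth_on_mult assms)

lemma smooth_on_comp:
  fixes f :: "real ^ 'n::finite \<Rightarrow> real"
  assumes "open S" "smooth_real I g" "\<And>x. x \<in> S \<Longrightarrow> f x \<in> I" "smooth_on S f"
  shows "smooth_on S (\<lambda>x. g (f x))"
proof -
  obtain D where D: "D 0 = g" "\<And>n x. x \<in> I \<Longrightarrow> (D n has_real_derivative D (Suc n) x) (at x)"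
    using assms(2) unfolding smooth_real_def by blast
  show ?thesis
    unfolding smooth_on_def D(1)[symmetric]
    using Ck_on_comp[where D = D and I = I and n = 0, OF assms(1) D(2) assms(3)] assms(4)
    by (simp add: smooth_on_def)
qed

lemma smooth_on_partial: "smooth_on S f \<Longrightarrow> smooth_on S (partial k f)"
  unfolding smooth_on_def by (metis Ck_on.simps(2))

lemma smooth_on_differentiable: "smooth_on S f \<Longrightarrow> x \<in> S \<Longrightarrow> f differentiable (at x)"
  unfolding smooth_on_def by (metis Ck_on.simps(2))

lemma smooth_on_imp_continuous_on: "smooth_on S f \<Longrightarrow> continuous_on S f"
  unfolding smooth_on_def by (metis Ck_on.simps(1))

lemma smooth_on_nth: "smooth_on S (\<lambda>x::real ^ 'n::finite. x $ j)"
proof -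
  have *: "((\<lambda>x::real ^ 'n. x $ j) has_derivative (\<lambda>v. v $ j)) (at x)" for x
    by (auto intro!: derivative_eq_intros bounded_linear_imp_has_derivative bounded_linear_vec_nth)
  have **: "partial k (\<lambda>x::real ^ 'n. x $ j) = (\<lambda>x. axis k 1 $ j)" for k
    by (rule ext) (rule partial_eqI[OF *])
  show ?thesis unfolding smooth_on_def
  proof
    fix r show "Ck_on r S (\<lambda>x::real ^ 'n. x $ j)"
      by (cases r) (auto simp: ** intro: Ck_on_const continuous_intros differentiableI[OF *])
  qed
qed

section \<open>Smooth functions of one real variable\<close>

lemma smooth_real_powr: "smooth_real {0<..} (\<lambda>x. x powr a)"
  unfolding smooth_real_def
proof (intro exI conjI allI ballI)
  let ?D = "\<lambda>n x. (\<Prod>i<n. a - real i) * x powr (a - real n)"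
  show "?D 0 = (\<lambda>x. x powr a)" by simp
  show "(?D n has_real_derivative ?D (Suc n) x) (at x)" if "x \<in> {0<..}" for n x
    using that by (auto intro!: derivative_eq_intros simp: algebra_simps)
qed

lemma smooth_real_inverse: "smooth_real (- {0}) inverse"
  unfolding smooth_real_def
proof (intro exI conjI allI ballI)
  let ?D = "\<lambda>n x::real. (\<Prod>i<n. - (1 + real i)) * inverse x ^ (Suc n)"
  show "?D 0 = inverse" by auto
  show "(?D n has_real_derivative ?D (Suc n) x) (at x)" if "x \<in> - {0}" for n x
  proof -
    have "((\<lambda>x. inverse x ^ Suc n) has_real_derivative - (1 + real n) * inverse x ^ Suc (Suc n)) (at x)"
      using that by (auto intro!: derivative_eq_intros simp: algebra_simps simp flip: power_Suc)
    from DERIV_cmult[OF this, of "\<Prod>i<n. - (1 + real i)"] show ?thesis by (simp add: algebra_simps)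
  qed
qed

lemma smooth_real_ln: "smooth_real {0<..} ln"
  unfolding smooth_real_def
proof -
  obtain D where D: "D 0 = inverse" "\<And>n x. x \<in> - {0} \<Longrightarrow> (D n has_real_derivative D (Suc n) x) (at x)"
    using smooth_real_inverse unfolding smooth_real_def by blast
  let ?E = "\<lambda>n. case n of 0 \<Rightarrow> ln | Suc m \<Rightarrow> D m"
  have "(?E n has_real_derivative ?E (Suc n) x) (at x)" if "x \<in> {0<..}" for n x
    using that D(2) by (auto split: nat.splits simp: D(1) DERIV_ln)
  then show "\<exists>D. D 0 = ln \<and> (\<forall>n. \<forall>x\<in>{0<..}. (D n has_real_derivative D (Suc n) x) (at x))"
    by (intro exI[of _ ?E]) auto
qed

section \<open>Directional derivatives and symmetry of mixed partial derivatives\<close>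

lemma differentiable_direction:
  fixes f :: "real ^ 'n::finite \<Rightarrow> real"
  assumes "f differentiable (at (x + t *\<^sub>R v))"
  shows "((\<lambda>t. f (x + t *\<^sub>R v)) has_real_derivative (\<Sum>k\<in>UNIV. v $ k * partial k f (x + t *\<^sub>R v))) (at t)"
proof -
  let ?D = "frechet_derivative f (at (x + t *\<^sub>R v))"
  have f: "(f has_derivative ?D) (at (x + t *\<^sub>R v))"
    using assms by (simp add: frechet_derivative_works)
  then interpret linear ?D by (rule has_derivative_linear)
  have "?D v = ?D (\<Sum>k\<in>UNIV. v $ k *\<^sub>R axis k 1)"
    by (simp add: basis_expansion[of v, unfolded vector_scalar_mult_def scalar_mult_eq_scaleR])
  also have "\<dots> = (\<Sum>k\<in>UNIV. v $ k * partial k f (x + t *\<^sub>R v))"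
    by (simp add: sum scale partial_def)
  finally have *: "?D v = (\<Sum>k\<in>UNIV. v $ k * partial k f (x + t *\<^sub>R v))" .
  have "((\<lambda>t. x + t *\<^sub>R v) has_derivative (\<lambda>s. s *\<^sub>R v)) (at t)"
    by (auto intro!: derivative_eq_intros)
  from has_derivative_compose[OF this f]
  have "((\<lambda>t. f (x + t *\<^sub>R v)) has_derivative (\<lambda>s. s *\<^sub>R ?D v)) (at t)"
    by (simp add: scale)
  then show ?thesis
    by (simp add: has_field_derivative_def * mult.commute[of _ "sum _ _"])
qed

lemma differentiable_direction_axis:
  fixes f :: "real ^ 'n::finite \<Rightarrow> real"
  assumes "f differentiable (at (x + t *\<^sub>R axis k 1))"
  shows "((\<lambda>t. f (x + t *\<^sub>R axis k 1)) has_real_derivative partial k f (x + t *\<^sub>R axis k 1)) (at t)"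
proof -
  have "(\<Sum>j\<in>UNIV. (axis k 1 :: real ^ 'n) $ j * partial j f y) = partial k f y" for y
    by (subst sum.remove[of _ k]) (auto simp: axis_def intro!: sum.neutral)
  with differentiable_direction[OF assms] show ?thesis by simp
qed

text \<open>Preparation for the symmetry of mixed derivatives: the second difference is symmetric in
  k and l. The mean value theorem is used along k, for the difference of two values of f displaced
  along l, and then along l for \<open>partial k f\<close>.\<close>

lemma second_difference:
  fixes f :: "real ^ 'n::finite \<Rightarrow> real"
  assumes "smooth_on UNIV f" "0 < h"
  shows "\<exists>\<theta> \<eta>. 0 < \<theta> \<and> \<theta> < h \<and> 0 < \<eta> \<and> \<eta> < h \<and>
    f (x + h *\<^sub>R axis k 1 + h *\<^sub>R axis l 1) - f (x + h *\<^sub>R axis k 1) - f (x + h *\<^sub>R axis l 1) + f x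
      = h\<^sup>2 * partial l (partial k f) (x + \<theta> *\<^sub>R axis k 1 + \<eta> *\<^sub>R axis l 1)"
proof -
  let ?e = "axis k 1 :: real ^ 'n" and ?e' = "axis l 1 :: real ^ 'n"
  let ?G = "\<lambda>s. f (x + h *\<^sub>R ?e' + s *\<^sub>R ?e) - f (x + s *\<^sub>R ?e)"
  have d: "f differentiable (at y)" "partial k f differentiable (at y)" for y
    using assms(1) smooth_on_differentiable smooth_on_partial by blast+
  have "\<exists>\<theta>. 0 < \<theta> \<and> \<theta> < h \<and> ?G h - ?G 0
      = (h - 0) * (partial k f (x + h *\<^sub>R ?e' + \<theta> *\<^sub>R ?e) - partial k f (x + \<theta> *\<^sub>R ?e))"
    by (rule MVT2[OF assms(2)]) (intro DERIV_diff differentiable_direction_axis d)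
  then obtain \<theta> where \<theta>: "0 < \<theta>" "\<theta> < h" "?G h - ?G 0
      = h * (partial k f (x + h *\<^sub>R ?e' + \<theta> *\<^sub>R ?e) - partial k f (x + \<theta> *\<^sub>R ?e))" by auto
  have "\<exists>\<eta>. 0 < \<eta> \<and> \<eta> < h \<and> partial k f (x + \<theta> *\<^sub>R ?e + h *\<^sub>R ?e') - partial k f (x + \<theta> *\<^sub>R ?e + 0 *\<^sub>R ?e')
      = (h - 0) * partial l (partial k f) (x + \<theta> *\<^sub>R ?e + \<eta> *\<^sub>R ?e')"
    by (rule MVT2[OF assms(2)]) (intro differentiable_direction_axis d)
  then obtain \<eta> where \<eta>: "0 < \<eta>" "\<eta> < h" "partial k f (x + h *\<^sub>R ?e' + \<theta> *\<^sub>R ?e) - partial k f (x + \<theta> *\<^sub>R ?e)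
      = h * partial l (partial k f) (x + \<theta> *\<^sub>R ?e + \<eta> *\<^sub>R ?e')" by (auto simp: add_ac)
  have "?G h - ?G 0 = h\<^sup>2 * partial l (partial k f) (x + \<theta> *\<^sub>R ?e + \<eta> *\<^sub>R ?e')"
    unfolding \<theta>(3) \<eta>(3) by (simp add: power2_eq_square)
  moreover have "x + h *\<^sub>R ?e' + h *\<^sub>R ?e = x + h *\<^sub>R ?e + h *\<^sub>R ?e'" by simp
  ultimately show ?thesis
    using \<theta>(1,2) \<eta>(1,2) by (intro exI[of _ \<theta>] exI[of _ \<eta>]) simp
qed

text \<open>Reading the symmetric second difference in both orders gives, after division by h^2,
  equal values of the two mixed derivatives at two points whose distance to x tends to 0 with h.
  Continuity carries both to x.\<close>

lemma partial_commute:
  fixes f :: "real ^ 'n::finite \<Rightarrow> real"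
  assumes "smooth_on UNIV f"
  shows "partial k (partial l f) x = partial l (partial k f) x"
proof -
  let ?h = "\<lambda>n. inverse (real (Suc n))"
  have lim: "(\<lambda>n. partial j (partial i f) (x + \<theta> n *\<^sub>R axis i 1 + \<eta> n *\<^sub>R axis j 1))
      \<longlonglongrightarrow> partial j (partial i f) x"
    if "\<And>n. 0 < \<theta> n \<and> \<theta> n < ?h n \<and> 0 < \<eta> n \<and> \<eta> n < ?h n" for \<theta> \<eta> :: "nat \<Rightarrow> real" and i j
  proof -
    have 0: "\<theta> \<longlonglongrightarrow> 0" "\<eta> \<longlonglongrightarrow> 0"
      by (rule tendsto_sandwich[OF _ _ tendsto_const LIMSEQ_inverse_real_of_nat];
          use that in \<open>force intro: always_eventually less_imp_le\<close>)+
    have "(\<lambda>n. x + \<theta> n *\<^sub>R axis i 1 + \<eta> n *\<^sub>R axis j 1) \<longlonglongrightarrow> x + 0 *\<^sub>R axis i 1 + 0 *\<^sub>R axis j 1"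
      by (intro tendsto_intros 0)
    moreover have "isCont (partial j (partial i f)) x"
      using smooth_on_imp_continuous_on[OF smooth_on_partial[OF smooth_on_partial[OF assms]]]
      by (simp add: continuous_on_eq_continuous_at)
    ultimately show ?thesis using isCont_tendsto_compose by fastforce
  qed
  have "\<forall>n. \<exists>\<theta> \<eta> \<theta>' \<eta>'. 0 < \<theta> \<and> \<theta> < ?h n \<and> 0 < \<eta> \<and> \<eta> < ?h n \<and> 0 < \<theta>' \<and> \<theta>' < ?h n \<and> 0 < \<eta>' \<and> \<eta>' < ?h n \<and>
      partial k (partial l f) (x + \<theta> *\<^sub>R axis l 1 + \<eta> *\<^sub>R axis k 1)
      = partial l (partial k f) (x + \<theta>' *\<^sub>R axis k 1 + \<eta>' *\<^sub>R axis l 1)"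
  proof
    fix n
    have pos: "0 < ?h n" by simp
    obtain \<theta> \<eta> where 1: "0 < \<theta>" "\<theta> < ?h n" "0 < \<eta>" "\<eta> < ?h n"
      "f (x + ?h n *\<^sub>R axis l 1 + ?h n *\<^sub>R axis k 1) - f (x + ?h n *\<^sub>R axis l 1) - f (x + ?h n *\<^sub>R axis k 1) + f x
      = (?h n)\<^sup>2 * partial k (partial l f) (x + \<theta> *\<^sub>R axis l 1 + \<eta> *\<^sub>R axis k 1)"
      using second_difference[OF assms pos, of x l k] by blast
    obtain \<theta>' \<eta>' where 2: "0 < \<theta>'" "\<theta>' < ?h n" "0 < \<eta>'" "\<eta>' < ?h n"
      "f (x + ?h n *\<^sub>R axis k 1 + ?h n *\<^sub>R axis l 1) - f (x + ?h n *\<^sub>R axis k 1) - f (x + ?h n *\<^sub>R axis l 1) + f x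
      = (?h n)\<^sup>2 * partial l (partial k f) (x + \<theta>' *\<^sub>R axis k 1 + \<eta>' *\<^sub>R axis l 1)"
      using second_difference[OF assms pos, of x k l] by blast
    have "(?h n)\<^sup>2 * partial k (partial l f) (x + \<theta> *\<^sub>R axis l 1 + \<eta> *\<^sub>R axis k 1)
        = (?h n)\<^sup>2 * partial l (partial k f) (x + \<theta>' *\<^sub>R axis k 1 + \<eta>' *\<^sub>R axis l 1)"
      unfolding 1(5)[symmetric] 2(5)[symmetric] by (simp add: add_ac)
    then have "partial k (partial l f) (x + \<theta> *\<^sub>R axis l 1 + \<eta> *\<^sub>R axis k 1)
        = partial l (partial k f) (x + \<theta>' *\<^sub>R axis k 1 + \<eta>' *\<^sub>R axis l 1)"
      using pos by simp
    with 1(1-4) 2(1-4) show "\<exists>\<theta> \<eta> \<theta>' \<eta>'. 0 < \<theta> \<and> \<theta> < ?h n \<and> 0 < \<eta> \<and> \<eta> < ?h n \<and> 0 < \<theta>' \<and> \<theta>' < ?h n \<and> 0 < \<eta>' \<and> \<eta>' < ?h n \<and>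
      partial k (partial l f) (x + \<theta> *\<^sub>R axis l 1 + \<eta> *\<^sub>R axis k 1)
      = partial l (partial k f) (x + \<theta>' *\<^sub>R axis k 1 + \<eta>' *\<^sub>R axis l 1)" by blast
  qed
  then obtain \<theta> \<eta> \<theta>' \<eta>' where
    *: "\<And>n. 0 < \<theta> n \<and> \<theta> n < ?h n \<and> 0 < \<eta> n \<and> \<eta> n < ?h n"
       "\<And>n. 0 < \<theta>' n \<and> \<theta>' n < ?h n \<and> 0 < \<eta>' n \<and> \<eta>' n < ?h n" and
    eq: "\<And>n. partial k (partial l f) (x + \<theta> n *\<^sub>R axis l 1 + \<eta> n *\<^sub>R axis k 1)
      = partial l (partial k f) (x + \<theta>' n *\<^sub>R axis k 1 + \<eta>' n *\<^sub>R axis l 1)"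
    by metis
  show ?thesis
    using LIMSEQ_unique[OF lim[OF *(1), where i = l and j = k, unfolded eq] lim[OF *(2), where i = k and j = l]] .
qed

text \<open>The flat function exp(-1/t) with a polynomial factor in 1/t. The polynomial is a
  parameter because the derivatives of exp(-1/t) have this form with growing polynomials.\<close>

definition exp_bump :: "real poly \<Rightarrow> real \<Rightarrow> real" where
  "exp_bump P t = (if t \<le> 0 then 0 else poly P (inverse t) * exp (- inverse t))"

lemma poly_exp_tendsto_0: "((\<lambda>x::real. poly P x * exp (- x)) \<longlongrightarrow> 0) at_top"
proof -
  have "((\<lambda>x::real. \<Sum>i\<le>degree P. coeff P i * (x ^ i / exp x)) \<longlongrightarrow> 0) at_top"
    by (intro tendsto_null_sum tendsto_mult_right_zero tendsto_power_div_exp_0)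
  then show ?thesis
    by (simp add: poly_altdef sum_distrib_right exp_minus divide_inverse mult.assoc)
qed

text \<open>With x = 1/t, differentiation turns P into x^2 (P - P'), and \<open>monom 1 2\<close> is
  x^2. Flatness is needed only at t = 0, where exp(-1/t) beats every polynomial in 1/t.\<close>

lemma exp_bump_deriv:
  "(exp_bump P has_real_derivative exp_bump (monom 1 2 * (P - pderiv P)) t) (at t)"
proof -
  consider "t < 0" | "t = 0" | "t > 0" by linarith
  then show ?thesis
  proof cases
    case 1
    have "((\<lambda>_. 0) has_real_derivative 0) (at t)" by simp
    then have "(exp_bump P has_real_derivative 0) (at t)"
      by (rule has_field_derivative_transform_within_open[where S = "{..<0}"])
        (use 1 in \<open>auto simp: exp_bump_def\<close>)
    then show ?thesis using 1 by (simp add: exp_bump_def)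
  next
    case 3
    have "((\<lambda>t. poly P (inverse t) * exp (- inverse t)) has_real_derivative
        poly (pderiv P) (inverse t) * (- (inverse t)\<^sup>2) * exp (- inverse t)
        + poly P (inverse t) * (exp (- inverse t) * (inverse t)\<^sup>2)) (at t)"
      using 3 by (auto intro!: derivative_eq_intros DERIV_chain2[OF poly_DERIV] simp: power2_eq_square)
    then have "(exp_bump P has_real_derivative
        poly (pderiv P) (inverse t) * (- (inverse t)\<^sup>2) * exp (- inverse t)
        + poly P (inverse t) * (exp (- inverse t) * (inverse t)\<^sup>2)) (at t)"
      by (rule has_field_derivative_transform_within_open[where S = "{0<..}"])
        (use 3 in \<open>auto simp: exp_bump_def\<close>)
    then show ?thesis using 3 by (simp add: exp_bump_def poly_monom algebra_simps)
  next
    case 2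
    have "((\<lambda>h. exp_bump P h / h) \<longlongrightarrow> 0) (at_right 0)"
    proof (rule Lim_transform_eventually)
      \<comment> \<open>Dividing by h multiplies the polynomial by its variable, so the difference
        quotient at 0 has the same shape, with \<open>pCons 0 P\<close>.\<close>
      show "((\<lambda>h. poly (pCons 0 P) (inverse h) * exp (- inverse h)) \<longlongrightarrow> 0) (at_right 0)"
        by (rule filterlim_compose[OF poly_exp_tendsto_0 filterlim_inverse_at_top_right])
      show "\<forall>\<^sub>F h in at_right 0. poly (pCons 0 P) (inverse h) * exp (- inverse h) = exp_bump P h / h"
        by (rule eventually_at_rightI[of 0 1]) (auto simp: exp_bump_def field_simps)
    qed
    moreover have "((\<lambda>h. exp_bump P h / h) \<longlongrightarrow> 0) (at_left 0)"
      by (rule tendsto_eventually, rule eventually_at_leftI[of "-1"]) (auto simp: exp_bump_def)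
    ultimately have "((\<lambda>h. exp_bump P h / h) \<longlongrightarrow> 0) (at 0)"
      by (simp add: filterlim_at_split)
    then show ?thesis using 2 by (simp add: DERIV_def exp_bump_def)
  qed
qed

lemma smooth_real_exp_bump: "smooth_real UNIV (exp_bump P)"
  unfolding smooth_real_def
proof (intro exI conjI allI ballI)
  let ?D = "\<lambda>n. exp_bump (((\<lambda>P. monom 1 2 * (P - pderiv P)) ^^ n) P)"
  show "?D 0 = exp_bump P" by simp
  show "(?D n has_real_derivative ?D (Suc n) x) (at x)" for n x
    using exp_bump_deriv by simp
qed

section \<open>Algebra of test functions, and bumps\<close>

lemma test_fun_smooth: "test_fun \<Omega> \<phi> \<Longrightarrow> smooth_on UNIV \<phi>"
  unfolding test_fun_def by blast

lemma test_fun_mono: "test_fun \<Omega> \<phi> \<Longrightarrow> \<Omega> \<subseteq> \<Omega>' \<Longrightarrow> test_fun \<Omega>' \<phi>"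
  unfolding test_fun_def by blast

lemma test_fun_outside: "test_fun \<Omega> \<phi> \<Longrightarrow> x \<notin> \<Omega> \<Longrightarrow> \<phi> x = 0"
  unfolding test_fun_def by blast

lemma partial_outside:
  fixes \<phi> :: "real ^ 'n::finite \<Rightarrow> real"
  assumes "closed K" "\<And>x. x \<notin> K \<Longrightarrow> \<phi> x = 0" "x \<notin> K"
  shows "partial k \<phi> x = 0"
  using partial_cong(1)[of "- K" x "\<lambda>_. 0" \<phi> k] assms by auto

lemma test_fun_partial:
  fixes \<phi> :: "real ^ 'n::finite \<Rightarrow> real"
  assumes "test_fun \<Omega> \<phi>"
  shows "test_fun \<Omega> (partial k \<phi>)"
proof -
  obtain K where K: "compact K" "K \<subseteq> \<Omega>" "\<And>x. x \<notin> K \<Longrightarrow> \<phi> x = 0"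
    using assms unfolding test_fun_def by blast
  then have "partial k \<phi> x = 0" if "x \<notin> K" for x
    using partial_outside compact_imp_closed that by blast
  then show ?thesis
    using K smooth_on_partial[OF test_fun_smooth[OF assms]] unfolding test_fun_def by blast
qed

text \<open>Outside S the values of g are arbitrary. Smoothness on the whole space is glued from two
  open sets: S, and the complement of a compact K containing the support of \<phi>, where the
  product is 0.\<close>

lemma test_fun_mult_smooth:
  fixes \<phi> :: "real ^ 'n::finite \<Rightarrow> real"
  assumes "open S" "smooth_on S g" "test_fun \<Omega> \<phi>" "\<Omega> \<subseteq> S"
  shows "test_fun \<Omega> (\<lambda>x. g x * \<phi> x)"
proof -
  obtain K where K: "compact K" "K \<subseteq> \<Omega>" "\<And>x. x \<notin> K \<Longrightarrow> \<phi> x = 0"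
    using assms(3) unfolding test_fun_def by blast
  have o: "open (- K)" using K(1) compact_imp_closed by blast
  have "smooth_on S (\<lambda>x. g x * \<phi> x)"
    using assms smooth_on_subset[OF test_fun_smooth, of \<Omega> \<phi> S] by (auto intro: smooth_on_mult)
  moreover have "smooth_on (- K) (\<lambda>x. g x * \<phi> x)"
    by (rule smooth_on_cong[OF o _ smooth_on_const[of _ 0]]) (use K in auto)
  ultimately have "smooth_on (S \<union> - K) (\<lambda>x. g x * \<phi> x)"
    by (intro smooth_on_Un assms o)
  moreover have "S \<union> - K = UNIV" using K assms by auto
  ultimately show ?thesis unfolding test_fun_def using K by force
qed

lemma test_fun_add:
  fixes \<phi> :: "real ^ 'n::finite \<Rightarrow> real"
  assumes "test_fun \<Omega> \<phi>" "test_fun \<Omega> \<psi>"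
  shows "test_fun \<Omega> (\<lambda>x. \<phi> x + \<psi> x)"
proof -
  obtain K L where "compact K" "K \<subseteq> \<Omega>" "\<forall>x. x \<notin> K \<longrightarrow> \<phi> x = 0"
    "compact L" "L \<subseteq> \<Omega>" "\<forall>x. x \<notin> L \<longrightarrow> \<psi> x = 0"
    using assms unfolding test_fun_def by metis
  then have "compact (K \<union> L) \<and> K \<union> L \<subseteq> \<Omega> \<and> (\<forall>x. x \<notin> K \<union> L \<longrightarrow> \<phi> x + \<psi> x = 0)"
    by auto
  moreover have "smooth_on UNIV (\<lambda>x. \<phi> x + \<psi> x)"
    using assms by (intro smooth_on_add test_fun_smooth) auto
  ultimately show ?thesis unfolding test_fun_def by blast
qed

lemma test_fun_zero: "test_fun \<Omega> (\<lambda>x::real ^ 'n::finite. 0)"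
  unfolding test_fun_def using smooth_on_const compact_empty by blast

lemma test_fun_sum:
  fixes \<phi> :: "'a \<Rightarrow> real ^ 'n::finite \<Rightarrow> real"
  shows "(\<And>i. i \<in> I \<Longrightarrow> test_fun \<Omega> (\<phi> i)) \<Longrightarrow> test_fun \<Omega> (\<lambda>x. \<Sum>i\<in>I. \<phi> i x)"
  by (induction I rule: infinite_finite_induct) (auto intro: test_fun_zero test_fun_add)

lemma test_fun_cmult: "test_fun \<Omega> \<phi> \<Longrightarrow> test_fun \<Omega> (\<lambda>x::real ^ 'n::finite. c * \<phi> x)"
  using test_fun_mult_smooth[OF open_UNIV smooth_on_const] by blast

lemma test_fun_continuous:
  fixes \<phi> :: "real ^ 'n::finite \<Rightarrow> real"
  shows "test_fun \<Omega> \<phi> \<Longrightarrow> continuous_on S \<phi>"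
  using smooth_on_imp_continuous_on continuous_on_subset test_fun_smooth by blast

lemma test_fun_bounded:
  fixes \<phi> :: "real ^ 'n::finite \<Rightarrow> real"
  assumes "test_fun \<Omega> \<phi>"
  obtains B where "\<And>x. \<bar>\<phi> x\<bar> \<le> B" "0 < B"
proof -
  obtain K where K: "compact K" "K \<subseteq> \<Omega>" "\<And>x. x \<notin> K \<Longrightarrow> \<phi> x = 0"
    using assms unfolding test_fun_def by blast
  have "bounded (\<phi> ` K)"
    using K(1) test_fun_continuous[OF assms] compact_continuous_image compact_imp_bounded by blast
  then obtain B where "0 < B" "\<forall>y\<in>\<phi> ` K. norm y \<le> B" by (auto simp: bounded_pos)
  then have "\<bar>\<phi> x\<bar> \<le> B" for x using K(3)[of x] by (cases "x \<in> K") auto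
  with \<open>0 < B\<close> that show thesis by blast
qed

text \<open>The squared norm is a polynomial in the coordinates, so the centre causes no trouble for
  smoothness; the sign of the argument singles out the open ball.\<close>

definition bump :: "real ^ 'n::finite \<Rightarrow> real \<Rightarrow> real ^ 'n \<Rightarrow> real" where
  "bump c r x = exp_bump 1 (r\<^sup>2 - (norm (x - c))\<^sup>2)"

lemma bump_pos:
  assumes "0 < r"
  shows "0 < bump c r x \<longleftrightarrow> x \<in> ball c r"
proof -
  have "norm (x - c) < r \<longleftrightarrow> (norm (x - c))\<^sup>2 < r\<^sup>2"
    using assms by (metis less_imp_le norm_ge_zero not_le power_mono_iff zero_less_numeral)
  then show ?thesis
    by (simp add: bump_def exp_bump_def dist_norm norm_minus_commute not_le)
qed

lemma bump_nonneg: "0 \<le> bump c r x"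
  by (auto simp: bump_def exp_bump_def)

lemma test_fun_bump:
  assumes "0 < r" "cball c r \<subseteq> \<Omega>"
  shows "test_fun \<Omega> (bump c r)"
proof -
  have 1: "(norm (x - c))\<^sup>2 = (\<Sum>i\<in>UNIV. (x $ i + - c $ i) * (x $ i + - c $ i))" for x
    by (simp add: norm_vec_def L2_set_def sum_nonneg power2_eq_square)
  have "smooth_on UNIV (\<lambda>x. r\<^sup>2 + - (\<Sum>i\<in>UNIV. (x $ i + - c $ i) * (x $ i + - c $ i)))"
    by (intro smooth_on_add smooth_on_mult smooth_on_sum smooth_on_uminus smooth_on_const smooth_on_nth open_UNIV)
  then have "smooth_on UNIV (bump c r)"
    using smooth_on_comp[OF open_UNIV smooth_real_exp_bump] by (simp add: bump_def[abs_def] 1)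
  moreover have "\<forall>x. x \<notin> cball c r \<longrightarrow> bump c r x = 0"
    using bump_pos[OF assms(1), of c] bump_nonneg[of c r]
    by (metis ball_subset_cball order_le_less subsetD)
  ultimately show ?thesis
    unfolding test_fun_def using assms(2) compact_cball by blast
qed

section \<open>Integration by parts and the fundamental lemma\<close>

text \<open>Differentiation under the integral sign along a translation. With h = 1 it yields
  integration by parts; with a general continuous h it drives the moving bump that shows local
  constancy.\<close>

lemma DERIV_integral_translate:
  fixes F :: "real ^ 'n::finite \<Rightarrow> real"
  assumes F: "smooth_on UNIV F" and h: "continuous_on (cbox a b) h"
  shows "((\<lambda>t. integral (cbox a b) (\<lambda>x. h x * F (x + t *\<^sub>R v))) has_real_derivative
    integral (cbox a b) (\<lambda>x. h x * (\<Sum>k\<in>UNIV. v $ k * partial k F (x + t *\<^sub>R v)))) (at t)"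
proof (rule leibniz_rule_field_derivative[where U = UNIV])
  have cF: "continuous_on UNIV F" using F by (rule smooth_on_imp_continuous_on)
  have cp: "continuous_on UNIV (partial k F)" for k
    using F smooth_on_partial smooth_on_imp_continuous_on by blast
  show "((\<lambda>t. h x * F (x + t *\<^sub>R v)) has_real_derivative
      h x * (\<Sum>k\<in>UNIV. v $ k * partial k F (x + t *\<^sub>R v))) (at t)" for x t
    by (rule DERIV_cmult, rule differentiable_direction, rule smooth_on_differentiable[OF F UNIV_I])
  show "(\<lambda>x. h x * F (x + t *\<^sub>R v)) integrable_on cbox a b" for t
    by (intro integrable_continuous continuous_intros h continuous_on_compose2[OF cF]) auto
  have h2: "continuous_on (UNIV \<times> cbox a b) (\<lambda>z. h (snd z))"
    by (rule continuous_on_compose2[OF h]) (auto intro: continuous_intros)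
  show "continuous_on (UNIV \<times> cbox a b) (\<lambda>(t, x). h x * (\<Sum>k\<in>UNIV. v $ k * partial k F (x + t *\<^sub>R v)))"
    unfolding case_prod_unfold
    by (intro continuous_intros h2 continuous_on_compose2[OF cp]) auto
qed auto

lemma open_in_sets_lebesgue: "open S \<Longrightarrow> S \<in> sets lebesgue"
  by (simp add: sets_completionI_sets)

lemma indicator_mult_subset:
  fixes g :: "'a \<Rightarrow> real"
  assumes "A \<subseteq> B"
  shows "(\<lambda>x. indicator A x * g x) = (\<lambda>x. indicator A x * (indicator B x * g x))"
  using assms by (auto simp: fun_eq_iff indicator_def)

lemma norm_indicator_mult_mono:
  fixes g :: "'a \<Rightarrow> real"
  assumes "A \<subseteq> B"
  shows "norm (indicator A x * g x) \<le> norm (indicator B x * g x)"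
  using assms by (auto simp: indicator_def)

lemma test_fun_integrable:
  fixes \<phi> :: "real ^ 'n::finite \<Rightarrow> real"
  assumes "test_fun \<Omega> \<phi>"
  shows "integrable lborel \<phi>" "integrable lebesgue \<phi>"
proof -
  obtain K where K: "compact K" "\<And>x. x \<notin> K \<Longrightarrow> \<phi> x = 0"
    using assms unfolding test_fun_def by blast
  have "integrable lborel (\<lambda>x. indicator K x *\<^sub>R \<phi> x)"
    using K(1) test_fun_continuous[OF assms] by (rule borel_integrable_compact)
  moreover have "(\<lambda>x. indicator K x *\<^sub>R \<phi> x) = \<phi>"
    using K(2) by (auto simp: fun_eq_iff indicator_def)
  ultimately show *: "integrable lborel \<phi>" by simp
  then show "integrable lebesgue \<phi>"
    by (subst integrable_completion) auto
qed

lemma test_fun_measurable: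
  fixes \<phi> :: "real ^ 'n::finite \<Rightarrow> real"
  assumes "test_fun \<Omega> \<phi>"
  shows "\<phi> \<in> borel_measurable lebesgue"
  using test_fun_integrable(2)[OF assms] by blast

text \<open>By translation invariance of Lebesgue measure the integral of F(x + t e_k) does not
  depend on t, and its derivative at t = 0 is the integral of \<open>partial k F\<close>. This
  avoids iterated integrals.\<close>

lemma integral_partial_eq_0:
  fixes F :: "real ^ 'n::finite \<Rightarrow> real"
  assumes "test_fun \<Omega> F"
  shows "(LINT x:\<Omega>|lebesgue. partial k F x) = 0"
proof -
  obtain K where K: "compact K" "\<And>x. x \<notin> K \<Longrightarrow> F x = 0"
    using assms unfolding test_fun_def by blast
  obtain B where B: "\<And>x. x \<in> K \<Longrightarrow> norm x \<le> B"
    using K(1) compact_imp_bounded bounded_iff by metis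
  \<comment> \<open>The margin 1 leaves room for the translates with |t| < 1, whose supports must
    lie in the same box.\<close>
  obtain c :: "real ^ 'n" where c: "cball 0 (B + 1) \<subseteq> cbox (-c) c"
    using bounded_subset_cbox_symmetric bounded_cball by metis
  let ?Q = "cbox (-c) c" and ?e = "axis k 1 :: real ^ 'n"
  have supp: "integral ?Q g = (LINT x|lborel. g x)"
    if "integrable lborel g" "\<And>x. x \<notin> ?Q \<Longrightarrow> g x = 0" for g :: "real ^ 'n \<Rightarrow> real"
  proof -
    have "g = (\<lambda>x. if x \<in> ?Q then g x else 0)" using that(2) by auto
    then have "integral ?Q g = integral UNIV g" by (metis integral_restrict_UNIV)
    also have "\<dots> = (LINT x|lborel. g x)" using that(1) by (rule integral_lborel)
    finally show ?thesis .
  qed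
  have G: "integral ?Q (\<lambda>x. 1 * F (x + t *\<^sub>R ?e)) = (LINT x|lborel. F x)" if "t \<in> {-1<..<1}" for t
  proof -
    have d: "distr lborel borel (\<lambda>x. t *\<^sub>R ?e + x) = lborel"
      by (rule lborel_distr_plus)
    have m: "F \<in> borel_measurable borel"
      using test_fun_integrable(1)[OF assms] by auto
    have "integrable (distr lborel borel (\<lambda>x. t *\<^sub>R ?e + x)) F"
      unfolding d by (rule test_fun_integrable(1)[OF assms])
    then have i: "integrable lborel (\<lambda>x. F (x + t *\<^sub>R ?e))"
      using m by (subst (asm) integrable_distr_eq) (auto simp: add.commute)
    have "F (x + t *\<^sub>R ?e) = 0" if "x \<notin> ?Q" for x
    proof (rule K(2), rule)
      assume "x + t *\<^sub>R ?e \<in> K"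
      then have "norm (x + t *\<^sub>R ?e) \<le> B" by (rule B)
      moreover have "norm (t *\<^sub>R ?e) \<le> 1" using \<open>t \<in> {-1<..<1}\<close> by (simp add: norm_axis_1 abs_le_iff)
      moreover have "norm x \<le> norm (x + t *\<^sub>R ?e) + norm (t *\<^sub>R ?e)"
        using norm_triangle_ineq4[of "x + t *\<^sub>R ?e" "t *\<^sub>R ?e"] by simp
      ultimately have "x \<in> cball 0 (B + 1)" by simp
      with c that show False by blast
    qed
    then have "integral ?Q (\<lambda>x. 1 * F (x + t *\<^sub>R ?e)) = (LINT x|lborel. F (x + t *\<^sub>R ?e))"
      using supp[OF i] by simp
    also have "\<dots> = (LINT x|distr lborel borel (\<lambda>x. t *\<^sub>R ?e + x). F x)"
      using m by (subst integral_distr) (auto simp: add.commute)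
    finally show ?thesis unfolding d .
  qed
  have "((\<lambda>t. LINT x|lborel. F x) has_real_derivative
      integral ?Q (\<lambda>x. 1 * (\<Sum>j\<in>UNIV. ?e $ j * partial j F (x + 0 *\<^sub>R ?e)))) (at 0)"
    by (rule has_field_derivative_transform_within_open
        [OF DERIV_integral_translate[OF test_fun_smooth[OF assms], where h = "\<lambda>_. 1"], where S = "{-1<..<1}"])
      (use G in auto)
  then have "integral ?Q (\<lambda>x. 1 * (\<Sum>j\<in>UNIV. ?e $ j * partial j F (x + 0 *\<^sub>R ?e))) = 0"
    using DERIV_unique DERIV_const by blast
  moreover have "(\<Sum>j\<in>UNIV. ?e $ j * partial j F y) = partial k F y" for y
    by (subst sum.remove[of _ k]) (auto simp: axis_def intro!: sum.neutral)
  ultimately have 0: "integral ?Q (partial k F) = 0" by simp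
  have "partial k F x = 0" if "x \<notin> ?Q" for x
  proof (rule partial_outside[OF compact_imp_closed[OF K(1)] K(2)])
    show "x \<notin> K" using B[of x] c that by (auto simp: subset_iff)
  qed
  then have "(LINT x|lborel. partial k F x) = 0"
    using supp[OF test_fun_integrable(1)[OF test_fun_partial[OF assms]]] 0 by simp
  moreover have "(\<lambda>x. indicator \<Omega> x *\<^sub>R partial k F x) = partial k F"
    using test_fun_outside[OF test_fun_partial[OF assms]] by (auto simp: fun_eq_iff indicator_def)
  ultimately show ?thesis
    unfolding set_lebesgue_integral_def
    using test_fun_integrable(1)[OF test_fun_partial[OF assms]] by (subst integral_completion) auto
qed

lemma L1_loc_mult_test:
  fixes \<psi> :: "real ^ 'n::finite \<Rightarrow> real"
  assumes "L1_loc \<Omega> g" "test_fun \<Omega> \<psi>"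
  shows "set_integrable lebesgue \<Omega> (\<lambda>x. g x * \<psi> x)"
proof -
  obtain K where K: "compact K" "K \<subseteq> \<Omega>" "\<And>x. x \<notin> K \<Longrightarrow> \<psi> x = 0"
    using assms(2) unfolding test_fun_def by blast
  obtain B where B: "\<And>x. \<bar>\<psi> x\<bar> \<le> B" "0 < B" using test_fun_bounded[OF assms(2)] by blast
  have i: "integrable lebesgue (\<lambda>x. indicator K x * g x)"
    using assms(1) K(1,2) unfolding L1_loc_def set_integrable_def by simp
  have "integrable lebesgue (\<lambda>x. (indicator K x * g x) * \<psi> x)"
  proof (rule Bochner_Integration.integrable_bound[OF integrable_mult_left[of B, OF i]])
    show "(\<lambda>x. indicator K x * g x * \<psi> x) \<in> borel_measurable lebesgue"
      by (rule borel_measurable_times[OF borel_measurable_integrable[OF i] test_fun_measurable[OF assms(2)]])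
    show "AE x in lebesgue. norm (indicator K x * g x * \<psi> x) \<le> norm (indicator K x * g x * B)"
      using B by (auto simp: abs_mult intro!: always_eventually mult_left_mono)
  qed
  moreover have "(\<lambda>x. (indicator K x * g x) * \<psi> x) = (\<lambda>x. indicator \<Omega> x *\<^sub>R (g x * \<psi> x))"
    using K by (auto simp: fun_eq_iff indicator_def)
  ultimately show ?thesis unfolding set_integrable_def by simp
qed

lemma continuous_on_L1_loc:
  fixes f :: "real ^ 'n::finite \<Rightarrow> real"
  assumes "continuous_on \<Omega> f"
  shows "L1_loc \<Omega> f"
  unfolding L1_loc_def set_integrable_def
proof (intro allI impI)
  fix K assume K: "compact K \<and> K \<subseteq> \<Omega>"
  then have "integrable lborel (\<lambda>x. indicator K x *\<^sub>R f x)"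
    using continuous_on_subset[OF assms] by (intro borel_integrable_compact) auto
  then show "integrable lebesgue (\<lambda>x. indicator K x *\<^sub>R f x)"
    by (subst integrable_completion) auto
qed

text \<open>
  If \<open>\<psi> \<ge> 0\<close> is a test function, then the test functions \<open>\<psi> / (\<psi> + 1/n)\<close> increase to the indicator
  function of \<open>{\<psi> > 0}\<close>.
\<close>

lemma weak_zero_on_balls:
  fixes g :: "real ^ 'n::finite \<Rightarrow> real"
  assumes "L1_loc \<Omega> g"
    and z: "\<And>\<phi>. test_fun \<Omega> \<phi> \<Longrightarrow> (LINT x:\<Omega>|lebesgue. g x * \<phi> x) = 0"
    and C: "finite C" "0 < r" "(\<Union>c\<in>C. cball c r) \<subseteq> \<Omega>"
  shows "(LINT x:(\<Union>c\<in>C. ball c r)|lebesgue. g x) = 0"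
proof -
  let ?\<psi> = "\<lambda>x. \<Sum>c\<in>C. bump c r x"
  let ?V = "\<Union>c\<in>C. ball c r" and ?K = "\<Union>c\<in>C. cball c r"
  have \<psi>: "test_fun \<Omega> ?\<psi>"
    using C by (intro test_fun_sum test_fun_bump) auto
  have \<psi>0: "0 \<le> ?\<psi> x" for x by (simp add: bump_nonneg sum_nonneg)
  have \<psi>V: "?\<psi> x = 0 \<longleftrightarrow> x \<notin> ?V" for x
    using bump_pos[OF C(2), of _ x] bump_nonneg[of _ r x]
    by (subst sum_nonneg_eq_0_iff) (auto simp: C(1) order_less_le)
  let ?\<chi> = "\<lambda>n x. inverse (?\<psi> x + inverse (real (Suc n))) * ?\<psi> x"
  have pos: "0 < ?\<psi> x + inverse (real (Suc n))" for x n
    using \<psi>0[of x] by (simp add: add_nonneg_pos)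
  have \<chi>: "test_fun \<Omega> (?\<chi> n)" for n
  proof (rule test_fun_mult_smooth[OF open_UNIV _ \<psi> subset_UNIV])
    show "smooth_on UNIV (\<lambda>x. inverse (?\<psi> x + inverse (real (Suc n))))"
      by (rule smooth_on_comp[OF open_UNIV smooth_real_inverse _
            smooth_on_add[OF open_UNIV test_fun_smooth[OF \<psi>] smooth_on_const]])
        (use pos[of _ n] in \<open>metis ComplI singletonD less_irrefl\<close>)
  qed
  have K: "compact ?K" using C(1) by (intro compact_UN) auto
  then have iK: "integrable lebesgue (\<lambda>x. indicator ?K x * g x)"
    using assms(1) C(3) unfolding L1_loc_def set_integrable_def by simp
  have iV: "?V \<in> sets lebesgue" by (rule open_in_sets_lebesgue) auto
  have eq: "(\<lambda>x. indicator \<Omega> x *\<^sub>R (g x * ?\<chi> n x)) = (\<lambda>x. (indicator ?K x * g x) * ?\<chi> n x)" for n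
  proof
    fix x
    show "indicator \<Omega> x *\<^sub>R (g x * ?\<chi> n x) = (indicator ?K x * g x) * ?\<chi> n x"
    proof (cases "x \<in> ?V")
      case True
      then have "x \<in> ?K" using ball_subset_cball by blast
      with C(3) have "x \<in> \<Omega>" by blast
      with \<open>x \<in> ?K\<close> show ?thesis by simp
    next
      case False
      then have "?\<psi> x = 0" using \<psi>V by blast
      then show ?thesis by simp
    qed
  qed
  have "(\<lambda>n. integral\<^sup>L lebesgue (\<lambda>x. (indicator ?K x * g x) * ?\<chi> n x))
      \<longlonglongrightarrow> integral\<^sup>L lebesgue (\<lambda>x. indicator ?V x * g x)"
  proof (rule integral_dominated_convergence[where w = "\<lambda>x. norm (indicator ?K x * g x)"])
    show "integrable lebesgue (\<lambda>x. norm (indicator ?K x * g x))" using iK by (rule integrable_norm)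
    show "(\<lambda>x. indicator ?K x * g x * ?\<chi> n x) \<in> borel_measurable lebesgue" for n
      by (rule borel_measurable_times[OF borel_measurable_integrable[OF iK] test_fun_measurable[OF \<chi>]])
    have "(\<lambda>x. indicator ?V x * g x) = (\<lambda>x. indicator ?V x * (indicator ?K x * g x))"
      by (rule indicator_mult_subset) (use ball_subset_cball in blast)
    moreover have "(\<lambda>x. indicator ?V x * (indicator ?K x * g x)) \<in> borel_measurable lebesgue"
      by (rule borel_measurable_times[OF borel_measurable_indicator[OF iV] borel_measurable_integrable[OF iK]])
    ultimately show "(\<lambda>x. indicator ?V x * g x) \<in> borel_measurable lebesgue" by simp
    show "AE x in lebesgue. norm (indicator ?K x * g x * ?\<chi> n x) \<le> norm (indicator ?K x * g x)" for n
    proof (rule always_eventually, rule allI)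
      fix x
      have "\<bar>?\<chi> n x\<bar> \<le> 1"
        using \<psi>0[of x] pos[of x n] by (simp add: field_simps)
      then show "norm (indicator ?K x * g x * ?\<chi> n x) \<le> norm (indicator ?K x * g x)"
        by (metis abs_ge_zero abs_mult mult_left_le real_norm_def)
    qed
    show "AE x in lebesgue. (\<lambda>n. indicator ?K x * g x * ?\<chi> n x) \<longlonglongrightarrow> indicator ?V x * g x"
    proof (rule always_eventually, rule allI)
      fix x
      show "(\<lambda>n. indicator ?K x * g x * ?\<chi> n x) \<longlonglongrightarrow> indicator ?V x * g x"
      proof (cases "x \<in> ?V")
        case True
        then have "?\<psi> x \<noteq> 0" "x \<in> ?K" using \<psi>V ball_subset_cball by blast+
        then have "(\<lambda>n. indicator ?K x * g x * ?\<chi> n x) \<longlonglongrightarrow> indicator ?K x * g x * (inverse (?\<psi> x + 0) * ?\<psi> x)"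
          by (intro tendsto_intros LIMSEQ_inverse_real_of_nat) auto
        with \<open>?\<psi> x \<noteq> 0\<close> \<open>x \<in> ?K\<close> True show ?thesis by simp
      next
        case False
        then have "?\<psi> x = 0" using \<psi>V by blast
        with False show ?thesis by simp
      qed
    qed
  qed
  moreover have "integral\<^sup>L lebesgue (\<lambda>x. (indicator ?K x * g x) * ?\<chi> n x) = 0" for n
    using z[OF \<chi>[of n]] unfolding set_lebesgue_integral_def eq .
  ultimately have "integral\<^sup>L lebesgue (\<lambda>x. indicator ?V x * g x) = 0"
    by (simp only: LIMSEQ_const_iff)
  then show ?thesis by (simp add: set_lebesgue_integral_def)
qed

text \<open>K is covered by finitely many balls of radius \<open>r n\<close> about points of K, and
  the integral of g over their union vanishes. As \<open>r n\<close> tends to 0, every point outside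
  K eventually leaves these unions because K is closed; a compact neighbourhood of K supplies the
  dominating function.\<close>

lemma weak_zero_on_compact:
  fixes g :: "real ^ 'n::finite \<Rightarrow> real"
  assumes "open \<Omega>" "L1_loc \<Omega> g"
    and z: "\<And>\<phi>. test_fun \<Omega> \<phi> \<Longrightarrow> (LINT x:\<Omega>|lebesgue. g x * \<phi> x) = 0"
    and K: "compact K" "K \<subseteq> \<Omega>"
  shows "(LINT x:K|lebesgue. g x) = 0"
proof -
  obtain e where e: "0 < e" "(\<Union>x\<in>K. cball x e) \<subseteq> \<Omega>"
    using compact_subset_open_imp_cball_epsilon_subset[OF K(1) assms(1) K(2)] by blast
  \<comment> \<open>The closed e-neighbourhood of K, written as a sum of two compact sets so that
    its compactness is immediate.\<close>
  let ?L = "{x + y | x y. x \<in> K \<and> y \<in> cball 0 e}"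
  have Leq: "?L = (\<Union>x\<in>K. cball x e)"
  proof -
    have "z \<in> ?L" if "x \<in> K" "z \<in> cball x e" for x z
      using that by (intro CollectI exI[of _ x] exI[of _ "z - x"]) (auto simp: dist_norm norm_minus_commute)
    then show ?thesis by (auto simp: dist_norm)
  qed
  have L: "compact ?L" by (rule compact_sums[OF K(1) compact_cball])
  have iL: "integrable lebesgue (\<lambda>x. indicator ?L x * g x)"
    using assms(2) L e(2) unfolding L1_loc_def set_integrable_def Leq by simp
  define r where "r n = e * inverse (real (Suc n))" for n
  have r: "0 < r n" "r n \<le> e" for n using e(1) by (auto simp: r_def field_simps)
  have "\<exists>C. finite C \<and> C \<subseteq> K \<and> K \<subseteq> (\<Union>c\<in>C. ball c (r n))" for n
  proof -
    have "K \<subseteq> (\<Union>c\<in>K. ball c (r n))" using r(1)[of n] by auto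
    then show ?thesis
      using compactE_image[OF K(1), of K "\<lambda>c. ball c (r n)"] by (metis open_ball)
  qed
  then obtain C where C: "\<And>n. finite (C n)" "\<And>n. C n \<subseteq> K" "\<And>n. K \<subseteq> (\<Union>c\<in>C n. ball c (r n))"
    by metis
  let ?V = "\<lambda>n. \<Union>c\<in>C n. ball c (r n)"
  have VL: "?V n \<subseteq> ?L" for n
    unfolding Leq using C(2)[of n] r(2)[of n] by fastforce
  have cV: "(\<Union>c\<in>C n. cball c (r n)) \<subseteq> \<Omega>" for n
    using e(2) C(2)[of n] r(2)[of n] by fastforce
  have eqV: "(\<lambda>x. indicator (?V n) x * g x) = (\<lambda>x. indicator (?V n) x * (indicator ?L x * g x))" for n
    by (rule indicator_mult_subset[OF VL])
  have KL: "K \<subseteq> ?L" using C(3)[of 0] VL[of 0] by blast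
  have "(\<lambda>n. integral\<^sup>L lebesgue (\<lambda>x. indicator (?V n) x * g x))
      \<longlonglongrightarrow> integral\<^sup>L lebesgue (\<lambda>x. indicator K x * g x)"
  proof (rule integral_dominated_convergence[where w = "\<lambda>x. norm (indicator ?L x * g x)"])
    show "integrable lebesgue (\<lambda>x. norm (indicator ?L x * g x))" using iL by (rule integrable_norm)
    have "?V n \<in> sets lebesgue" for n by (rule open_in_sets_lebesgue) auto
    then show "(\<lambda>x. indicator (?V n) x * g x) \<in> borel_measurable lebesgue" for n
      unfolding eqV by (intro borel_measurable_times borel_measurable_indicator borel_measurable_integrable[OF iL])
    have "K \<in> sets lebesgue" using K(1) by (simp add: lmeasurable_compact fmeasurableD)
    then have "(\<lambda>x. indicator K x * (indicator ?L x * g x)) \<in> borel_measurable lebesgue"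
      by (intro borel_measurable_times borel_measurable_indicator borel_measurable_integrable[OF iL])
    moreover have "(\<lambda>x. indicator K x * g x) = (\<lambda>x. indicator K x * (indicator ?L x * g x))"
      by (rule indicator_mult_subset[OF KL])
    ultimately show "(\<lambda>x. indicator K x * g x) \<in> borel_measurable lebesgue" by simp
    show "AE x in lebesgue. norm (indicator (?V n) x * g x) \<le> norm (indicator ?L x * g x)" for n
      by (intro always_eventually allI norm_indicator_mult_mono VL)
    show "AE x in lebesgue. (\<lambda>n. indicator (?V n) x * g x) \<longlonglongrightarrow> indicator K x * g x"
    proof (rule always_eventually, rule allI)
      fix x
      show "(\<lambda>n. indicator (?V n) x * g x) \<longlonglongrightarrow> indicator K x * g x"
      proof (cases "x \<in> K")
        case True
        then have "x \<in> ?V n" for n using C(3) by blast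
        with True show ?thesis by simp
      next
        case False
        then obtain d where d: "0 < d" "ball x d \<subseteq> - K"
          using compact_imp_closed[OF K(1)] open_contains_ball[of "- K"] by auto
        have "r \<longlonglongrightarrow> e * 0" unfolding r_def by (intro tendsto_intros LIMSEQ_inverse_real_of_nat)
        then have "\<forall>\<^sub>F n in sequentially. r n < d" using d(1) by (simp add: order_tendstoD)
        then have "\<forall>\<^sub>F n in sequentially. indicator (?V n) x * g x = indicator K x * g x"
        proof eventually_elim
          case (elim n)
          have "x \<notin> ?V n"
          proof
            assume "x \<in> ?V n"
            then obtain c where "c \<in> K" "dist c x < d" using C(2)[of n] elim by fastforce
            then show False using d(2) by (auto simp: dist_commute subset_iff)
          qed
          with False show ?case by simp
        qed
        then show ?thesis by (rule tendsto_eventually)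
      qed
    qed
  qed
  moreover have "integral\<^sup>L lebesgue (\<lambda>x. indicator (?V n) x * g x) = 0" for n
    using weak_zero_on_balls[OF assms(2) z C(1) r(1) cV, of n] by (simp add: set_lebesgue_integral_def)
  ultimately have "integral\<^sup>L lebesgue (\<lambda>x. indicator K x * g x) = 0"
    by (simp only: LIMSEQ_const_iff)
  then show ?thesis by (simp add: set_lebesgue_integral_def)
qed

text \<open>Inner regularity: the part of K where g > 0 contains a closed T that misses only a set
  of measure less than e. The integral of g over the compact T is 0 while g > 0 on T, so T is a null
  set.\<close>

lemma weak_zero_not_pos:
  fixes g :: "real ^ 'n::finite \<Rightarrow> real"
  assumes "open \<Omega>" "L1_loc \<Omega> g"
    and z: "\<And>\<phi>. test_fun \<Omega> \<phi> \<Longrightarrow> (LINT x:\<Omega>|lebesgue. g x * \<phi> x) = 0"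
    and K: "compact K" "K \<subseteq> \<Omega>"
  shows "AE x in lebesgue. x \<in> K \<longrightarrow> g x \<le> 0"
proof -
  let ?f = "\<lambda>x. indicator K x * g x" and ?A = "{x \<in> K. 0 < g x}"
  have "integrable lebesgue ?f"
    using assms(2) K unfolding L1_loc_def set_integrable_def by simp
  then have m: "?f \<in> borel_measurable lebesgue" by auto
  have "{x \<in> space lebesgue. 0 < ?f x} \<in> sets lebesgue" using m by measurable
  moreover have "{x \<in> space lebesgue. 0 < ?f x} = ?A" by (auto simp: indicator_def split: if_splits)
  ultimately have A: "?A \<in> sets lebesgue" by simp
  have "emeasure lebesgue ?A \<le> ennreal e" if "0 < e" for e
  proof -
    obtain T where T: "closed T" "T \<subseteq> ?A" "?A - T \<in> lmeasurable" "emeasure lebesgue (?A - T) < ennreal e"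
      using sets_lebesgue_inner_closed[OF A \<open>0 < e\<close>] by blast
    have cT: "compact T"
      using compact_Int_closed[OF K(1) T(1)] T(2) by (simp add: Int_absorb1 Collect_restrict subset_trans)
    have T\<Omega>: "T \<subseteq> \<Omega>" using T(2) K(2) by blast
    have mT: "T \<in> sets lebesgue" using cT by (simp add: lmeasurable_compact fmeasurableD)
    have "integral\<^sup>L lebesgue (\<lambda>x. indicator T x * g x) = 0"
      using weak_zero_on_compact[OF assms(1,2) z cT T\<Omega>] by (simp add: set_lebesgue_integral_def)
    moreover have "integrable lebesgue (\<lambda>x. indicator T x * g x)"
      using assms(2) cT T\<Omega> unfolding L1_loc_def set_integrable_def by simp
    moreover have "AE x in lebesgue. 0 \<le> indicator T x * g x"
      using T(2) by (intro always_eventually allI) (auto simp: indicator_def)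
    ultimately have "AE x in lebesgue. indicator T x * g x = 0"
      using integral_nonneg_eq_0_iff_AE by blast
    then have "AE x in lebesgue. x \<notin> T"
      by eventually_elim (use T(2) in \<open>auto simp: indicator_def split: if_splits\<close>)
    then have "emeasure lebesgue T = 0"
      using mT by (simp add: AE_iff_null_sets null_setsD1)
    moreover have "?A = T \<union> (?A - T)" using T(2) by auto
    ultimately have "emeasure lebesgue ?A \<le> 0 + emeasure lebesgue (?A - T)"
      using emeasure_subadditive[of T lebesgue "?A - T"] mT A by (metis sets.Diff)
    with T(4) show ?thesis by simp
  qed
  then have "emeasure lebesgue ?A \<le> 0 + ennreal e" if "0 < e" for e
    using that by simp
  then have "emeasure lebesgue ?A \<le> 0"
    by (rule ennreal_le_epsilon)
  then have "?A \<in> null_sets lebesgue" using A by auto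
  then have "AE x in lebesgue. x \<notin> ?A" by (rule AE_not_in)
  then show ?thesis by eventually_elim auto
qed

text \<open>The one-sided bound is applied to g and to -g on a countable exhaustion by compact sets.
  The purpose is uniqueness of weak derivatives up to null sets.\<close>

theorem fundamental_lemma:
  fixes g :: "real ^ 'n::finite \<Rightarrow> real"
  assumes "open \<Omega>" "L1_loc \<Omega> g"
    and z: "\<And>\<phi>. test_fun \<Omega> \<phi> \<Longrightarrow> (LINT x:\<Omega>|lebesgue. g x * \<phi> x) = 0"
  shows "AE x in lebesgue. x \<in> \<Omega> \<longrightarrow> g x = 0"
proof -
  obtain K :: "nat \<Rightarrow> _" where K: "\<And>n. compact (K n)" "\<And>n. K n \<subseteq> \<Omega>" "\<Union> (range K) = \<Omega>"
    by (rule open_Union_compact_subsets[OF assms(1)]) blast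
  have "L1_loc \<Omega> (\<lambda>x. - g x)" using assms(2) unfolding L1_loc_def set_integrable_def by auto
  moreover have "(LINT x:\<Omega>|lebesgue. - g x * \<phi> x) = 0" if "test_fun \<Omega> \<phi>" for \<phi>
    using z[OF that] by (simp add: set_lebesgue_integral_def)
  ultimately have "AE x in lebesgue. x \<in> K n \<longrightarrow> - g x \<le> 0" for n
    using weak_zero_not_pos[OF assms(1) _ _ K(1,2), of "\<lambda>x. - g x"] by blast
  moreover have "AE x in lebesgue. x \<in> K n \<longrightarrow> g x \<le> 0" for n
    using weak_zero_not_pos[OF assms(1,2) z K(1,2)] by blast
  ultimately have "AE x in lebesgue. \<forall>n. (x \<in> K n \<longrightarrow> - g x \<le> 0) \<and> (x \<in> K n \<longrightarrow> g x \<le> 0)"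
    by (simp add: AE_all_countable)
  then show ?thesis
    by eventually_elim (use K(3) in force)
qed

section \<open>Horizontal Sobolev spaces\<close>

lemma powr_add_le:
  fixes x y p :: real
  assumes "0 \<le> x" "0 \<le> y" "0 < p"
  shows "(x + y) powr p \<le> 2 powr p * (x powr p + y powr p)"
proof -
  have "(x + y) powr p \<le> (2 * max x y) powr p"
    using assms by (intro powr_mono2) auto
  also have "\<dots> = 2 powr p * max x y powr p" using assms by (simp add: powr_mult)
  also have "\<dots> \<le> 2 powr p * (x powr p + y powr p)" by (simp add: max_def)
  finally show ?thesis .
qed

text \<open>Supplies dominating functions: if c approximates a with an error controlled by d, then c
  is controlled by quantities that do not depend on the index of the approximation. The crude
  constant \<open>2 powr p\<close> suffices for that.\<close>

lemma norm_powr_le_add: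
  fixes a c :: "'a::real_normed_vector"
  assumes "norm (a - c) powr p \<le> d" "0 < p"
  shows "norm c powr p \<le> 2 powr p * (norm a powr p + d)"
proof -
  have "norm c \<le> norm a + norm (a - c)"
    by (metis add.commute norm_triangle_sub norm_minus_commute)
  then have "norm c powr p \<le> (norm a + norm (a - c)) powr p"
    using assms(2) by (intro powr_mono2) auto
  also have "\<dots> \<le> 2 powr p * (norm a powr p + norm (a - c) powr p)"
    using assms(2) by (intro powr_add_le) auto
  also have "\<dots> \<le> 2 powr p * (norm a powr p + d)" using assms(1) by simp
  finally show ?thesis .
qed

lemma norm_powr_le_sum:
  fixes v :: "real ^ 'm::finite"
  assumes "0 < p"
  shows "norm v powr p \<le> real CARD('m) powr p * (\<Sum>i\<in>UNIV. \<bar>v $ i\<bar> powr p)"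
proof -
  obtain j where j: "\<And>i. \<bar>v $ i\<bar> \<le> \<bar>v $ j\<bar>"
    using obtains_MAX[of UNIV "\<lambda>i. \<bar>v $ i\<bar>"] by (metis Max_ge UNIV_I UNIV_not_empty finite finite_imageI image_eqI)
  have "norm v \<le> (\<Sum>i\<in>UNIV. \<bar>v $ i\<bar>)" by (rule norm_le_l1_cart)
  also have "\<dots> \<le> real CARD('m) * \<bar>v $ j\<bar>"
    using sum_bounded_above[of UNIV "\<lambda>i. \<bar>v $ i\<bar>" "\<bar>v $ j\<bar>"] j by simp
  finally have "norm v powr p \<le> (real CARD('m) * \<bar>v $ j\<bar>) powr p"
    using assms by (intro powr_mono2) auto
  also have "\<dots> = real CARD('m) powr p * \<bar>v $ j\<bar> powr p" by (simp add: powr_mult)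
  also have "\<dots> \<le> real CARD('m) powr p * (\<Sum>i\<in>UNIV. \<bar>v $ i\<bar> powr p)"
    by (intro mult_left_mono member_le_sum) auto
  finally show ?thesis .
qed

lemma borel_measurable_vecI:
  fixes f :: "'a \<Rightarrow> real ^ 'm::finite"
  assumes "\<And>i. (\<lambda>x. f x $ i) \<in> borel_measurable M"
  shows "f \<in> borel_measurable M"
  by (subst borel_measurable_euclidean_space) (auto simp: Basis_vec_def inner_axis assms)

text \<open>Boundedness makes \<open>M\<close> a finite measure, so constants may enter dominating
  functions and first powers are controlled by p-th powers.\<close>

locale open_fields =
  fixes b :: "('m::finite, 'n::finite) vfields" and \<Omega> :: "(real ^ 'n) set" and p :: real
  assumes p: "1 < p" and op: "open \<Omega>" and bd: "bounded \<Omega>" and smooth: "smooth_fields \<Omega> b"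
begin

abbreviation "M \<equiv> lebesgue_on \<Omega>"

lemma \<Omega>_sets [simp, measurable]: "\<Omega> \<in> sets lebesgue" "\<Omega> \<inter> space lebesgue \<in> sets lebesgue"
  using op open_in_sets_lebesgue by auto

lemma set_integrable_M: "set_integrable lebesgue \<Omega> f \<longleftrightarrow> integrable M f" for f :: "_ \<Rightarrow> real"
  by (simp add: set_integrable_def integrable_restrict_space)

lemma set_integral_M: "(LINT x:\<Omega>|lebesgue. f x) = integral\<^sup>L M f" for f :: "_ \<Rightarrow> real"
  by (simp add: set_lebesgue_integral_def integral_restrict_space)

lemma set_measurable_M: "set_borel_measurable lebesgue \<Omega> f \<longleftrightarrow> f \<in> borel_measurable M" for f :: "_ \<Rightarrow> real"
  by (simp add: set_borel_measurable_def borel_measurable_restrict_space_iff)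

lemma AE_M: "(AE x in M. P x) \<longleftrightarrow> (AE x in lebesgue. x \<in> \<Omega> \<longrightarrow> P x)"
  by (simp add: AE_restrict_space_iff)

lemma AE_M_in: "AE x in M. x \<in> \<Omega>"
  by (simp add: AE_M)

lemma finite_M: "finite_measure M"
  using op bd by (simp add: finite_measure_lebesgue_on lmeasurable_open)

lemma bounded_integrable_M:
  fixes f :: "_ \<Rightarrow> real"
  assumes "f \<in> borel_measurable M" "\<And>x. x \<in> \<Omega> \<Longrightarrow> \<bar>f x\<bar> \<le> B"
  shows "integrable M f"
  using AE_M_in by (intro finite_measure.integrable_const_bound[OF finite_M, of _ B] assms(1))
    (auto elim: eventually_mono simp: assms(2))

lemma continuous_measurable_M: "continuous_on \<Omega> f \<Longrightarrow> f \<in> borel_measurable M" for f :: "_ \<Rightarrow> real"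
  using continuous_imp_measurable_on_sets_lebesgue \<Omega>_sets by blast

lemma test_fun_measurable_M: "test_fun \<Omega>' \<phi> \<Longrightarrow> \<phi> \<in> borel_measurable M"
  using test_fun_continuous continuous_measurable_M by blast

text \<open>The weak derivatives in \<open>grad_X\<close> come from a choice operator, so their
  measurability is read off from \<open>L1_loc\<close>: on \<Omega> the function is the pointwise
  limit of its restrictions to an exhaustion by compact sets.\<close>

lemma L1_loc_measurable:
  assumes "L1_loc \<Omega> f"
  shows "f \<in> borel_measurable M"
proof -
  obtain K :: "nat \<Rightarrow> _" where K: "\<And>n. compact (K n)" "\<And>n. K n \<subseteq> \<Omega>"
      "\<And>n. K n \<subseteq> interior (K (Suc n))" "\<Union> (range K) = \<Omega>"
    by (rule open_Union_compact_subsets[OF op]) blast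
  have "(\<lambda>x. indicator \<Omega> x *\<^sub>R f x) \<in> borel_measurable lebesgue"
  proof (rule borel_measurable_LIMSEQ_real)
    have "integrable lebesgue (\<lambda>x. indicator (K n) x * f x)" for n
      using assms K(1,2) unfolding L1_loc_def set_integrable_def by simp
    then show "(\<lambda>x. indicator (K n) x * f x) \<in> borel_measurable lebesgue" for n
      by (rule borel_measurable_integrable)
    fix x
    have mono: "K m \<subseteq> K n" if "m \<le> n" for m n
    proof (rule lift_Suc_mono_le[OF _ that])
      show "K n \<subseteq> K (Suc n)" for n using K(3)[of n] interior_subset by (rule subset_trans)
    qed
    show "(\<lambda>n. indicator (K n) x * f x) \<longlonglongrightarrow> indicator \<Omega> x *\<^sub>R f x"
    proof (cases "x \<in> \<Omega>")
      case True
      then obtain N where "x \<in> K N" using K(4) by blast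
      then have "\<forall>\<^sub>F n in sequentially. x \<in> K n"
        using mono by (auto simp: eventually_sequentially)
      then have "\<forall>\<^sub>F n in sequentially. indicator (K n) x * f x = indicator \<Omega> x *\<^sub>R f x"
        by eventually_elim (use True in simp)
      then show ?thesis by (rule tendsto_eventually)
    next
      case False
      then have "x \<notin> K n" for n using K(2) by blast
      with False show ?thesis by simp
    qed
  qed
  then show ?thesis by (simp add: borel_measurable_restrict_space_iff)
qed

text \<open>The classical derivative, free of the choice made in \<open>weak_X\<close>. Explicit
  computations are made with it and compared with \<open>grad_X\<close> almost everywhere.\<close>

definition X_cl :: "'m \<Rightarrow> (real ^ 'n \<Rightarrow> real) \<Rightarrow> real ^ 'n \<Rightarrow> real" where
  "X_cl i \<phi> x = (\<Sum>k\<in>UNIV. b i x $ k * partial k \<phi> x)"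

definition grad_cl :: "(real ^ 'n \<Rightarrow> real) \<Rightarrow> real ^ 'n \<Rightarrow> real ^ 'm" where
  "grad_cl \<phi> x = (\<chi> i. X_cl i \<phi> x)"

lemma smooth_coeff: "smooth_on \<Omega> (\<lambda>x. b i x $ k)"
  using smooth unfolding smooth_fields_def by blast

lemma test_fun_coeff: "test_fun \<Omega> \<psi> \<Longrightarrow> test_fun \<Omega> (\<lambda>x. b i x $ k * \<psi> x)"
  by (rule test_fun_mult_smooth[OF op smooth_coeff]) auto

lemma test_fun_adjoint: "test_fun \<Omega> \<psi> \<Longrightarrow> test_fun \<Omega> (adjoint_X b i \<psi>)"
proof -
  assume "test_fun \<Omega> \<psi>"
  then have "test_fun \<Omega> (\<lambda>x. \<Sum>k\<in>UNIV. partial k (\<lambda>y. b i y $ k * \<psi> y) x)"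
    by (intro test_fun_sum test_fun_partial test_fun_coeff)
  from test_fun_cmult[OF this, of "-1"] show ?thesis by (simp add: adjoint_X_def[abs_def])
qed

lemma test_fun_X_cl: "test_fun \<Omega> \<psi> \<Longrightarrow> test_fun \<Omega> (X_cl i \<psi>)"
  unfolding X_cl_def[abs_def] by (intro test_fun_sum test_fun_coeff test_fun_partial)

lemma continuous_X_cl: "smooth_on UNIV \<phi> \<Longrightarrow> continuous_on \<Omega> (X_cl i \<phi>)"
  unfolding X_cl_def[abs_def]
  by (intro continuous_on_sum continuous_on_mult smooth_on_imp_continuous_on smooth_coeff
      smooth_on_partial) (rule smooth_on_subset, auto)

lemma L1_loc_mult_test_M: "L1_loc \<Omega> g \<Longrightarrow> test_fun \<Omega> \<psi> \<Longrightarrow> integrable M (\<lambda>x. g x * \<psi> x)"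
  using L1_loc_mult_test set_integrable_M by blast

text \<open>For each k the product of \<phi>, the coefficient and \<psi> is a test function, so its
  partial derivative in direction k integrates to 0; the claim is the sum over k. The support of
  \<psi> alone confines the integrals, so \<phi> may be nonzero up to the boundary, as the
  regularised logarithms of test functions are.\<close>

lemma has_weak_X_smooth:
  assumes \<phi>: "smooth_on UNIV \<phi>"
  shows "has_weak_X b \<Omega> i \<phi> (X_cl i \<phi>)"
  unfolding has_weak_X_def
proof (intro conjI allI impI)
  have c\<phi>: "continuous_on \<Omega> \<phi>" using \<phi> smooth_on_imp_continuous_on smooth_on_subset by blast
  then show L\<phi>: "L1_loc \<Omega> \<phi>" by (rule continuous_on_L1_loc)
  show "L1_loc \<Omega> (X_cl i \<phi>)" by (rule continuous_on_L1_loc[OF continuous_X_cl[OF \<phi>]])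
  fix \<psi> assume \<psi>: "test_fun \<Omega> \<psi>"
  define q where "q k x = b i x $ k * \<psi> x" for k x
  have q: "test_fun \<Omega> (q k)" for k unfolding q_def by (rule test_fun_coeff[OF \<psi>])
  have i1: "integrable M (\<lambda>x. \<phi> x * partial k (q k) x)" for k
    by (rule L1_loc_mult_test_M[OF L\<phi> test_fun_partial[OF q]])
  have i2: "integrable M (\<lambda>x. partial k \<phi> x * q k x)" for k
    by (rule L1_loc_mult_test_M[OF continuous_on_L1_loc q])
      (rule smooth_on_imp_continuous_on, rule smooth_on_subset[OF smooth_on_partial[OF \<phi>]], simp)
  have "integral\<^sup>L M (\<lambda>x. \<phi> x * partial k (q k) x + partial k \<phi> x * q k x) = 0" for k
  proof -
    have t: "test_fun \<Omega> (\<lambda>x. \<phi> x * q k x)"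
      by (rule test_fun_mult_smooth[OF open_UNIV \<phi> q]) auto
    have "partial k (\<lambda>x. \<phi> x * q k x) x = \<phi> x * partial k (q k) x + partial k \<phi> x * q k x" for x
      by (intro partial_mult smooth_on_differentiable[OF \<phi>] smooth_on_differentiable[OF test_fun_smooth[OF q]]) auto
    with integral_partial_eq_0[OF t, of k] show ?thesis by (simp add: set_integral_M)
  qed
  then have 0: "integral\<^sup>L M (\<lambda>x. \<phi> x * partial k (q k) x) + integral\<^sup>L M (\<lambda>x. partial k \<phi> x * q k x) = 0" for k
    by (subst Bochner_Integration.integral_add[OF i1 i2, symmetric])
  have "(LINT x:\<Omega>|lebesgue. X_cl i \<phi> x * \<psi> x) = integral\<^sup>L M (\<lambda>x. \<Sum>k\<in>UNIV. partial k \<phi> x * q k x)"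
    unfolding set_integral_M by (simp add: X_cl_def q_def sum_distrib_left mult_ac)
  also have "\<dots> = (\<Sum>k\<in>UNIV. integral\<^sup>L M (\<lambda>x. partial k \<phi> x * q k x))"
    by (rule Bochner_Integration.integral_sum[OF i2])
  also have "\<dots> = - (\<Sum>k\<in>UNIV. integral\<^sup>L M (\<lambda>x. \<phi> x * partial k (q k) x))"
    unfolding sum_negf[symmetric] using 0 by (intro sum.cong) (auto simp: add_eq_0_iff)
  also have "\<dots> = - integral\<^sup>L M (\<lambda>x. \<Sum>k\<in>UNIV. \<phi> x * partial k (q k) x)"
    by (simp add: Bochner_Integration.integral_sum[OF i1])
  also have "\<dots> = (LINT x:\<Omega>|lebesgue. \<phi> x * adjoint_X b i \<psi> x)"
    unfolding set_integral_M by (simp add: adjoint_X_def q_def[abs_def] sum_distrib_left)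
  finally show "(LINT x:\<Omega>|lebesgue. X_cl i \<phi> x * \<psi> x) = (LINT x:\<Omega>|lebesgue. \<phi> x * adjoint_X b i \<psi> x)" .
qed

lemma L1_loc_diff: "L1_loc \<Omega> f \<Longrightarrow> L1_loc \<Omega> g \<Longrightarrow> L1_loc \<Omega> (\<lambda>x. f x - g x)"
  unfolding L1_loc_def by (auto intro: set_integral_diff)

lemma has_weak_X_diff:
  assumes "has_weak_X b \<Omega> i u g" "has_weak_X b \<Omega> i v h"
  shows "has_weak_X b \<Omega> i (\<lambda>x. u x - v x) (\<lambda>x. g x - h x)"
proof -
  have L: "L1_loc \<Omega> u" "L1_loc \<Omega> v" "L1_loc \<Omega> g" "L1_loc \<Omega> h"
    using assms unfolding has_weak_X_def by auto
  have "(LINT x:\<Omega>|lebesgue. (g x - h x) * \<psi> x) = (LINT x:\<Omega>|lebesgue. (u x - v x) * adjoint_X b i \<psi> x)"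
    if \<psi>: "test_fun \<Omega> \<psi>" for \<psi>
  proof -
    have 1: "integral\<^sup>L M (\<lambda>x. g x * \<psi> x) = integral\<^sup>L M (\<lambda>x. u x * adjoint_X b i \<psi> x)"
      "integral\<^sup>L M (\<lambda>x. h x * \<psi> x) = integral\<^sup>L M (\<lambda>x. v x * adjoint_X b i \<psi> x)"
      using assms \<psi> unfolding has_weak_X_def set_integral_M by auto
    show ?thesis
      using L1_loc_mult_test_M[OF L(3) \<psi>] L1_loc_mult_test_M[OF L(4) \<psi>]
        L1_loc_mult_test_M[OF L(1) test_fun_adjoint[OF \<psi>]] L1_loc_mult_test_M[OF L(2) test_fun_adjoint[OF \<psi>]]
      unfolding set_integral_M by (simp add: left_diff_distrib 1)
  qed
  with L show ?thesis unfolding has_weak_X_def by (blast intro: L1_loc_diff)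
qed

lemma has_weak_X_unique:
  assumes "has_weak_X b \<Omega> i u g" "has_weak_X b \<Omega> i u h"
  shows "AE x in M. g x = h x"
proof -
  have L: "L1_loc \<Omega> g" "L1_loc \<Omega> h" using assms unfolding has_weak_X_def by auto
  have "AE x in lebesgue. x \<in> \<Omega> \<longrightarrow> g x - h x = 0"
  proof (rule fundamental_lemma[OF op L1_loc_diff[OF L]])
    fix \<phi> assume \<phi>: "test_fun \<Omega> \<phi>"
    have "integral\<^sup>L M (\<lambda>x. g x * \<phi> x) = integral\<^sup>L M (\<lambda>x. h x * \<phi> x)"
      using assms \<phi> unfolding has_weak_X_def set_integral_M by auto
    then show "(LINT x:\<Omega>|lebesgue. (g x - h x) * \<phi> x) = 0"
      using L1_loc_mult_test_M[OF L(1) \<phi>] L1_loc_mult_test_M[OF L(2) \<phi>]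
      unfolding set_integral_M by (simp add: left_diff_distrib)
  qed
  then show ?thesis by (simp add: AE_M)
qed

lemma has_weak_X_weak_X: "has_weak_X b \<Omega> i u g \<Longrightarrow> has_weak_X b \<Omega> i u (weak_X b \<Omega> i u)"
  unfolding weak_X_def by (rule someI[of "has_weak_X b \<Omega> i u"])

text \<open>Replaces the representative chosen by \<open>weak_X\<close> by an explicit one. The
  index type is finite, so the exceptional null sets of all components can be united.\<close>

lemma grad_X_eqI:
  assumes "\<And>i. has_weak_X b \<Omega> i u (g i)"
  shows "AE x in M. grad_X b \<Omega> u x = (\<chi> i. g i x)"
proof -
  have "AE x in M. weak_X b \<Omega> i u x = g i x" for i
    by (rule has_weak_X_unique[OF has_weak_X_weak_X[OF assms] assms])
  then have "AE x in M. \<forall>i. weak_X b \<Omega> i u x = g i x"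
    by (simp add: AE_all_countable)
  then show ?thesis by eventually_elim (simp add: grad_X_def)
qed

lemma grad_X_smooth: "smooth_on UNIV \<phi> \<Longrightarrow> AE x in M. grad_X b \<Omega> \<phi> x = grad_cl \<phi> x"
  unfolding grad_cl_def by (rule grad_X_eqI[OF has_weak_X_smooth])

lemma Lp_test_fun:
  assumes "test_fun \<Omega> \<phi>"
  shows "Lp p \<Omega> \<phi>"
proof -
  obtain B where B: "\<And>x. \<bar>\<phi> x\<bar> \<le> B" using test_fun_bounded[OF assms] by metis
  have m: "\<phi> \<in> borel_measurable M" by (rule test_fun_measurable_M[OF assms])
  have "integrable M (\<lambda>x. \<bar>\<phi> x\<bar> powr p)"
  proof (rule bounded_integrable_M)
    show "(\<lambda>x. \<bar>\<phi> x\<bar> powr p) \<in> borel_measurable M" using m by measurable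
    show "\<bar>\<bar>\<phi> x\<bar> powr p\<bar> \<le> B powr p" for x using B p by (auto intro: powr_mono2)
  qed
  with m show ?thesis by (simp add: Lp_def set_measurable_M set_integrable_M)
qed

lemma Lp_diff:
  assumes "Lp p \<Omega> f" "Lp p \<Omega> g"
  shows "Lp p \<Omega> (\<lambda>x. f x - g x)"
proof -
  have *: "f \<in> borel_measurable M" "g \<in> borel_measurable M"
    "integrable M (\<lambda>x. \<bar>f x\<bar> powr p)" "integrable M (\<lambda>x. \<bar>g x\<bar> powr p)"
    using assms by (auto simp: Lp_def set_measurable_M set_integrable_M)
  have "integrable M (\<lambda>x. \<bar>f x - g x\<bar> powr p)"
  proof (rule Bochner_Integration.integrable_bound)
    show "integrable M (\<lambda>x. 2 powr p * (\<bar>f x\<bar> powr p + \<bar>g x\<bar> powr p))"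
      using * by (intro integrable_mult_right Bochner_Integration.integrable_add)
    show "(\<lambda>x. \<bar>f x - g x\<bar> powr p) \<in> borel_measurable M" using *(1,2) by measurable
    have "\<bar>f x - g x\<bar> powr p \<le> 2 powr p * (\<bar>f x\<bar> powr p + \<bar>g x\<bar> powr p)" for x
    proof -
      have "\<bar>f x - g x\<bar> powr p \<le> (\<bar>f x\<bar> + \<bar>g x\<bar>) powr p" using p by (intro powr_mono2) auto
      also have "\<dots> \<le> 2 powr p * (\<bar>f x\<bar> powr p + \<bar>g x\<bar> powr p)" using p by (intro powr_add_le) auto
      finally show ?thesis .
    qed
    then show "AE x in M. norm (\<bar>f x - g x\<bar> powr p) \<le> norm (2 powr p * (\<bar>f x\<bar> powr p + \<bar>g x\<bar> powr p))"
      by simp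
  qed
  with * show ?thesis by (simp add: Lp_def set_measurable_M set_integrable_M)
qed

lemma W1p_test_fun: "test_fun \<Omega> \<phi> \<Longrightarrow> \<phi> \<in> W1p b p \<Omega>"
  unfolding W1p_def using Lp_test_fun has_weak_X_smooth test_fun_X_cl test_fun_smooth by blast

lemma W1p_diff: "u \<in> W1p b p \<Omega> \<Longrightarrow> v \<in> W1p b p \<Omega> \<Longrightarrow> (\<lambda>x. u x - v x) \<in> W1p b p \<Omega>"
  unfolding W1p_def mem_Collect_eq using Lp_diff has_weak_X_diff by meson

lemma W1p_measurable: "u \<in> W1p b p \<Omega> \<Longrightarrow> u \<in> borel_measurable M"
  unfolding W1p_def Lp_def set_measurable_M by blast

lemma W1p_integrable: "u \<in> W1p b p \<Omega> \<Longrightarrow> integrable M (\<lambda>x. \<bar>u x\<bar> powr p)"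
  unfolding W1p_def Lp_def set_integrable_M by blast

lemma W1p_has_weak_X: "u \<in> W1p b p \<Omega> \<Longrightarrow> has_weak_X b \<Omega> i u (weak_X b \<Omega> i u)"
  unfolding W1p_def using has_weak_X_weak_X by blast

lemma grad_X_measurable:
  assumes "u \<in> W1p b p \<Omega>"
  shows "grad_X b \<Omega> u \<in> borel_measurable M"
  using W1p_has_weak_X[OF assms] L1_loc_measurable
  by (intro borel_measurable_vecI) (auto simp: grad_X_def has_weak_X_def)

text \<open>\<open>W1p\<close> asserts that some weak derivative lies in L^p, whereas
  \<open>grad_X\<close> uses a possibly different representative; uniqueness almost everywhere
  transfers the integrability.\<close>

lemma grad_X_integrable:
  assumes u: "u \<in> W1p b p \<Omega>"
  shows "integrable M (\<lambda>x. norm (grad_X b \<Omega> u x) powr p)"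
proof (rule Bochner_Integration.integrable_bound)
  have "integrable M (\<lambda>x. \<bar>weak_X b \<Omega> i u x\<bar> powr p)" for i
  proof -
    have "\<exists>g. has_weak_X b \<Omega> i u g \<and> Lp p \<Omega> g" using u by (simp add: W1p_def)
    then obtain g where g: "has_weak_X b \<Omega> i u g" "Lp p \<Omega> g" by (elim exE conjE)
    have m: "g \<in> borel_measurable M" "weak_X b \<Omega> i u \<in> borel_measurable M"
      using g(1) W1p_has_weak_X[OF u, of i] L1_loc_measurable unfolding has_weak_X_def by blast+
    have "AE x in M. \<bar>g x\<bar> powr p = \<bar>weak_X b \<Omega> i u x\<bar> powr p"
      using has_weak_X_unique[OF g(1) W1p_has_weak_X[OF u]] by eventually_elim simp
    moreover have "integrable M (\<lambda>x. \<bar>g x\<bar> powr p)" using g(2) by (simp add: Lp_def set_integrable_M)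
    ultimately show ?thesis
      using m by (subst integrable_cong_AE[of _ _ "\<lambda>x. \<bar>g x\<bar> powr p"]) (auto elim: eventually_mono)
  qed
  then show "integrable M (\<lambda>x. real CARD('m) powr p * (\<Sum>i\<in>UNIV. \<bar>grad_X b \<Omega> u x $ i\<bar> powr p))"
    by (intro integrable_mult_right Bochner_Integration.integrable_sum) (simp add: grad_X_def)
  show "(\<lambda>x. norm (grad_X b \<Omega> u x) powr p) \<in> borel_measurable M"
    using grad_X_measurable[OF u] by measurable
  show "AE x in M. norm (norm (grad_X b \<Omega> u x) powr p)
      \<le> norm (real CARD('m) powr p * (\<Sum>i\<in>UNIV. \<bar>grad_X b \<Omega> u x $ i\<bar> powr p))"
    using norm_powr_le_sum[of p "grad_X b \<Omega> u _"] p by (auto simp: abs_mult sum_nonneg)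
qed

lemma grad_X_diff_smooth:
  assumes u: "u \<in> W1p b p \<Omega>" and \<phi>: "smooth_on UNIV \<phi>"
  shows "AE x in M. grad_X b \<Omega> (\<lambda>x. u x - \<phi> x) x = grad_X b \<Omega> u x - grad_cl \<phi> x"
proof -
  have "AE x in M. grad_X b \<Omega> (\<lambda>x. u x - \<phi> x) x = (\<chi> i. weak_X b \<Omega> i u x - X_cl i \<phi> x)"
    by (rule grad_X_eqI[OF has_weak_X_diff[OF W1p_has_weak_X[OF u] has_weak_X_smooth[OF \<phi>]]])
  then show ?thesis by eventually_elim (simp add: vec_eq_iff grad_X_def grad_cl_def)
qed

lemma W1p0_test_fun:
  assumes "test_fun \<Omega> \<phi>"
  shows "\<phi> \<in> W1p0 b p \<Omega>"
proof -
  have "AE x in M. grad_X b \<Omega> (\<lambda>x. \<phi> x - \<phi> x) x = grad_cl (\<lambda>x. \<phi> x - \<phi> x) x"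
    by (rule grad_X_smooth) (simp add: smooth_on_const)
  then have "AE x in M. \<bar>\<phi> x - \<phi> x\<bar> powr p + norm (grad_X b \<Omega> (\<lambda>x. \<phi> x - \<phi> x) x) powr p = 0"
    by eventually_elim (simp add: grad_cl_def X_cl_def vec_eq_iff)
  then have "integral\<^sup>L M (\<lambda>x. \<bar>\<phi> x - \<phi> x\<bar> powr p + norm (grad_X b \<Omega> (\<lambda>x. \<phi> x - \<phi> x) x) powr p) = 0"
    by (rule integral_eq_zero_AE)
  then have "W1p_norm b p \<Omega> (\<lambda>x. \<phi> x - \<phi> x) = 0"
    by (simp add: W1p_norm_def set_integral_M)
  then show ?thesis
    unfolding W1p0_def using W1p_test_fun[OF assms] assms by auto
qed

text \<open>
  The approximation is chosen so fast that the errors are summable; their sum \<open>D\<close> dominates.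
\<close>

lemma W1p0_approx:
  assumes "u \<in> W1p0 b p \<Omega>"
  obtains \<phi> D where "\<And>k::nat. test_fun \<Omega> (\<phi> k)" "integrable M D"
    "AE x in M. \<forall>k. \<bar>u x - \<phi> k x\<bar> powr p \<le> D x \<and> norm (grad_X b \<Omega> u x - grad_cl (\<phi> k) x) powr p \<le> D x"
    "AE x in M. (\<lambda>k. \<phi> k x) \<longlonglongrightarrow> u x"
    "AE x in M. (\<lambda>k. grad_cl (\<phi> k) x) \<longlonglongrightarrow> grad_X b \<Omega> u x"
proof -
  have u: "u \<in> W1p b p \<Omega>" using assms unfolding W1p0_def by blast
  have "\<forall>k. \<exists>\<phi>. test_fun \<Omega> \<phi> \<and> W1p_norm b p \<Omega> (\<lambda>x. u x - \<phi> x) < ((1/2) ^ k) powr (1 / p)"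
    using assms unfolding W1p0_def by auto
  then obtain \<phi> where \<phi>: "\<And>k::nat. test_fun \<Omega> (\<phi> k)"
    and small: "\<And>k. W1p_norm b p \<Omega> (\<lambda>x. u x - \<phi> k x) < ((1/2) ^ k) powr (1 / p)" by metis
  define e where "e k x = \<bar>u x - \<phi> k x\<bar> powr p + norm (grad_X b \<Omega> (\<lambda>x. u x - \<phi> k x) x) powr p" for k x
  have e0: "0 \<le> e k x" for k x by (simp add: e_def)
  have W: "(\<lambda>x. u x - \<phi> k x) \<in> W1p b p \<Omega>" for k
    by (rule W1p_diff[OF u W1p_test_fun[OF \<phi>]])
  have ie: "integrable M (e k)" for k
    unfolding e_def by (intro Bochner_Integration.integrable_add W1p_integrable grad_X_integrable W)
  have le: "integral\<^sup>L M (e k) \<le> (1/2) ^ k" for k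
  proof (rule ccontr)
    assume "\<not> integral\<^sup>L M (e k) \<le> (1/2) ^ k"
    then have "((1/2) ^ k) powr (1 / p) \<le> integral\<^sup>L M (e k) powr (1 / p)"
      using p by (intro powr_mono2) auto
    with small[of k] show False by (simp add: W1p_norm_def set_integral_M e_def[abs_def])
  qed
  have me: "e k \<in> borel_measurable M" for k using ie by blast
  have "(\<integral>\<^sup>+ x. (\<Sum>k. ennreal (e k x)) \<partial>M) = (\<Sum>k. \<integral>\<^sup>+ x. ennreal (e k x) \<partial>M)"
    using me by (intro nn_integral_suminf) measurable
  also have "\<dots> = (\<Sum>k. ennreal (integral\<^sup>L M (e k)))"
    by (intro suminf_cong nn_integral_eq_integral ie) (simp add: e0)
  also have "\<dots> \<le> (\<Sum>k. ennreal ((1/2) ^ k))"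
    by (intro suminf_le ennreal_leI le) auto
  also have "\<dots> < \<infinity>"
    by (subst suminf_ennreal2) (auto simp: summable_geometric)
  finally have "AE x in M. (\<Sum>k. ennreal (e k x)) \<noteq> \<infinity>"
    using me by (intro nn_integral_PInf_AE) auto
  then have sum: "AE x in M. summable (\<lambda>k. e k x)"
    by eventually_elim (rule summable_suminf_not_top, auto simp: e0)
  have "summable (\<lambda>k. integral\<^sup>L M (\<lambda>x. norm (e k x)))"
    by (rule summable_comparison_test'[OF summable_geometric[of "1/2::real"]])
      (use le e0 in \<open>auto simp: integral_nonneg_AE\<close>)
  then have iD: "integrable M (\<lambda>x. \<Sum>k. e k x)"
    using sum by (intro integrable_suminf ie) (auto simp: e0)
  have "AE x in M. \<forall>k. grad_X b \<Omega> (\<lambda>x. u x - \<phi> k x) x = grad_X b \<Omega> u x - grad_cl (\<phi> k) x"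
    unfolding AE_all_countable using grad_X_diff_smooth[OF u test_fun_smooth[OF \<phi>]] by blast
  then have eq: "AE x in M. \<forall>k. e k x = \<bar>u x - \<phi> k x\<bar> powr p + norm (grad_X b \<Omega> u x - grad_cl (\<phi> k) x) powr p"
    by eventually_elim (simp add: e_def)
  have tend: "(\<lambda>k. a k) \<longlonglongrightarrow> 0" if "\<And>k. 0 \<le> a k" "\<And>k. a k powr p \<le> e k x" "summable (\<lambda>k. e k x)" for a x
  proof -
    have "(\<lambda>k. a k powr p) \<longlonglongrightarrow> 0"
      by (rule tendsto_sandwich[OF _ _ tendsto_const summable_LIMSEQ_zero[OF that(3)]])
        (use that in auto)
    then have "(\<lambda>k. (a k powr p) powr (1 / p)) \<longlonglongrightarrow> 0 powr (1 / p)"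
      using p by (intro tendsto_powr2) auto
    then show ?thesis using that(1) p by (simp add: powr_powr)
  qed
  show thesis
  proof (rule that[OF \<phi> iD])
    show "AE x in M. \<forall>k. \<bar>u x - \<phi> k x\<bar> powr p \<le> (\<Sum>k. e k x) \<and>
        norm (grad_X b \<Omega> u x - grad_cl (\<phi> k) x) powr p \<le> (\<Sum>k. e k x)"
      using sum eq
    proof eventually_elim
      case (elim x)
      have le: "e k x \<le> (\<Sum>k. e k x)" for k
        using sum_le_suminf[OF elim(1), of "{k}"] e0 by simp
      have "\<bar>u x - \<phi> k x\<bar> powr p \<le> e k x" "norm (grad_X b \<Omega> u x - grad_cl (\<phi> k) x) powr p \<le> e k x" for k
        unfolding elim(2)[rule_format] by simp_all
      then show ?case using le order_trans by blast
    qed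
    show "AE x in M. (\<lambda>k. \<phi> k x) \<longlonglongrightarrow> u x"
      using sum eq
    proof eventually_elim
      case (elim x)
      have "(\<lambda>k. \<bar>u x - \<phi> k x\<bar>) \<longlonglongrightarrow> 0"
      proof (rule tend)
        show "\<bar>u x - \<phi> k x\<bar> powr p \<le> e k x" for k
          unfolding elim(2)[rule_format] by simp
      qed (simp, rule elim(1))
      then have "(\<lambda>k. u x - \<phi> k x) \<longlonglongrightarrow> 0" by (simp add: tendsto_rabs_zero_iff)
      from tendsto_diff[OF tendsto_const[of "u x"] this] show ?case by simp
    qed
    show "AE x in M. (\<lambda>k. grad_cl (\<phi> k) x) \<longlonglongrightarrow> grad_X b \<Omega> u x"
      using sum eq
    proof eventually_elim
      case (elim x)
      have "(\<lambda>k. norm (grad_X b \<Omega> u x - grad_cl (\<phi> k) x)) \<longlonglongrightarrow> 0"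
      proof (rule tend)
        show "norm (grad_X b \<Omega> u x - grad_cl (\<phi> k) x) powr p \<le> e k x" for k
          unfolding elim(2)[rule_format] by simp
      qed (simp, rule elim(1))
      then have "(\<lambda>k. grad_X b \<Omega> u x - grad_cl (\<phi> k) x) \<longlonglongrightarrow> 0" by (simp add: tendsto_norm_zero_iff)
      from tendsto_diff[OF tendsto_const[of "grad_X b \<Omega> u x"] this] show ?case by simp
    qed
  qed
qed

text \<open>The Rayleigh quotient bound freed of its division: if w vanishes almost everywhere, the
  left-hand side is 0. The infimum is a genuine lower bound because the quotients are bounded below
  by 0. The weak gradient is exchanged for the classical one, which can be computed for explicit
  compositions.\<close>

lemma lambda1_test_fun:
  assumes w: "test_fun \<Omega> w"
  shows "lambda1 b p \<Omega> * integral\<^sup>L M (\<lambda>x. \<bar>w x\<bar> powr p) \<le> integral\<^sup>L M (\<lambda>x. norm (grad_cl w x) powr p)"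
proof (cases "nonzero_on \<Omega> w")
  case False
  then have "AE x in M. \<bar>w x\<bar> powr p = 0"
    by (simp add: nonzero_on_def AE_M)
  then have "integral\<^sup>L M (\<lambda>x. \<bar>w x\<bar> powr p) = 0" by (rule integral_eq_zero_AE)
  then show ?thesis by (simp add: integral_nonneg_AE)
next
  case True
  let ?I = "integral\<^sup>L M (\<lambda>x. \<bar>w x\<bar> powr p)"
  have "\<not> (AE x in M. \<bar>w x\<bar> powr p = 0)"
    using True by (simp add: nonzero_on_def AE_M)
  then have "?I \<noteq> 0"
    using integral_nonneg_eq_0_iff_AE[OF W1p_integrable[OF W1p_test_fun[OF w]]] by simp
  moreover have "0 \<le> ?I" by (simp add: integral_nonneg_AE)
  ultimately have I: "0 < ?I" by linarith
  have "lambda1 b p \<Omega> \<le> (LINT x:\<Omega>|lebesgue. norm (grad_X b \<Omega> w x) powr p) / (LINT x:\<Omega>|lebesgue. \<bar>w x\<bar> powr p)"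
    unfolding lambda1_def
  proof (rule cINF_lower)
    show "bdd_below ((\<lambda>v. (LINT x:\<Omega>|lebesgue. norm (grad_X b \<Omega> v x) powr p) / (LINT x:\<Omega>|lebesgue. \<bar>v x\<bar> powr p)) `
        {v \<in> W1p0 b p \<Omega>. nonzero_on \<Omega> v})"
      by (rule bdd_belowI[of _ 0]) (auto simp: set_integral_M intro!: divide_nonneg_nonneg integral_nonneg_AE)
  qed (use W1p0_test_fun[OF w] True in simp)
  also have "(LINT x:\<Omega>|lebesgue. norm (grad_X b \<Omega> w x) powr p) = integral\<^sup>L M (\<lambda>x. norm (grad_cl w x) powr p)"
    unfolding set_integral_M
  proof (rule integral_cong_AE)
    show "(\<lambda>x. norm (grad_X b \<Omega> w x) powr p) \<in> borel_measurable M"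
      using grad_X_measurable[OF W1p_test_fun[OF w]] by measurable
    have "grad_cl w \<in> borel_measurable M"
      by (rule borel_measurable_vecI) (simp add: grad_cl_def test_fun_measurable_M[OF test_fun_X_cl[OF w]])
    then show "(\<lambda>x. norm (grad_cl w x) powr p) \<in> borel_measurable M" by measurable
    show "AE x in M. norm (grad_X b \<Omega> w x) powr p = norm (grad_cl w x) powr p"
      using grad_X_smooth[OF test_fun_smooth[OF w]] by eventually_elim simp
  qed
  finally show ?thesis using I by (simp add: set_integral_M pos_le_divide_eq)
qed

text \<open>The weak equation tested with u itself.\<close>

lemma eigenfunction_energy:
  assumes "eigenfunction b p \<Omega> ev u"
  shows "integral\<^sup>L M (\<lambda>x. norm (grad_X b \<Omega> u x) powr p) = ev * integral\<^sup>L M (\<lambda>x. \<bar>u x\<bar> powr p)"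
proof -
  have 1: "norm v powr (p - 2) * (v \<bullet> v) = norm v powr p" for v :: "real ^ 'm"
    by (cases "v = 0") (auto simp: dot_square_norm powr_diff)
  have 2: "\<bar>t\<bar> powr (p - 2) * t * t = \<bar>t\<bar> powr p" for t :: real
    by (cases "t = 0") (auto simp: powr_diff power2_eq_square mult.assoc)
  have "(LINT x:\<Omega>|lebesgue. norm (grad_X b \<Omega> u x) powr (p - 2) * (grad_X b \<Omega> u x \<bullet> grad_X b \<Omega> u x))
      = ev * (LINT x:\<Omega>|lebesgue. \<bar>u x\<bar> powr (p - 2) * u x * u x)"
    using assms unfolding eigenfunction_def by blast
  then show ?thesis unfolding 1 2 set_integral_M .
qed

end

section \<open>Comparison of energies\<close>

lemma powr_MVT:
  fixes x y p :: real
  assumes "1 < p" "0 \<le> x" "x < y"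
  obtains z where "x < z" "z < y" "y powr p - x powr p = (y - x) * (p * z powr (p - 1))"
proof -
  have d: "((\<lambda>t. t powr p) has_real_derivative p * t powr (p - 1)) (at t)" if "x < t" for t
    using that assms by (auto intro!: derivative_eq_intros)
  have "continuous_on {x..y} (\<lambda>t. t powr p)"
    using assms by (intro continuous_on_powr' continuous_intros) auto
  then obtain l z where z: "x < z" "z < y" "((\<lambda>t. t powr p) has_real_derivative l) (at z)"
      "y powr p - x powr p = (y - x) * l"
    using MVT[OF assms(3), of "\<lambda>t. t powr p"] d real_differentiable_def by blast
  then show thesis using that DERIV_unique[OF z(3) d[OF z(1)]] by blast
qed

lemma powr_strict_tangent:
  fixes x y p :: real
  assumes "1 < p" "0 \<le> x" "0 < y" "x \<noteq> y"
  shows "y powr p + p * y powr (p - 1) * (x - y) < x powr p"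
proof (cases "x < y")
  case True
  obtain z where z: "x < z" "z < y" "y powr p - x powr p = (y - x) * (p * z powr (p - 1))"
    using powr_MVT[OF assms(1,2) True] .
  have "z powr (p - 1) < y powr (p - 1)"
    using z assms by (intro powr_less_mono2) auto
  then have "(y - x) * (p * z powr (p - 1)) < (y - x) * (p * y powr (p - 1))"
    using True assms(1) by (intro mult_strict_left_mono) auto
  with z(3) show ?thesis by (simp add: algebra_simps)
next
  case False
  with assms(4) have lt: "y < x" by simp
  obtain z where z: "y < z" "z < x" "x powr p - y powr p = (x - y) * (p * z powr (p - 1))"
    using powr_MVT[OF assms(1) less_imp_le[OF assms(3)] lt] .
  have "y powr (p - 1) < z powr (p - 1)"
    using z assms by (intro powr_less_mono2) auto
  then have "(x - y) * (p * y powr (p - 1)) < (x - y) * (p * z powr (p - 1))"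
    using lt assms(1) by (intro mult_strict_left_mono) auto
  with z(3) show ?thesis by (simp add: algebra_simps)
qed

text \<open>Triangle inequality, then convexity of t^p in the form of a tangent at y, the weighted
  mean of the two norms. In the equality case strictness of the tangent bound makes both norms equal
  to y, and the triangle inequality must be an equality as well; expanding the inner product then
  leaves no room for a - c.\<close>

lemma norm_powr_convex:
  fixes a c :: "'a::real_inner"
  assumes p: "1 < p" and \<theta>: "0 < \<theta>" "0 < \<eta>" "\<theta> + \<eta> = 1"
  shows "norm (\<theta> *\<^sub>R a + \<eta> *\<^sub>R c) powr p \<le> \<theta> * norm a powr p + \<eta> * norm c powr p" (is "?L \<le> ?R")
    and "norm (\<theta> *\<^sub>R a + \<eta> *\<^sub>R c) powr p = \<theta> * norm a powr p + \<eta> * norm c powr p \<Longrightarrow> a = c"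
proof -
  define y where "y = \<theta> * norm a + \<eta> * norm c"
  have y0: "0 \<le> y" using \<theta> by (simp add: y_def)
  have ny: "norm (\<theta> *\<^sub>R a + \<eta> *\<^sub>R c) \<le> y"
    unfolding y_def using norm_triangle_ineq[of "\<theta> *\<^sub>R a" "\<eta> *\<^sub>R c"] \<theta> by simp
  then have L: "?L \<le> y powr p" using p by (intro powr_mono2) auto
  have "?L \<le> ?R \<and> (?L = ?R \<longrightarrow> a = c)"
  proof (cases "y = 0")
    case True
    have "0 \<le> \<theta> * norm a" "0 \<le> \<eta> * norm c" using \<theta> by simp_all
    with True have "\<theta> * norm a = 0" "\<eta> * norm c = 0" unfolding y_def by linarith+
    then have "a = 0" "c = 0" using \<theta> by auto
    then show ?thesis by simp
  next
    case False
    with y0 have y: "0 < y" by simp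
    let ?t = "\<lambda>z. y powr p + p * y powr (p - 1) * (z - y)"
    have t: "?t z \<le> z powr p" "?t z = z powr p \<Longrightarrow> z = y" if "0 \<le> z" for z
      using powr_strict_tangent[OF p that y] by (cases "z = y"; force)+
    have "\<theta> * ?t (norm a) + \<eta> * ?t (norm c)
        = (\<theta> + \<eta>) * y powr p + p * y powr (p - 1) * (y - (\<theta> + \<eta>) * y)"
      unfolding y_def by (simp add: algebra_simps)
    then have eq: "\<theta> * ?t (norm a) + \<eta> * ?t (norm c) = y powr p" using \<theta>(3) by simp
    have ta: "\<theta> * ?t (norm a) \<le> \<theta> * norm a powr p" and tc: "\<eta> * ?t (norm c) \<le> \<eta> * norm c powr p"
      using t(1) \<theta> by (auto intro!: mult_left_mono)
    have 1: "?L \<le> ?R" using L eq ta tc by linarith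
    have "a = c" if "?L = ?R"
    proof -
      have "\<theta> * ?t (norm a) = \<theta> * norm a powr p" "\<eta> * ?t (norm c) = \<eta> * norm c powr p" and Ly: "?L = y powr p"
        using L eq ta tc that by linarith+
      then have na: "norm a = y" and nc: "norm c = y"
        using t(2)[of "norm a"] t(2)[of "norm c"] \<theta> by auto
      have "norm (\<theta> *\<^sub>R a + \<eta> *\<^sub>R c) = y"
      proof (rule ccontr)
        assume "norm (\<theta> *\<^sub>R a + \<eta> *\<^sub>R c) \<noteq> y"
        with ny have "?L < y powr p" using p by (intro powr_less_mono2) auto
        with Ly show False by simp
      qed
      then have "y\<^sup>2 = (\<theta> *\<^sub>R a + \<eta> *\<^sub>R c) \<bullet> (\<theta> *\<^sub>R a + \<eta> *\<^sub>R c)"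
        by (simp add: power2_norm_eq_inner[symmetric])
      \<comment> \<open>This is |\<theta> a + \<eta> c|^2 = \<theta> |a|^2 + \<eta> |c|^2 - \<theta>
        \<eta> |a - c|^2. The factors \<theta> + \<eta> turn it into a polynomial identity that
        holds before the sum is set to 1.\<close>
      also have "\<dots> = \<theta> * (\<theta> + \<eta>) * (a \<bullet> a) + \<eta> * (\<theta> + \<eta>) * (c \<bullet> c) - \<theta> * \<eta> * ((a - c) \<bullet> (a - c))"
        by (simp add: inner_simps inner_commute algebra_simps)
      also have "\<dots> = (\<theta> + \<eta>) * ((\<theta> + \<eta>) * y\<^sup>2) - \<theta> * \<eta> * (norm (a - c))\<^sup>2"
        unfolding power2_norm_eq_inner[symmetric] na nc by (simp add: algebra_simps)
      finally have "\<theta> * \<eta> * (norm (a - c))\<^sup>2 = 0" by (simp add: \<theta>(3))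
      then show ?thesis using \<theta> by simp
    qed
    with 1 show ?thesis by blast
  qed
  then show "?L \<le> ?R" "?L = ?R \<Longrightarrow> a = c" by blast+
qed

text \<open>If s and t are values of two positive functions and A and B their gradients, then G is
  the gradient of (s^p + t^p)^(1/p) by the chain rule. Its logarithmic gradient is the convex
  combination of A/s and B/t with weights s^p/Q and t^p/Q, where Q = s^p + t^p. Convexity of the
  p-th power of the norm, multiplied by Q, gives both the inequality and its equality case.\<close>

lemma hidden_convexity:
  fixes A B :: "'a::real_inner"
  assumes p: "1 < p" and s: "0 < s" and t: "0 < t"
  defines "G \<equiv> (s powr p + t powr p) powr (1 / p - 1) *\<^sub>R (s powr (p - 1) *\<^sub>R A + t powr (p - 1) *\<^sub>R B)"
  shows "norm G powr p \<le> norm A powr p + norm B powr p"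
    and "norm G powr p = norm A powr p + norm B powr p \<Longrightarrow> A /\<^sub>R s = B /\<^sub>R t"
proof -
  define Q where "Q = s powr p + t powr p"
  have Q: "0 < Q" using s t by (simp add: Q_def add_pos_pos)
  define \<theta> \<eta> where "\<theta> = s powr p / Q" and "\<eta> = t powr p / Q"
  have \<theta>: "0 < \<theta>" "0 < \<eta>" "\<theta> + \<eta> = 1"
    using s t Q by (auto simp: \<theta>_def \<eta>_def Q_def add_divide_distrib[symmetric])
  have c: "Q powr (1 / p - 1) * r powr (p - 1) = Q powr (1 / p) * (r powr p / Q) / r" if "0 < r" for r
    using that Q by (simp add: powr_diff)
  have "G = Q powr (1 / p) *\<^sub>R (\<theta> *\<^sub>R (A /\<^sub>R s) + \<eta> *\<^sub>R (B /\<^sub>R t))"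
    unfolding G_def Q_def[symmetric] scaleR_add_right scaleR_scaleR c[OF s] c[OF t] \<theta>_def \<eta>_def
    by (simp add: divide_inverse mult_ac)
  then have nG: "norm G powr p = Q * norm (\<theta> *\<^sub>R (A /\<^sub>R s) + \<eta> *\<^sub>R (B /\<^sub>R t)) powr p"
    using Q p by (simp add: powr_mult powr_powr)
  have n: "Q * (r powr p / Q * norm (C /\<^sub>R r) powr p) = norm C powr p" if "0 < r" for r and C :: 'a
  proof -
    have "norm (C /\<^sub>R r) = norm C / r" using that by (simp add: divide_inverse mult.commute)
    then have "norm (C /\<^sub>R r) powr p = norm C powr p / r powr p"
      using that by (simp add: powr_divide)
    then show ?thesis using that Q by simp
  qed
  have R: "Q * (\<theta> * norm (A /\<^sub>R s) powr p + \<eta> * norm (B /\<^sub>R t) powr p) = norm A powr p + norm B powr p"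
    unfolding distrib_left \<theta>_def \<eta>_def n[OF s] n[OF t] ..
  show "norm G powr p \<le> norm A powr p + norm B powr p"
    unfolding nG R[symmetric] by (rule mult_left_mono[OF norm_powr_convex(1)[OF p \<theta>] less_imp_le[OF Q]])
  show "A /\<^sub>R s = B /\<^sub>R t" if "norm G powr p = norm A powr p + norm B powr p"
    using that norm_powr_convex(2)[OF p \<theta>, of "A /\<^sub>R s" "B /\<^sub>R t"] Q unfolding nG R[symmetric] by simp
qed

text \<open>A smooth regularisation of \<open>(|s|\<^sup>p + |t|\<^sup>p)\<^sup>1\<^sup>/\<^sup>p\<close>; \<open>reg_coef\<close> is its derivative in \<open>s\<close>.\<close>

definition reg_pow :: "real \<Rightarrow> real \<Rightarrow> real \<Rightarrow> real" where
  "reg_pow p e s = (s * s + e * e) powr (p / 2)"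

definition reg_norm :: "real \<Rightarrow> real \<Rightarrow> real \<Rightarrow> real \<Rightarrow> real" where
  "reg_norm p e s t = (reg_pow p e s + reg_pow p e t) powr (1 / p)"

definition reg_coef :: "real \<Rightarrow> real \<Rightarrow> real \<Rightarrow> real \<Rightarrow> real" where
  "reg_coef p e s t = (reg_pow p e s + reg_pow p e t) powr (1 / p - 1) * ((s * s + e * e) powr (p / 2 - 1) * s)"

lemma sq_plus_sq_pos: "0 < e \<Longrightarrow> 0 < s * s + e * (e::real)"
  by (intro add_nonneg_pos) auto

lemma reg_pow_pos: "0 < e \<Longrightarrow> 0 < reg_pow p e s"
  using sq_plus_sq_pos[of e s] by (simp add: reg_pow_def)

text \<open>The powers of q cancel: the exponents 1/2 - p/2, p/2 - 1 and 1/2 add up to 0. One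
  summand of the base may be dropped since 1/p - 1 < 0. The bound is uniform in e, s and t, which is
  what dominates the gradients of the regularisations.\<close>

lemma reg_coef_bound:
  assumes "0 < e" "1 < p"
  shows "\<bar>reg_coef p e s t\<bar> \<le> 1"
proof -
  define q where "q = s * s + e * e"
  have q: "0 < q" unfolding q_def by (rule sq_plus_sq_pos[OF assms(1)])
  have S: "reg_pow p e s = q powr (p / 2)" by (simp add: reg_pow_def q_def)
  have "\<bar>s\<bar> = sqrt (s * s)" by simp
  also have "\<dots> \<le> sqrt q" unfolding q_def by (intro real_sqrt_le_mono) simp
  also have "\<dots> = q powr (1 / 2)" using q by (simp add: powr_half_sqrt)
  finally have s: "\<bar>s\<bar> \<le> q powr (1 / 2)" .
  have "(reg_pow p e s + reg_pow p e t) powr (1 / p - 1) \<le> reg_pow p e s powr (1 / p - 1)"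
    using reg_pow_pos[OF assms(1)] assms(2) by (intro powr_mono2') (auto simp: less_imp_le)
  also have "\<dots> = q powr (1 / 2 - p / 2)"
    using assms(2) by (simp add: S powr_powr right_diff_distrib)
  finally have "\<bar>reg_coef p e s t\<bar> \<le> q powr (1 / 2 - p / 2) * (q powr (p / 2 - 1) * q powr (1 / 2))"
    unfolding reg_coef_def q_def[symmetric] abs_mult using s by (intro mult_mono) auto
  also have "\<dots> = 1" using q by (simp add: powr_add[symmetric])
  finally show ?thesis .
qed

lemma reg_pow_le:
  assumes "0 \<le> e" "e \<le> 1" "1 < p"
  shows "reg_pow p e s \<le> 2 powr p * (\<bar>s\<bar> powr p + 1)"
proof -
  have "s * s + e * e \<le> (\<bar>s\<bar> + 1) * (\<bar>s\<bar> + 1)"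
  proof -
    have "e * e \<le> 1" using assms by (intro mult_le_one) auto
    then have "s * s + e * e \<le> \<bar>s\<bar> * \<bar>s\<bar> + (2 * \<bar>s\<bar> + 1)" by simp
    then show ?thesis by (simp add: algebra_simps)
  qed
  then have "reg_pow p e s \<le> ((\<bar>s\<bar> + 1) * (\<bar>s\<bar> + 1)) powr (p / 2)"
    unfolding reg_pow_def using assms by (intro powr_mono2) auto
  also have "\<dots> = (\<bar>s\<bar> + 1) powr p"
    using powr_add[of "\<bar>s\<bar> + 1" "p / 2" "p / 2"] by (simp add: powr_mult)
  also have "\<dots> \<le> 2 powr p * (\<bar>s\<bar> powr p + 1)"
    using powr_add_le[of "\<bar>s\<bar>" 1 p] assms by simp
  finally show ?thesis .
qed

text \<open>The value at the origin is the constant that is subtracted to obtain compact support; it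
  disappears with e.\<close>

lemma reg_norm_0:
  assumes "0 < e" "1 < p"
  shows "reg_norm p e 0 0 = 2 powr (1 / p) * e"
proof -
  have "(e * e) powr (p / 2) = e powr p"
    using assms powr_add[of e "p / 2" "p / 2"] by (simp add: powr_mult)
  then have "reg_norm p e 0 0 = (2 * e powr p) powr (1 / p)"
    by (simp add: reg_norm_def reg_pow_def)
  then show ?thesis using assms by (simp add: powr_mult powr_powr)
qed

lemma reg_norm_diff_powr_le:
  assumes "0 < e" "e \<le> 1" "1 < p"
  shows "\<bar>reg_norm p e s t - reg_norm p e 0 0\<bar> powr p
    \<le> 2 powr p * (\<bar>s\<bar> powr p + 1) + 2 powr p * (\<bar>t\<bar> powr p + 1) + 2"
proof -
  have n: "0 \<le> reg_norm p e a c" for a c by (simp add: reg_norm_def)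
  \<comment> \<open>Both terms are nonnegative, so their difference is at most the larger one; the
    p-th powers can then be computed separately.\<close>
  have "\<bar>reg_norm p e s t - reg_norm p e 0 0\<bar> \<le> max (reg_norm p e s t) (reg_norm p e 0 0)"
    using n[of s t] n[of 0 0] by linarith
  then have "\<bar>reg_norm p e s t - reg_norm p e 0 0\<bar> powr p \<le> max (reg_norm p e s t) (reg_norm p e 0 0) powr p"
    using assms by (intro powr_mono2) auto
  also have "\<dots> \<le> reg_norm p e s t powr p + reg_norm p e 0 0 powr p" by (simp add: max_def)
  also have "reg_norm p e s t powr p = reg_pow p e s + reg_pow p e t"
  proof -
    have "0 < reg_pow p e s + reg_pow p e t" by (intro add_pos_pos reg_pow_pos assms)
    then show ?thesis using assms by (simp add: reg_norm_def powr_powr)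
  qed
  also have "reg_norm p e 0 0 powr p = 2 * e powr p"
    unfolding reg_norm_0[OF assms(1,3)] using assms by (simp add: powr_mult powr_powr)
  also have "2 * e powr p \<le> 2" using assms powr_mono2[of p e 1] by simp
  also have "reg_pow p e s + reg_pow p e t + 2 \<le> 2 powr p * (\<bar>s\<bar> powr p + 1) + 2 powr p * (\<bar>t\<bar> powr p + 1) + 2"
    using reg_pow_le[OF less_imp_le[OF assms(1)] assms(2,3)] by (intro add_mono) auto
  finally show ?thesis by simp
qed

lemma sq_powr_half: "0 < (s::real) \<Longrightarrow> (s * s) powr (p / 2) = s powr p"
  using powr_add[of s "p / 2" "p / 2"] by (simp add: powr_mult)

lemma tendsto_reg_pow:
  assumes "e \<longlonglongrightarrow> 0" "s \<longlonglongrightarrow> s0" "0 < s0"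
  shows "(\<lambda>k. reg_pow p (e k) (s k)) \<longlonglongrightarrow> s0 powr p"
proof -
  have "(\<lambda>k. (s k * s k + e k * e k) powr (p / 2)) \<longlonglongrightarrow> (s0 * s0 + 0 * 0) powr (p / 2)"
    using assms(3) by (intro tendsto_intros assms(1,2)) auto
  then show ?thesis using sq_powr_half[OF assms(3)] by (simp add: reg_pow_def)
qed

lemma tendsto_reg_norm:
  assumes "e \<longlonglongrightarrow> 0" "\<And>k. 0 < e k" "s \<longlonglongrightarrow> s0" "0 < s0" "t \<longlonglongrightarrow> t0" "0 < t0" "1 < p"
  shows "(\<lambda>k. \<bar>reg_norm p (e k) (s k) (t k) - reg_norm p (e k) 0 0\<bar> powr p) \<longlonglongrightarrow> s0 powr p + t0 powr p"
proof -
  have Q: "0 < s0 powr p + t0 powr p" using assms by (simp add: add_pos_pos)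
  have "(\<lambda>k. reg_norm p (e k) (s k) (t k)) \<longlonglongrightarrow> (s0 powr p + t0 powr p) powr (1 / p)"
    unfolding reg_norm_def using Q by (intro tendsto_intros tendsto_reg_pow assms) auto
  moreover have "(\<lambda>k. reg_norm p (e k) 0 0) \<longlonglongrightarrow> 2 powr (1 / p) * 0"
    unfolding reg_norm_0[OF assms(2,7)] by (intro tendsto_intros assms)
  ultimately have "(\<lambda>k. \<bar>reg_norm p (e k) (s k) (t k) - reg_norm p (e k) 0 0\<bar> powr p)
      \<longlonglongrightarrow> \<bar>(s0 powr p + t0 powr p) powr (1 / p) - 2 powr (1 / p) * 0\<bar> powr p"
    using Q by (intro tendsto_intros) auto
  then show ?thesis using Q assms(7) by (simp add: powr_powr)
qed

text \<open>The limit is the coefficient of the first gradient in \<open>hidden_convexity\<close>.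
  Positivity of s0 and t0 keeps the bases of powers with possibly negative exponents away from
  0.\<close>

lemma tendsto_reg_coef:
  assumes "e \<longlonglongrightarrow> 0" "s \<longlonglongrightarrow> s0" "0 < s0" "t \<longlonglongrightarrow> t0" "0 < t0"
  shows "(\<lambda>k. reg_coef p (e k) (s k) (t k)) \<longlonglongrightarrow> (s0 powr p + t0 powr p) powr (1 / p - 1) * s0 powr (p - 1)"
proof -
  have Q: "0 < s0 powr p + t0 powr p" using assms by (simp add: add_pos_pos)
  have "(\<lambda>k. reg_coef p (e k) (s k) (t k)) \<longlonglongrightarrow>
      (s0 powr p + t0 powr p) powr (1 / p - 1) * ((s0 * s0 + 0 * 0) powr (p / 2 - 1) * s0)"
    unfolding reg_coef_def using assms(3) Q by (intro tendsto_intros tendsto_reg_pow assms) auto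
  moreover have "(s0 * s0 + 0 * 0) powr (p / 2 - 1) * s0 = s0 powr (p - 1)"
    using sq_powr_half[OF assms(3), of "p - 2"] assms(3) powr_add[of s0 "p - 2" 1] by (simp add: diff_divide_distrib)
  ultimately show ?thesis by simp
qed

section \<open>Passage from test functions to eigenfunctions\<close>

context open_fields
begin

text \<open>Subtracting the value at the origin makes w vanish outside the union of the two
  supports, and e > 0 keeps every base of a power positive, so w is smooth. The coefficient of the
  second gradient is \<open>reg_coef\<close> with its arguments exchanged, by symmetry of
  \<open>reg_norm\<close>.\<close>

lemma reg_norm_test_fun:
  assumes \<phi>: "test_fun \<Omega> \<phi>" and \<psi>: "test_fun \<Omega> \<psi>" and e: "0 < e"
  defines "w \<equiv> \<lambda>x. reg_norm p e (\<phi> x) (\<psi> x) - reg_norm p e 0 0"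
  shows "test_fun \<Omega> w"
    and "grad_cl w x = reg_coef p e (\<phi> x) (\<psi> x) *\<^sub>R grad_cl \<phi> x + reg_coef p e (\<psi> x) (\<phi> x) *\<^sub>R grad_cl \<psi> x"
proof -
  have s1: "smooth_on UNIV (\<lambda>x. reg_pow p e (f x))" if "smooth_on UNIV f" for f :: "real ^ 'n \<Rightarrow> real"
    unfolding reg_pow_def
    by (rule smooth_on_comp[OF open_UNIV smooth_real_powr])
      (use sq_plus_sq_pos[OF e] in \<open>auto intro!: smooth_on_add smooth_on_mult that smooth_on_const\<close>)
  have sm: "smooth_on UNIV w"
    unfolding w_def reg_norm_def
    by (rule smooth_on_diff[OF open_UNIV smooth_on_comp[OF open_UNIV smooth_real_powr] smooth_on_const])
      (use reg_pow_pos[OF e] in \<open>auto intro!: smooth_on_add s1 test_fun_smooth[OF \<phi>] test_fun_smooth[OF \<psi>] add_pos_pos\<close>)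
  obtain K L where KL: "compact K" "K \<subseteq> \<Omega>" "\<forall>x. x \<notin> K \<longrightarrow> \<phi> x = 0"
    "compact L" "L \<subseteq> \<Omega>" "\<forall>x. x \<notin> L \<longrightarrow> \<psi> x = 0"
    using \<phi> \<psi> unfolding test_fun_def by metis
  then have "compact (K \<union> L) \<and> K \<union> L \<subseteq> \<Omega> \<and> (\<forall>x. x \<notin> K \<union> L \<longrightarrow> w x = 0)"
    by (auto simp: w_def)
  with sm show "test_fun \<Omega> w" unfolding test_fun_def by blast
  have df: "\<phi> differentiable (at x)" "\<psi> differentiable (at x)"
    using smooth_on_differentiable test_fun_smooth \<phi> \<psi> by blast+
  have p1: "partial k (\<lambda>y. reg_pow p e (f y)) x = p * ((f x * f x + e * e) powr (p / 2 - 1) * f x) * partial k f x"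
    "(\<lambda>y. reg_pow p e (f y)) differentiable (at x)"
    if f: "f differentiable (at x)" for f k
  proof -
    have "((\<lambda>s. reg_pow p e s) has_real_derivative (p / 2) * (f x * f x + e * e) powr (p / 2 - 1) * (f x + f x)) (at (f x))"
      unfolding reg_pow_def using sq_plus_sq_pos[OF e, of "f x"]
      by (auto intro!: derivative_eq_intros)
    from partial_comp[OF f this, of k] differentiable_comp_real[OF f this]
    show "partial k (\<lambda>y. reg_pow p e (f y)) x = p * ((f x * f x + e * e) powr (p / 2 - 1) * f x) * partial k f x"
      "(\<lambda>y. reg_pow p e (f y)) differentiable (at x)" by (simp_all add: mult_ac)
  qed
  let ?S = "\<lambda>y. reg_pow p e (\<phi> y) + reg_pow p e (\<psi> y)"
  have "0 < ?S x" using reg_pow_pos[OF e] by (simp add: add_pos_pos)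
  then have d: "((\<lambda>s. s powr (1 / p) - reg_norm p e 0 0) has_real_derivative (1 / p) * ?S x powr (1 / p - 1)) (at (?S x))"
    by (auto intro!: derivative_eq_intros)
  have "partial k w x = reg_coef p e (\<phi> x) (\<psi> x) * partial k \<phi> x + reg_coef p e (\<psi> x) (\<phi> x) * partial k \<psi> x" for k
  proof -
    have "partial k w x = (1 / p) * ?S x powr (1 / p - 1) * partial k ?S x"
      unfolding w_def reg_norm_def
      using partial_comp[OF differentiable_add[OF p1(2)[OF df(1)] p1(2)[OF df(2)]] d, of k]
      by (simp add: reg_norm_def)
    also have "partial k ?S x = partial k (\<lambda>y. reg_pow p e (\<phi> y)) x + partial k (\<lambda>y. reg_pow p e (\<psi> y)) x"
      by (rule partial_add[OF p1(2)[OF df(1)] p1(2)[OF df(2)]])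
    finally have "p * partial k w x
        = p * (reg_coef p e (\<phi> x) (\<psi> x) * partial k \<phi> x + reg_coef p e (\<psi> x) (\<phi> x) * partial k \<psi> x)"
      using p unfolding p1(1)[OF df(1)] p1(1)[OF df(2)]
      by (simp add: reg_coef_def field_simps add.commute)
    then show ?thesis using p by simp
  qed
  then show "grad_cl w x = reg_coef p e (\<phi> x) (\<psi> x) *\<^sub>R grad_cl \<phi> x + reg_coef p e (\<psi> x) (\<phi> x) *\<^sub>R grad_cl \<psi> x"
    by (simp add: vec_eq_iff grad_cl_def X_cl_def sum_distrib_left sum.distrib[symmetric] algebra_simps)
qed

lemma grad_cl_measurable: "test_fun \<Omega> \<phi> \<Longrightarrow> grad_cl \<phi> \<in> borel_measurable M"
  by (rule borel_measurable_vecI) (simp add: grad_cl_def test_fun_measurable_M[OF test_fun_X_cl])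

text \<open>Dominated convergence on both sides of \<open>lambda1_test_fun\<close>, applied to
  regularisations \<open>w k\<close> of pairs of approximating test functions. The summed
  approximation errors D and E dominate, and the integrands converge almost everywhere because u and
  v are positive. G is only a pointwise limit of gradients; it is never identified with a weak
  gradient.\<close>

theorem energy_comparison:
  assumes u: "u \<in> W1p0 b p \<Omega>" and v: "v \<in> W1p0 b p \<Omega>"
    and pos: "\<And>x. x \<in> \<Omega> \<Longrightarrow> 0 < u x" "\<And>x. x \<in> \<Omega> \<Longrightarrow> 0 < v x"
  defines "G \<equiv> \<lambda>x. (u x powr p + v x powr p) powr (1 / p - 1) *\<^sub>R
    (u x powr (p - 1) *\<^sub>R grad_X b \<Omega> u x + v x powr (p - 1) *\<^sub>R grad_X b \<Omega> v x)"
  shows "lambda1 b p \<Omega> * integral\<^sup>L M (\<lambda>x. u x powr p + v x powr p) \<le> integral\<^sup>L M (\<lambda>x. norm (G x) powr p)"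
proof -
  obtain \<phi> D where \<phi>: "\<And>k::nat. test_fun \<Omega> (\<phi> k)" "integrable M D"
    "AE x in M. \<forall>k. \<bar>u x - \<phi> k x\<bar> powr p \<le> D x \<and> norm (grad_X b \<Omega> u x - grad_cl (\<phi> k) x) powr p \<le> D x"
    "AE x in M. (\<lambda>k. \<phi> k x) \<longlonglongrightarrow> u x"
    "AE x in M. (\<lambda>k. grad_cl (\<phi> k) x) \<longlonglongrightarrow> grad_X b \<Omega> u x"
    using W1p0_approx[OF u] by blast
  obtain \<psi> E where \<psi>: "\<And>k::nat. test_fun \<Omega> (\<psi> k)" "integrable M E"
    "AE x in M. \<forall>k. \<bar>v x - \<psi> k x\<bar> powr p \<le> E x \<and> norm (grad_X b \<Omega> v x - grad_cl (\<psi> k) x) powr p \<le> E x"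
    "AE x in M. (\<lambda>k. \<psi> k x) \<longlonglongrightarrow> v x"
    "AE x in M. (\<lambda>k. grad_cl (\<psi> k) x) \<longlonglongrightarrow> grad_X b \<Omega> v x"
    using W1p0_approx[OF v] by blast
  have W: "u \<in> W1p b p \<Omega>" "v \<in> W1p b p \<Omega>" using u v unfolding W1p0_def by blast+
  note mW = W1p_measurable[OF W(1)] W1p_measurable[OF W(2)] grad_X_measurable[OF W(1)] grad_X_measurable[OF W(2)]
  \<comment> \<open>The rate at which \<open>e k\<close> tends to 0 is arbitrary, since the bounds
    on the regularisation are uniform for e \<le> 1.\<close>
  define e where "e k = inverse (real (Suc k))" for k
  have e: "0 < e k" "e k \<le> 1" for k by (auto simp: e_def field_simps)
  have e0: "e \<longlonglongrightarrow> 0" unfolding e_def[abs_def] by (rule LIMSEQ_inverse_real_of_nat)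
  define w where "w k x = reg_norm p (e k) (\<phi> k x) (\<psi> k x) - reg_norm p (e k) 0 0" for k x
  have w: "test_fun \<Omega> (w k)"
    "grad_cl (w k) x = reg_coef p (e k) (\<phi> k x) (\<psi> k x) *\<^sub>R grad_cl (\<phi> k) x
      + reg_coef p (e k) (\<psi> k x) (\<phi> k x) *\<^sub>R grad_cl (\<psi> k) x" for k x
    unfolding w_def[abs_def] by (rule reg_norm_test_fun[OF \<phi>(1) \<psi>(1) e(1)])+
  have split: "norm c powr p \<le> 2 powr p * (norm a powr p + d)"
    if "norm (a - c) powr p \<le> d" for a c :: "'z::real_normed_vector" and d
    using norm_powr_le_add[OF that] p by simp
  have "(\<lambda>k. integral\<^sup>L M (\<lambda>x. \<bar>w k x\<bar> powr p)) \<longlonglongrightarrow> integral\<^sup>L M (\<lambda>x. u x powr p + v x powr p)"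
  proof (rule integral_dominated_convergence)
    let ?F = "\<lambda>x. 2 powr p * (2 powr p * (\<bar>u x\<bar> powr p + D x) + 1) + 2 powr p * (2 powr p * (\<bar>v x\<bar> powr p + E x) + 1) + 2"
    show "integrable M ?F"
      using W1p_integrable[OF W(1)] W1p_integrable[OF W(2)] \<phi>(2) \<psi>(2)
        finite_measure.integrable_const[OF finite_M]
      by (intro Bochner_Integration.integrable_add integrable_mult_right)
    show "(\<lambda>x. u x powr p + v x powr p) \<in> borel_measurable M" using mW by measurable
    show "(\<lambda>x. \<bar>w k x\<bar> powr p) \<in> borel_measurable M" for k
      using test_fun_measurable_M[OF w(1)] by measurable
    show "AE x in M. norm (\<bar>w k x\<bar> powr p) \<le> ?F x" for k
      using \<phi>(3) \<psi>(3)
    proof eventually_elim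
      case (elim x)
      have "\<bar>\<phi> k x\<bar> powr p \<le> 2 powr p * (\<bar>u x\<bar> powr p + D x)" "\<bar>\<psi> k x\<bar> powr p \<le> 2 powr p * (\<bar>v x\<bar> powr p + E x)"
        using split[of "u x" "\<phi> k x"] split[of "v x" "\<psi> k x"] elim by simp_all
      then have "2 powr p * (\<bar>\<phi> k x\<bar> powr p + 1) + 2 powr p * (\<bar>\<psi> k x\<bar> powr p + 1) + 2 \<le> ?F x"
        by (intro add_mono mult_left_mono) auto
      with reg_norm_diff_powr_le[OF e p, of k "\<phi> k x" "\<psi> k x"] show ?case by (simp add: w_def)
    qed
    show "AE x in M. (\<lambda>k. \<bar>w k x\<bar> powr p) \<longlonglongrightarrow> u x powr p + v x powr p"
      using \<phi>(4) \<psi>(4) AE_M_in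
    proof eventually_elim
      case (elim x)
      show ?case unfolding w_def
        by (rule tendsto_reg_norm[OF e0 e(1) elim(1) pos(1)[OF elim(3)] elim(2) pos(2)[OF elim(3)] p])
    qed
  qed
  then have 1: "(\<lambda>k. lambda1 b p \<Omega> * integral\<^sup>L M (\<lambda>x. \<bar>w k x\<bar> powr p))
      \<longlonglongrightarrow> lambda1 b p \<Omega> * integral\<^sup>L M (\<lambda>x. u x powr p + v x powr p)"
    by (rule tendsto_mult_left)
  have 2: "(\<lambda>k. integral\<^sup>L M (\<lambda>x. norm (grad_cl (w k) x) powr p)) \<longlonglongrightarrow> integral\<^sup>L M (\<lambda>x. norm (G x) powr p)"
  proof (rule integral_dominated_convergence)
    let ?F = "\<lambda>x. 2 powr p * (2 powr p * (norm (grad_X b \<Omega> u x) powr p + D x)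
      + 2 powr p * (norm (grad_X b \<Omega> v x) powr p + E x))"
    show "integrable M ?F"
      using grad_X_integrable[OF W(1)] grad_X_integrable[OF W(2)] \<phi>(2) \<psi>(2)
      by (intro Bochner_Integration.integrable_add integrable_mult_right)
    show "(\<lambda>x. norm (G x) powr p) \<in> borel_measurable M"
      unfolding G_def using mW by measurable
    show "(\<lambda>x. norm (grad_cl (w k) x) powr p) \<in> borel_measurable M" for k
      using grad_cl_measurable[OF w(1)] by measurable
    show "AE x in M. norm (norm (grad_cl (w k) x) powr p) \<le> ?F x" for k
      using \<phi>(3) \<psi>(3)
    proof eventually_elim
      case (elim x)
      let ?a = "grad_cl (\<phi> k) x" and ?c = "grad_cl (\<psi> k) x"
      have "norm (grad_cl (w k) x) \<le> \<bar>reg_coef p (e k) (\<phi> k x) (\<psi> k x)\<bar> * norm ?a + \<bar>reg_coef p (e k) (\<psi> k x) (\<phi> k x)\<bar> * norm ?c"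
        unfolding w(2) by (metis norm_scaleR norm_triangle_ineq)
      also have "\<dots> \<le> 1 * norm ?a + 1 * norm ?c"
        by (intro add_mono mult_right_mono reg_coef_bound e p) auto
      finally have "norm (grad_cl (w k) x) powr p \<le> (norm ?a + norm ?c) powr p"
        using p by (intro powr_mono2) auto
      also have "\<dots> \<le> 2 powr p * (norm ?a powr p + norm ?c powr p)" using p by (intro powr_add_le) auto
      also have "\<dots> \<le> ?F x"
        using elim by (intro mult_left_mono add_mono split) auto
      finally show ?case by simp
    qed
    show "AE x in M. (\<lambda>k. norm (grad_cl (w k) x) powr p) \<longlonglongrightarrow> norm (G x) powr p"
      using \<phi>(4,5) \<psi>(4,5) AE_M_in
    proof eventually_elim
      case (elim x)
      have u0: "0 < u x" and v0: "0 < v x" using pos elim by auto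
      have "(\<lambda>k. grad_cl (w k) x) \<longlonglongrightarrow>
          ((u x powr p + v x powr p) powr (1 / p - 1) * u x powr (p - 1)) *\<^sub>R grad_X b \<Omega> u x
        + ((v x powr p + u x powr p) powr (1 / p - 1) * v x powr (p - 1)) *\<^sub>R grad_X b \<Omega> v x"
        unfolding w(2) by (intro tendsto_intros tendsto_reg_coef e0 elim u0 v0)
      then have "(\<lambda>k. grad_cl (w k) x) \<longlonglongrightarrow> G x"
        by (simp add: G_def scaleR_add_right add.commute[of "v x powr p"])
      then show ?case using p by (intro tendsto_powr2 tendsto_norm tendsto_const) auto
    qed
  qed
  show ?thesis
    by (rule LIMSEQ_le[OF 1 2]) (use lambda1_test_fun[OF w(1)] in blast)
qed

theorem log_gradients_agree:
  assumes u: "eigenfunction b p \<Omega> (lambda1 b p \<Omega>) u" and v: "eigenfunction b p \<Omega> (lambda1 b p \<Omega>) v"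
    and pos: "\<And>x. x \<in> \<Omega> \<Longrightarrow> 0 < u x" "\<And>x. x \<in> \<Omega> \<Longrightarrow> 0 < v x"
  shows "AE x in M. grad_X b \<Omega> u x /\<^sub>R u x = grad_X b \<Omega> v x /\<^sub>R v x"
proof -
  have W0: "u \<in> W1p0 b p \<Omega>" "v \<in> W1p0 b p \<Omega>" using u v unfolding eigenfunction_def by blast+
  then have W: "u \<in> W1p b p \<Omega>" "v \<in> W1p b p \<Omega>" unfolding W1p0_def by blast+
  note mW = W1p_measurable[OF W(1)] W1p_measurable[OF W(2)] grad_X_measurable[OF W(1)] grad_X_measurable[OF W(2)]
  define G where "G x = (u x powr p + v x powr p) powr (1 / p - 1) *\<^sub>R
    (u x powr (p - 1) *\<^sub>R grad_X b \<Omega> u x + v x powr (p - 1) *\<^sub>R grad_X b \<Omega> v x)" for x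
  let ?g = "\<lambda>x. norm (G x) powr p"
    and ?A = "\<lambda>x. norm (grad_X b \<Omega> u x) powr p" and ?B = "\<lambda>x. norm (grad_X b \<Omega> v x) powr p"
  have int_abs: "integral\<^sup>L M (\<lambda>x. \<bar>f x\<bar> powr p) = integral\<^sup>L M (\<lambda>x. f x powr p)"
    "integrable M (\<lambda>x. \<bar>f x\<bar> powr p) \<longleftrightarrow> integrable M (\<lambda>x. f x powr p)"
    if "\<And>x. x \<in> \<Omega> \<Longrightarrow> 0 < f x" for f :: "real ^ 'n \<Rightarrow> real"
    by (rule Bochner_Integration.integral_cong Bochner_Integration.integrable_cong;
        use that in \<open>force simp: space_restrict_space\<close>)+
  note iA = grad_X_integrable[OF W(1)] and iB = grad_X_integrable[OF W(2)]
  have le: "AE x in M. ?g x \<le> ?A x + ?B x"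
    using AE_M_in by eventually_elim (unfold G_def, rule hidden_convexity(1)[OF p pos])
  have mG: "?g \<in> borel_measurable M" unfolding G_def using mW by measurable
  \<comment> \<open>Integrability of this density follows from the pointwise bound; it is needed to
    split the integral of the difference below.\<close>
  have ig: "integrable M ?g"
    by (rule Bochner_Integration.integrable_bound[OF Bochner_Integration.integrable_add[OF iA iB] mG])
      (use le in eventually_elim, simp)
  have "integral\<^sup>L M ?A + integral\<^sup>L M ?B
      = lambda1 b p \<Omega> * integral\<^sup>L M (\<lambda>x. u x powr p) + lambda1 b p \<Omega> * integral\<^sup>L M (\<lambda>x. v x powr p)"
    using eigenfunction_energy[OF u] eigenfunction_energy[OF v] int_abs(1)[of u] int_abs(1)[of v] pos by simp
  also have "\<dots> = lambda1 b p \<Omega> * integral\<^sup>L M (\<lambda>x. u x powr p + v x powr p)"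
    using W1p_integrable[OF W(1)] W1p_integrable[OF W(2)]
      int_abs(2)[of u] int_abs(2)[of v] pos by (simp add: distrib_left)
  also have "\<dots> \<le> integral\<^sup>L M ?g"
    unfolding G_def by (rule energy_comparison[OF W0 pos])
  finally have "integral\<^sup>L M (\<lambda>x. ?A x + ?B x - ?g x) \<le> 0"
    using iA iB ig by simp
  moreover have nn: "AE x in M. 0 \<le> ?A x + ?B x - ?g x" using le by eventually_elim simp
  moreover have "0 \<le> integral\<^sup>L M (\<lambda>x. ?A x + ?B x - ?g x)" by (rule integral_nonneg_AE[OF nn])
  ultimately have "integral\<^sup>L M (\<lambda>x. ?A x + ?B x - ?g x) = 0" by linarith
  then have "AE x in M. ?A x + ?B x - ?g x = 0"
    using integral_nonneg_eq_0_iff_AE[OF _ nn] iA iB ig by simp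
  with AE_M_in show ?thesis
  proof eventually_elim
    case (elim x)
    then have "?g x = ?A x + ?B x" by simp
    then show ?case using hidden_convexity(2)[OF p pos(1)[OF elim(1)] pos(2)[OF elim(1)]] unfolding G_def by blast
  qed
qed

end

section \<open>Logarithms of positive functions\<close>

text \<open>The logarithm of sqrt(s^2 + d^2). It is smooth on the whole line, as it must be, because
  the approximating test functions may vanish or change sign.\<close>

definition reg_ln :: "real \<Rightarrow> real \<Rightarrow> real" where
  "reg_ln d s = ln (s * s + d * d) / 2"

text \<open>From below ln d, from above ln (|s| + d) = ln d + ln (1 + |s|/d). Linear growth in s
  allows domination by integrable p-th powers.\<close>

lemma reg_ln_bound:
  assumes "0 < d"
  shows "\<bar>reg_ln d s\<bar> \<le> \<bar>ln d\<bar> + \<bar>s\<bar> / d"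
proof -
  have dd: "ln (d * d) = 2 * ln d" using assms by (simp add: ln_mult)
  have "ln (d * d) \<le> ln (s * s + d * d)" using assms by (intro ln_mono) (auto intro: sq_plus_sq_pos)
  then have lo: "ln d \<le> reg_ln d s" by (simp add: reg_ln_def dd)
  have "s * s + d * d \<le> (\<bar>s\<bar> + d) * (\<bar>s\<bar> + d)"
    using assms by (simp add: algebra_simps)
  then have "ln (s * s + d * d) \<le> ln ((\<bar>s\<bar> + d) * (\<bar>s\<bar> + d))"
    using assms sq_plus_sq_pos[OF assms, of s] by (intro ln_mono) auto
  also have "ln ((\<bar>s\<bar> + d) * (\<bar>s\<bar> + d)) = 2 * ln (\<bar>s\<bar> + d)"
    using assms by (subst ln_mult_pos) (auto simp: add_nonneg_pos)
  finally have "reg_ln d s \<le> ln (\<bar>s\<bar> + d)" by (simp add: reg_ln_def)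
  also have "\<bar>s\<bar> + d = d * (1 + \<bar>s\<bar> / d)" using assms by (simp add: distrib_left)
  also have "ln (d * (1 + \<bar>s\<bar> / d)) = ln d + ln (1 + \<bar>s\<bar> / d)"
  proof (rule ln_mult_pos)
    show "0 < 1 + \<bar>s\<bar> / d" using assms by (simp add: add_pos_nonneg)
  qed (rule assms)
  also have "\<dots> \<le> ln d + \<bar>s\<bar> / d"
    using assms by (intro add_left_mono ln_add_one_self_le_self) auto
  finally have hi: "reg_ln d s \<le> ln d + \<bar>s\<bar> / d" .
  have "0 \<le> \<bar>s\<bar> / d" using assms by simp
  with lo hi show ?thesis by linarith
qed

text \<open>The fraction is the derivative of \<open>reg_ln d\<close>; for fixed d it is bounded by
  the inequality between the arithmetic and the geometric mean.\<close>

lemma reg_ln_deriv_bound: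
  fixes s d :: real
  assumes "0 < d"
  shows "\<bar>s / (s * s + d * d)\<bar> \<le> 1 / d"
proof -
  have q: "0 < s * s + d * d" by (rule sq_plus_sq_pos[OF assms])
  have "2 * (\<bar>s\<bar> * d) \<le> \<bar>s\<bar> * \<bar>s\<bar> + d * d"
    using sum_squares_bound[of "\<bar>s\<bar>" d] by (simp add: power2_eq_square)
  moreover have "0 \<le> \<bar>s\<bar> * d" using assms by simp
  ultimately have "\<bar>s\<bar> * d \<le> s * s + d * d" by simp
  then show ?thesis using q assms by (simp add: abs_divide abs_of_pos field_simps)
qed

lemma le_one_plus_powr: "1 < p \<Longrightarrow> \<bar>s\<bar> \<le> 1 + \<bar>s\<bar> powr p" for s p :: real
proof (cases "\<bar>s\<bar> \<le> 1")
  case False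
  assume "1 < p"
  with False have "\<bar>s\<bar> powr 1 \<le> \<bar>s\<bar> powr p" by (intro powr_mono) auto
  with False show ?thesis by simp
qed (simp add: add_increasing2)

context open_fields
begin

lemma X_cl_reg_ln:
  assumes \<phi>: "smooth_on UNIV \<phi>" and d: "0 < d"
  shows "smooth_on UNIV (\<lambda>x. reg_ln d (\<phi> x))"
    and "X_cl i (\<lambda>x. reg_ln d (\<phi> x)) x = \<phi> x / (\<phi> x * \<phi> x + d * d) * X_cl i \<phi> x"
proof -
  have "smooth_on UNIV (\<lambda>x. ln (\<phi> x * \<phi> x + d * d))"
    by (rule smooth_on_comp[OF open_UNIV smooth_real_ln])
      (use sq_plus_sq_pos[OF d] in \<open>auto intro!: smooth_on_add smooth_on_mult \<phi> smooth_on_const\<close>)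
  from smooth_on_mult[OF open_UNIV this smooth_on_const[of _ "1/2"]]
  show "smooth_on UNIV (\<lambda>x. reg_ln d (\<phi> x))" by (simp add: reg_ln_def)
  have "((\<lambda>s. reg_ln d s) has_real_derivative \<phi> x / (\<phi> x * \<phi> x + d * d)) (at (\<phi> x))"
  proof -
    have "((\<lambda>s. s * s + d * d) has_real_derivative \<phi> x + \<phi> x) (at (\<phi> x))"
      by (auto intro!: derivative_eq_intros)
    from DERIV_cdivide[OF DERIV_chain2[OF DERIV_ln[OF sq_plus_sq_pos[OF d]] this], of 2]
    have "((\<lambda>s. ln (s * s + d * d) / 2) has_real_derivative
      inverse (\<phi> x * \<phi> x + d * d) * (\<phi> x + \<phi> x) / 2) (at (\<phi> x))" .
    moreover have "c * (a + a) / 2 = a * c" for a c :: real by simp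
    ultimately show ?thesis unfolding reg_ln_def divide_inverse[of "\<phi> x"] by metis
  qed
  from partial_comp[OF smooth_on_differentiable[OF \<phi> UNIV_I] this]
  show "X_cl i (\<lambda>x. reg_ln d (\<phi> x)) x = \<phi> x / (\<phi> x * \<phi> x + d * d) * X_cl i \<phi> x"
    by (simp add: X_cl_def sum_distrib_left mult_ac)
qed

text \<open>The chain rule for the approximating test functions, passed to the limit at fixed d: the
  bounded derivative and the linear growth of \<open>reg_ln d\<close> dominate the two sides. The
  parameter d can tend to 0 only after this, since the logarithm itself cannot be applied to the
  approximants.\<close>

lemma weak_X_reg_ln:
  assumes u: "u \<in> W1p0 b p \<Omega>" and \<psi>: "test_fun \<Omega> \<psi>" and d: "0 < d"
  shows "integral\<^sup>L M (\<lambda>x. u x / (u x * u x + d * d) * grad_X b \<Omega> u x $ i * \<psi> x)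
    = integral\<^sup>L M (\<lambda>x. reg_ln d (u x) * adjoint_X b i \<psi> x)"
proof -
  obtain \<phi> D where \<phi>: "\<And>k::nat. test_fun \<Omega> (\<phi> k)" "integrable M D"
    "AE x in M. \<forall>k. \<bar>u x - \<phi> k x\<bar> powr p \<le> D x \<and> norm (grad_X b \<Omega> u x - grad_cl (\<phi> k) x) powr p \<le> D x"
    "AE x in M. (\<lambda>k. \<phi> k x) \<longlonglongrightarrow> u x"
    "AE x in M. (\<lambda>k. grad_cl (\<phi> k) x) \<longlonglongrightarrow> grad_X b \<Omega> u x"
    using W1p0_approx[OF u] by blast
  have W: "u \<in> W1p b p \<Omega>" using u unfolding W1p0_def by blast
  note mu [measurable] = W1p_measurable[OF W]
  have mX [measurable]: "(\<lambda>x. grad_X b \<Omega> u x $ i) \<in> borel_measurable M"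
    using W1p_has_weak_X[OF W] L1_loc_measurable by (auto simp: grad_X_def has_weak_X_def)
  note \<alpha> = test_fun_adjoint[OF \<psi>, of i]
  have [measurable]: "\<psi> \<in> borel_measurable M" "adjoint_X b i \<psi> \<in> borel_measurable M"
    by (rule test_fun_measurable_M[OF \<psi>] test_fun_measurable_M[OF \<alpha>])+
  have [measurable]: "\<phi> k \<in> borel_measurable M" "X_cl i (\<phi> k) \<in> borel_measurable M" for k
    by (rule test_fun_measurable_M[OF \<phi>(1)] test_fun_measurable_M[OF test_fun_X_cl[OF \<phi>(1)]])+
  obtain B where B: "\<And>x. \<bar>\<psi> x\<bar> \<le> B" "0 < B" using test_fun_bounded[OF \<psi>] by blast
  obtain C where C: "\<And>x. \<bar>adjoint_X b i \<psi> x\<bar> \<le> C" "0 < C" using test_fun_bounded[OF \<alpha>] by blast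
  have split: "norm c \<le> 1 + 2 powr p * (norm a powr p + e)"
    if "norm (a - c) powr p \<le> e" for a c :: "'z::real_normed_vector" and e
    using norm_powr_le_add[OF that] le_one_plus_powr[OF p, of "norm c"] p by simp
  have 1: "(\<lambda>k. integral\<^sup>L M (\<lambda>x. \<phi> k x / (\<phi> k x * \<phi> k x + d * d) * X_cl i (\<phi> k) x * \<psi> x))
      \<longlonglongrightarrow> integral\<^sup>L M (\<lambda>x. u x / (u x * u x + d * d) * grad_X b \<Omega> u x $ i * \<psi> x)"
  proof (rule integral_dominated_convergence)
    let ?F = "\<lambda>x. 1 / d * (1 + 2 powr p * (norm (grad_X b \<Omega> u x) powr p + D x)) * B"
    show "integrable M ?F"
      using grad_X_integrable[OF W] \<phi>(2) finite_measure.integrable_const[OF finite_M]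
      by (intro Bochner_Integration.integrable_add integrable_mult_right integrable_mult_left)
    show "AE x in M. norm (\<phi> k x / (\<phi> k x * \<phi> k x + d * d) * X_cl i (\<phi> k) x * \<psi> x) \<le> ?F x" for k
      using \<phi>(3)
    proof eventually_elim
      case (elim x)
      have "\<bar>X_cl i (\<phi> k) x\<bar> \<le> norm (grad_cl (\<phi> k) x)"
        using component_le_norm_cart[of "grad_cl (\<phi> k) x" i] by (simp add: grad_cl_def)
      also have "\<dots> \<le> 1 + 2 powr p * (norm (grad_X b \<Omega> u x) powr p + D x)"
        using elim by (intro split) auto
      finally have "\<bar>X_cl i (\<phi> k) x\<bar> \<le> 1 + 2 powr p * (norm (grad_X b \<Omega> u x) powr p + D x)" .
      then show ?case
        unfolding real_norm_def abs_mult using reg_ln_deriv_bound[OF d] B d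
        by (intro mult_mono) (auto intro: order_trans[OF abs_ge_zero])
    qed
    show "AE x in M. (\<lambda>k. \<phi> k x / (\<phi> k x * \<phi> k x + d * d) * X_cl i (\<phi> k) x * \<psi> x)
        \<longlonglongrightarrow> u x / (u x * u x + d * d) * grad_X b \<Omega> u x $ i * \<psi> x"
      using \<phi>(4,5)
    proof eventually_elim
      case (elim x)
      have "(\<lambda>k. X_cl i (\<phi> k) x) \<longlonglongrightarrow> grad_X b \<Omega> u x $ i"
        using tendsto_vec_nth[OF elim(2), of i] by (simp add: grad_cl_def)
      then show ?case
        using sq_plus_sq_pos[OF d, of "u x"] by (intro tendsto_intros elim(1)) auto
    qed
  qed measurable
  have 2: "(\<lambda>k. integral\<^sup>L M (\<lambda>x. reg_ln d (\<phi> k x) * adjoint_X b i \<psi> x))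
      \<longlonglongrightarrow> integral\<^sup>L M (\<lambda>x. reg_ln d (u x) * adjoint_X b i \<psi> x)"
  proof (rule integral_dominated_convergence)
    let ?F = "\<lambda>x. (\<bar>ln d\<bar> + (1 + 2 powr p * (\<bar>u x\<bar> powr p + D x)) * inverse d) * C"
    show "integrable M ?F"
      using W1p_integrable[OF W] \<phi>(2) finite_measure.integrable_const[OF finite_M]
      by (intro Bochner_Integration.integrable_add integrable_mult_right integrable_mult_left)
    show "(\<lambda>x. reg_ln d (u x) * adjoint_X b i \<psi> x) \<in> borel_measurable M"
      "(\<lambda>x. reg_ln d (\<phi> k x) * adjoint_X b i \<psi> x) \<in> borel_measurable M" for k
      unfolding reg_ln_def by measurable
    show "AE x in M. norm (reg_ln d (\<phi> k x) * adjoint_X b i \<psi> x) \<le> ?F x" for k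
      using \<phi>(3)
    proof eventually_elim
      case (elim x)
      have "\<bar>\<phi> k x\<bar> \<le> 1 + 2 powr p * (\<bar>u x\<bar> powr p + D x)"
        using split[of "u x" "\<phi> k x" "D x"] elim by simp
      then have "\<bar>\<phi> k x\<bar> / d \<le> (1 + 2 powr p * (\<bar>u x\<bar> powr p + D x)) * inverse d"
        unfolding divide_inverse using d by (intro mult_right_mono) auto
      then have "\<bar>reg_ln d (\<phi> k x)\<bar> \<le> \<bar>ln d\<bar> + (1 + 2 powr p * (\<bar>u x\<bar> powr p + D x)) * inverse d"
        using reg_ln_bound[OF d, of "\<phi> k x"] by linarith
      then show ?case
        unfolding real_norm_def abs_mult using C by (intro mult_mono) (auto intro: order_trans[OF abs_ge_zero])
    qed
    show "AE x in M. (\<lambda>k. reg_ln d (\<phi> k x) * adjoint_X b i \<psi> x) \<longlonglongrightarrow> reg_ln d (u x) * adjoint_X b i \<psi> x"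
      using \<phi>(4)
    proof eventually_elim
      case (elim x)
      then show ?case unfolding reg_ln_def
        using sq_plus_sq_pos[OF d, of "u x"] by (intro tendsto_intros) auto
    qed
  qed
  have "integral\<^sup>L M (\<lambda>x. \<phi> k x / (\<phi> k x * \<phi> k x + d * d) * X_cl i (\<phi> k) x * \<psi> x)
      = integral\<^sup>L M (\<lambda>x. reg_ln d (\<phi> k x) * adjoint_X b i \<psi> x)" for k
  proof -
    note s = test_fun_smooth[OF \<phi>(1)[of k]]
    have "(LINT x:\<Omega>|lebesgue. X_cl i (\<lambda>x. reg_ln d (\<phi> k x)) x * \<psi> x)
        = (LINT x:\<Omega>|lebesgue. reg_ln d (\<phi> k x) * adjoint_X b i \<psi> x)"
      using has_weak_X_smooth[OF X_cl_reg_ln(1)[OF s d], of i] \<psi> unfolding has_weak_X_def by blast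
    then show ?thesis unfolding set_integral_M X_cl_reg_ln(2)[OF s d] .
  qed
  then show ?thesis using LIMSEQ_unique[OF 1] 2 by simp
qed

text \<open>Here d tends to 0 with u fixed. On the left s / (s^2 + d^2) \<le> 1/s, so the limit
  itself dominates. On the right the integrand lives on a compact set outside which the adjoint
  applied to \<psi> vanishes; there u and ln u are bounded by continuity and positivity.\<close>

theorem weak_X_ln:
  assumes u: "u \<in> W1p0 b p \<Omega>" and cont: "continuous_on \<Omega> u" and pos: "\<And>x. x \<in> \<Omega> \<Longrightarrow> 0 < u x"
  shows "has_weak_X b \<Omega> i (\<lambda>x. ln (u x)) (\<lambda>x. grad_X b \<Omega> u x $ i / u x)"
proof -
  have W: "u \<in> W1p b p \<Omega>" using u unfolding W1p0_def by blast
  have hw: "has_weak_X b \<Omega> i u (\<lambda>x. grad_X b \<Omega> u x $ i)"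
    unfolding grad_X_def vec_lambda_beta by (rule W1p_has_weak_X[OF W])
  note mu [measurable] = W1p_measurable[OF W]
  have mX [measurable]: "(\<lambda>x. grad_X b \<Omega> u x $ i) \<in> borel_measurable M"
    using hw L1_loc_measurable by (auto simp: has_weak_X_def)
  have cln: "continuous_on \<Omega> (\<lambda>x. ln (u x))"
    using pos by (intro continuous_on_ln cont) (metis less_irrefl)
  have L: "L1_loc \<Omega> (\<lambda>x. grad_X b \<Omega> u x $ i / u x)"
    unfolding L1_loc_def
  proof (intro allI impI)
    fix K assume K: "compact K \<and> K \<subseteq> \<Omega>"
    have i: "integrable lebesgue (\<lambda>x. indicator K x * grad_X b \<Omega> u x $ i)"
      using hw K unfolding has_weak_X_def L1_loc_def set_integrable_def by simp
    have Ks: "K \<in> sets lebesgue" using K by (simp add: lmeasurable_compact fmeasurableD)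
    have "continuous_on K (\<lambda>x. inverse (u x))"
      using K pos by (intro continuous_on_inverse continuous_on_subset[OF cont]) (auto simp: subset_iff less_le)
    then have "bounded ((\<lambda>x. inverse (u x)) ` K)"
      using K compact_continuous_image compact_imp_bounded by blast
    then obtain B where B: "\<And>x. x \<in> K \<Longrightarrow> \<bar>inverse (u x)\<bar> \<le> B" by (auto simp: bounded_iff)
    \<comment> \<open>The measurability of u is known only on \<Omega>, so the reciprocal is taken
      after cutting off; outside \<Omega> it becomes \<open>inverse 0 = 0\<close>, invisible behind
      the indicator of K.\<close>
    have "(\<lambda>x. indicator \<Omega> x *\<^sub>R u x) \<in> borel_measurable lebesgue"
      using mu by (simp add: borel_measurable_restrict_space_iff)
    then have m: "(\<lambda>x. indicator K x * grad_X b \<Omega> u x $ i * inverse (indicator \<Omega> x *\<^sub>R u x)) \<in> borel_measurable lebesgue"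
      by (intro borel_measurable_times borel_measurable_inverse borel_measurable_integrable[OF i])
    have "integrable lebesgue (\<lambda>x. indicator K x * grad_X b \<Omega> u x $ i * inverse (indicator \<Omega> x *\<^sub>R u x))"
    proof (rule Bochner_Integration.integrable_bound[OF integrable_mult_left[of B, OF i] m])
      have "norm (indicator K x * grad_X b \<Omega> u x $ i * inverse (indicator \<Omega> x *\<^sub>R u x))
          \<le> norm (indicator K x * grad_X b \<Omega> u x $ i * B)" for x
      proof (cases "x \<in> K")
        case True
        then have "x \<in> \<Omega>" using K by blast
        have "\<bar>inverse (u x)\<bar> \<le> \<bar>B\<bar>" using B[OF True] by linarith
        then show ?thesis using True \<open>x \<in> \<Omega>\<close> by (simp add: abs_mult mult_left_mono)
      qed simp
      then show "AE x in lebesgue. norm (indicator K x * grad_X b \<Omega> u x $ i * inverse (indicator \<Omega> x *\<^sub>R u x))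
          \<le> norm (indicator K x * grad_X b \<Omega> u x $ i * B)" by simp
    qed
    moreover have "(\<lambda>x. indicator K x * grad_X b \<Omega> u x $ i * inverse (indicator \<Omega> x *\<^sub>R u x))
        = (\<lambda>x. indicator K x *\<^sub>R (grad_X b \<Omega> u x $ i / u x))"
      using K by (auto simp: fun_eq_iff indicator_def divide_inverse)
    ultimately show "set_integrable lebesgue K (\<lambda>x. grad_X b \<Omega> u x $ i / u x)"
      unfolding set_integrable_def by simp
  qed
  have "integral\<^sup>L M (\<lambda>x. grad_X b \<Omega> u x $ i / u x * \<psi> x) = integral\<^sup>L M (\<lambda>x. ln (u x) * adjoint_X b i \<psi> x)"
    if \<psi>: "test_fun \<Omega> \<psi>" for \<psi>
  proof -
    note \<alpha> = test_fun_adjoint[OF \<psi>, of i]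
    have [measurable]: "\<psi> \<in> borel_measurable M" "adjoint_X b i \<psi> \<in> borel_measurable M"
      by (rule test_fun_measurable_M[OF \<psi>] test_fun_measurable_M[OF \<alpha>])+
    define d where "d k = inverse (real (Suc k))" for k
    have d: "0 < d k" "d k \<le> 1" for k by (auto simp: d_def field_simps)
    have d0: "d \<longlonglongrightarrow> 0" unfolding d_def[abs_def] by (rule LIMSEQ_inverse_real_of_nat)
    have 1: "(\<lambda>k. integral\<^sup>L M (\<lambda>x. u x / (u x * u x + d k * d k) * grad_X b \<Omega> u x $ i * \<psi> x))
        \<longlonglongrightarrow> integral\<^sup>L M (\<lambda>x. grad_X b \<Omega> u x $ i / u x * \<psi> x)"
    proof (rule integral_dominated_convergence)
      show "integrable M (\<lambda>x. norm (grad_X b \<Omega> u x $ i / u x * \<psi> x))"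
        by (rule integrable_norm[OF L1_loc_mult_test_M[OF L \<psi>]])
      show "AE x in M. norm (u x / (u x * u x + d k * d k) * grad_X b \<Omega> u x $ i * \<psi> x)
          \<le> norm (grad_X b \<Omega> u x $ i / u x * \<psi> x)" for k
        using AE_M_in
      proof eventually_elim
        case (elim x)
        have u0: "0 < u x" using pos elim by blast
        have "u x / (u x * u x + d k * d k) \<le> u x / (u x * u x)"
          using u0 by (intro divide_left_mono mult_pos_pos add_pos_nonneg) auto
        moreover have "u x / (u x * u x) = inverse (u x)" using u0 by (simp add: divide_inverse)
        moreover have "0 \<le> u x / (u x * u x + d k * d k)" using u0 by simp
        ultimately have "\<bar>u x / (u x * u x + d k * d k)\<bar> \<le> inverse (u x)" by linarith
        then have "\<bar>u x / (u x * u x + d k * d k)\<bar> * (\<bar>grad_X b \<Omega> u x $ i\<bar> * \<bar>\<psi> x\<bar>)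
            \<le> inverse (u x) * (\<bar>grad_X b \<Omega> u x $ i\<bar> * \<bar>\<psi> x\<bar>)"
          by (intro mult_right_mono) auto
        moreover have "\<bar>inverse (u x)\<bar> = inverse (u x)" using u0 by simp
        ultimately show ?case by (simp only: real_norm_def abs_mult divide_inverse mult_ac)
      qed
      show "AE x in M. (\<lambda>k. u x / (u x * u x + d k * d k) * grad_X b \<Omega> u x $ i * \<psi> x)
          \<longlonglongrightarrow> grad_X b \<Omega> u x $ i / u x * \<psi> x"
        using AE_M_in
      proof eventually_elim
        case (elim x)
        have u0: "0 < u x" using pos elim by blast
        have "(\<lambda>k. u x / (u x * u x + d k * d k) * grad_X b \<Omega> u x $ i * \<psi> x)
          \<longlonglongrightarrow> u x / (u x * u x + 0 * 0) * grad_X b \<Omega> u x $ i * \<psi> x"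
          using u0 by (intro tendsto_intros d0) auto
        then show ?case using u0 by simp
      qed
    qed measurable
    obtain K where K: "compact K" "K \<subseteq> \<Omega>" "\<And>x. x \<notin> K \<Longrightarrow> adjoint_X b i \<psi> x = 0"
      using \<alpha> unfolding test_fun_def by blast
    obtain C where C: "\<And>x. \<bar>adjoint_X b i \<psi> x\<bar> \<le> C" "0 < C" using test_fun_bounded[OF \<alpha>] by blast
    have "bounded ((\<lambda>x. ln (u x)) ` K)" "bounded (u ` K)"
      using K(1) continuous_on_subset[OF cln K(2)] continuous_on_subset[OF cont K(2)]
      by (auto intro: compact_imp_bounded compact_continuous_image)
    then obtain A1 A2 where A: "\<And>x. x \<in> K \<Longrightarrow> \<bar>ln (u x)\<bar> \<le> A1" "\<And>x. x \<in> K \<Longrightarrow> \<bar>u x\<bar> \<le> A2"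
      by (auto simp: bounded_iff)
    have 2: "(\<lambda>k. integral\<^sup>L M (\<lambda>x. reg_ln (d k) (u x) * adjoint_X b i \<psi> x))
        \<longlonglongrightarrow> integral\<^sup>L M (\<lambda>x. ln (u x) * adjoint_X b i \<psi> x)"
    proof (rule integral_dominated_convergence)
      \<comment> \<open>From below the regularised logarithm is at least ln u; from above, ln t
        \<le> t together with d k \<le> 1 gives the bound u^2 + 1.\<close>
      let ?F = "\<lambda>x. (\<bar>A1\<bar> + (A2 * A2 + 1)) * C"
      show "integrable M ?F" by (rule finite_measure.integrable_const[OF finite_M])
      show "(\<lambda>x. ln (u x) * adjoint_X b i \<psi> x) \<in> borel_measurable M"
        "(\<lambda>x. reg_ln (d k) (u x) * adjoint_X b i \<psi> x) \<in> borel_measurable M" for k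
        unfolding reg_ln_def by measurable
      have "norm (reg_ln (d k) (u x) * adjoint_X b i \<psi> x) \<le> ?F x" for k x
      proof (cases "x \<in> K")
        case True
        then have u0: "0 < u x" using K(2) pos by blast
        have "ln (u x * u x) \<le> ln (u x * u x + d k * d k)" using u0 by (intro ln_mono) (auto simp: add_pos_nonneg)
        then have lo: "ln (u x) \<le> reg_ln (d k) (u x)" using u0 by (simp add: reg_ln_def ln_mult)
        have "ln (u x * u x + d k * d k) \<le> u x * u x + d k * d k"
          using ln_bound[of "u x * u x + d k * d k"] sq_plus_sq_pos[OF d(1)] by simp
        moreover have "u x * u x \<le> A2 * A2" using u0 A(2)[OF True] by (intro mult_mono) auto
        moreover have "d k * d k \<le> 1" using d[of k] by (intro mult_le_one) auto
        moreover have "0 \<le> A2 * A2" by simp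
        ultimately have "reg_ln (d k) (u x) \<le> A2 * A2 + 1" unfolding reg_ln_def by linarith
        with lo A(1)[OF True] \<open>0 \<le> A2 * A2\<close> have "\<bar>reg_ln (d k) (u x)\<bar> \<le> \<bar>A1\<bar> + (A2 * A2 + 1)" by linarith
        then show ?thesis
          unfolding real_norm_def abs_mult using C by (intro mult_mono) auto
      next
        case False
        then show ?thesis using K(3) C by simp
      qed
      then show "AE x in M. norm (reg_ln (d k) (u x) * adjoint_X b i \<psi> x) \<le> ?F x" for k by simp
      show "AE x in M. (\<lambda>k. reg_ln (d k) (u x) * adjoint_X b i \<psi> x) \<longlonglongrightarrow> ln (u x) * adjoint_X b i \<psi> x"
        using AE_M_in
      proof eventually_elim
        case (elim x)
        have u0: "0 < u x" using pos elim by blast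
        have "(\<lambda>k. reg_ln (d k) (u x) * adjoint_X b i \<psi> x)
            \<longlonglongrightarrow> ln (u x * u x + 0 * 0) / 2 * adjoint_X b i \<psi> x"
          unfolding reg_ln_def using u0 by (intro tendsto_intros d0) auto
        then show ?case using u0 by (simp add: ln_mult)
      qed
    qed
    show ?thesis
      using LIMSEQ_unique[OF 1] 2 unfolding weak_X_reg_ln[OF u \<psi> d(1)] by blast
  qed
  with L continuous_on_L1_loc[OF cln] show ?thesis
    unfolding has_weak_X_def set_integral_M by blast
qed

end

section \<open>Functions annihilated by the vector fields\<close>

lemma partial_uminus:
  fixes f :: "real ^ 'n::finite \<Rightarrow> real"
  assumes "f differentiable (at x)"
  shows "partial k (\<lambda>y. - f y) x = - partial k f x"
  using partial_mult[OF differentiable_const[of "-1"] assms, of k] by simp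

lemma partial_diff:
  fixes f :: "real ^ 'n::finite \<Rightarrow> real"
  assumes "f differentiable (at x)" "g differentiable (at x)"
  shows "partial k (\<lambda>y. f y - g y) x = partial k f x - partial k g x"
  using partial_add[OF assms(1) differentiable_minus[OF assms(2)], of k]
  by (simp add: partial_uminus[OF assms(2)])

lemma partial_sum:
  fixes f :: "'a \<Rightarrow> real ^ 'n::finite \<Rightarrow> real"
  assumes "finite I" "\<And>i. i \<in> I \<Longrightarrow> f i differentiable (at x)"
  shows "partial k (\<lambda>y. \<Sum>i\<in>I. f i y) x = (\<Sum>i\<in>I. partial k (f i) x)"
  using assms
proof (induction I)
  case (insert i I)
  then have "partial k (\<lambda>y. f i y + (\<Sum>i\<in>I. f i y)) x = partial k (f i) x + partial k (\<lambda>y. \<Sum>i\<in>I. f i y) x"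
    by (intro partial_add differentiable_sum) auto
  with insert show ?case by simp
qed simp

text \<open>The divergence of \<phi> Y, which for Y = \<open>b i\<close> is the negative of
  \<open>adjoint_X b i\<close>. It is defined for an arbitrary field so that commutators can be
  tested as well.\<close>

definition divf :: "(real ^ 'n \<Rightarrow> real ^ 'n) \<Rightarrow> (real ^ 'n \<Rightarrow> real) \<Rightarrow> real ^ 'n::finite \<Rightarrow> real" where
  "divf Y \<phi> x = (\<Sum>k\<in>UNIV. partial k (\<lambda>y. Y y $ k * \<phi> y) x)"

definition smooth_field :: "(real ^ 'n) set \<Rightarrow> (real ^ 'n \<Rightarrow> real ^ 'n) \<Rightarrow> bool" where
  "smooth_field S Y \<longleftrightarrow> (\<forall>k. smooth_on S (\<lambda>x. Y x $ k))"

lemma test_fun_field: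
  fixes Y :: "real ^ 'n::finite \<Rightarrow> real ^ 'n"
  shows "open S \<Longrightarrow> smooth_field S Y \<Longrightarrow> test_fun S \<psi> \<Longrightarrow> test_fun S (\<lambda>y. Y y $ k * \<psi> y)"
  unfolding smooth_field_def using test_fun_mult_smooth by blast

lemma test_fun_divf:
  fixes Y :: "real ^ 'n::finite \<Rightarrow> real ^ 'n"
  shows "open S \<Longrightarrow> smooth_field S Y \<Longrightarrow> test_fun S \<psi> \<Longrightarrow> test_fun S (divf Y \<psi>)"
  unfolding divf_def[abs_def] by (intro test_fun_sum test_fun_partial test_fun_field)

lemma smooth_field_lie_bracket:
  fixes Y Z :: "real ^ 'n::finite \<Rightarrow> real ^ 'n"
  assumes "open S" "smooth_field S Y" "smooth_field S Z"
  shows "smooth_field S (lie_bracket Y Z)"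
  using assms unfolding smooth_field_def lie_bracket_def
  by (auto intro!: smooth_on_diff smooth_on_sum smooth_on_mult smooth_on_partial)

text \<open>
  The second-order terms are \<open>\<Sum>\<^sub>k\<^sub>l \<partial>\<^sub>k \<partial>\<^sub>l P\<^sub>k\<^sub>l\<close> with \<open>P\<^sub>k\<^sub>l = (Y\<^sub>k Z\<^sub>l - Z\<^sub>k Y\<^sub>l) \<psi>\<close>, which vanishes because \<open>P\<close>
  is antisymmetric.
\<close>

lemma divf_lie_bracket:
  fixes Y Z :: "real ^ 'n::finite \<Rightarrow> real ^ 'n"
  assumes S: "open S" "smooth_field S Y" "smooth_field S Z" and \<psi>: "test_fun S \<psi>" and x: "x \<in> S"
  shows "divf (lie_bracket Y Z) \<psi> x = divf Y (divf Z \<psi>) x - divf Z (divf Y \<psi>) x"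
proof -
  define P where "P k l y = Y y $ k * (Z y $ l * \<psi> y) - Z y $ k * (Y y $ l * \<psi> y)" for k l y
  note fY = test_fun_field[OF S(1,2)] and fZ = test_fun_field[OF S(1,3)]
  have P: "test_fun S (P k l)" for k l
  proof -
    have "test_fun S (\<lambda>y. Y y $ k * (Z y $ l * \<psi> y) + (-1) * (Z y $ k * (Y y $ l * \<psi> y)))"
      by (rule test_fun_add[OF fY[OF fZ[OF \<psi>]] test_fun_cmult[OF fZ[OF fY[OF \<psi>]]]])
    then show ?thesis by (simp add: P_def[abs_def])
  qed
  have dY: "(\<lambda>y. Y y $ k) differentiable (at y)" and dZ: "(\<lambda>y. Z y $ k) differentiable (at y)" if "y \<in> S" for k y
    using S(2,3) that smooth_on_differentiable unfolding smooth_field_def by blast+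
  have dt: "\<phi> differentiable (at y)" if "test_fun S \<phi>" for \<phi> y
    using smooth_on_differentiable[OF test_fun_smooth[OF that]] by simp
  \<comment> \<open>Only first derivatives occur here. Applying \<open>partial k\<close> and summing
    over k gives the claim, with the double sum over P as remainder.\<close>
  have eq: "(\<Sum>l\<in>UNIV. partial l (P k l) y) + lie_bracket Y Z y $ k * \<psi> y
      = Y y $ k * divf Z \<psi> y - Z y $ k * divf Y \<psi> y" if y: "y \<in> S" for k y
  proof -
    have "partial l (P k l) y = (Y y $ k * partial l (\<lambda>y. Z y $ l * \<psi> y) y + partial l (\<lambda>y. Y y $ k) y * (Z y $ l * \<psi> y))
        - (Z y $ k * partial l (\<lambda>y. Y y $ l * \<psi> y) y + partial l (\<lambda>y. Z y $ k) y * (Y y $ l * \<psi> y))" for l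
      unfolding P_def[abs_def]
      by (subst partial_diff[OF dt[OF fY[OF fZ[OF \<psi>]]] dt[OF fZ[OF fY[OF \<psi>]]]])
        (simp only: partial_mult[OF dY[OF y] dt[OF fZ[OF \<psi>]]] partial_mult[OF dZ[OF y] dt[OF fY[OF \<psi>]]])
    then show ?thesis
      unfolding divf_def lie_bracket_def vec_lambda_beta sum_distrib_left left_diff_distrib sum_distrib_right
        sum_subtractf[symmetric] sum.distrib[symmetric]
      by (intro sum.cong refl) (simp add: algebra_simps)
  qed
  have "partial k (\<lambda>y. Y y $ k * divf Z \<psi> y) x - partial k (\<lambda>y. Z y $ k * divf Y \<psi> y) x
      = (\<Sum>l\<in>UNIV. partial k (partial l (P k l)) x) + partial k (\<lambda>y. lie_bracket Y Z y $ k * \<psi> y) x" for k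
  proof -
    note t1 = fY[OF test_fun_divf[OF S(1,3) \<psi>], of k] and t2 = fZ[OF test_fun_divf[OF S(1,2) \<psi>], of k]
      and t3 = test_fun_field[OF S(1) smooth_field_lie_bracket[OF S] \<psi>, of k]
    have "partial k (\<lambda>y. Y y $ k * divf Z \<psi> y - Z y $ k * divf Y \<psi> y) x
        = partial k (\<lambda>y. (\<Sum>l\<in>UNIV. partial l (P k l) y) + lie_bracket Y Z y $ k * \<psi> y) x"
      by (rule partial_cong(1)[OF S(1) x]) (use eq dt t1 t2 in auto)
    moreover have "partial k (\<lambda>y. (\<Sum>l\<in>UNIV. partial l (P k l) y) + lie_bracket Y Z y $ k * \<psi> y) x
        = partial k (\<lambda>y. \<Sum>l\<in>UNIV. partial l (P k l) y) x + partial k (\<lambda>y. lie_bracket Y Z y $ k * \<psi> y) x"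
      by (rule partial_add[OF dt[OF test_fun_sum[OF test_fun_partial[OF P]]] dt[OF t3]])
    moreover have "partial k (\<lambda>y. \<Sum>l\<in>UNIV. partial l (P k l) y) x = (\<Sum>l\<in>UNIV. partial k (partial l (P k l)) x)"
      by (rule partial_sum[OF finite dt[OF test_fun_partial[OF P]]])
    ultimately show ?thesis using partial_diff[OF dt[OF t1] dt[OF t2], of k] by simp
  qed
  then have "divf Y (divf Z \<psi>) x - divf Z (divf Y \<psi>) x
      = (\<Sum>k\<in>UNIV. \<Sum>l\<in>UNIV. partial k (partial l (P k l)) x) + divf (lie_bracket Y Z) \<psi> x"
    by (simp add: divf_def sum_subtractf[symmetric] sum.distrib)
  moreover have "(\<Sum>k\<in>UNIV. \<Sum>l\<in>UNIV. partial k (partial l (P k l)) x) = 0"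
  proof -
    let ?T = "\<Sum>k\<in>UNIV. \<Sum>l\<in>UNIV. partial k (partial l (P k l)) x"
    have anti: "partial k (partial l (P k l)) x = - partial l (partial k (P l k)) x" for k l
    proof -
      have P_lk: "P l k = (\<lambda>y. - P k l y)" by (simp add: P_def fun_eq_iff algebra_simps)
      have p_lk: "partial k (P l k) = (\<lambda>y. - partial k (P k l) y)"
        by (rule ext) (unfold P_lk, rule partial_uminus[OF dt[OF P]])
      have "partial l (partial k (P l k)) x = - partial l (partial k (P k l)) x"
        unfolding p_lk by (rule partial_uminus[OF dt[OF test_fun_partial[OF P]]])
      with partial_commute[OF test_fun_smooth[OF P]] show ?thesis by simp
    qed
    have "?T = (\<Sum>k\<in>UNIV. \<Sum>l\<in>UNIV. - partial l (partial k (P l k)) x)"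
      by (intro sum.cong refl anti)
    also have "\<dots> = - (\<Sum>l\<in>UNIV. \<Sum>k\<in>UNIV. partial l (partial k (P l k)) x)"
      by (subst sum.swap) (simp add: sum_negf)
    finally show ?thesis by simp
  qed
  ultimately show ?thesis by simp
qed

text \<open>
  The integral of \<open>h\<close> against a bump does not change when the bump is translated.
\<close>

lemma locally_constant_of_weak_gradient:
  fixes h :: "real ^ 'n::finite \<Rightarrow> real"
  assumes V: "open V" "x0 \<in> V" and h: "continuous_on V h"
    and z: "\<And>k \<psi>. test_fun V \<psi> \<Longrightarrow> integral\<^sup>L lebesgue (\<lambda>x. h x * partial k \<psi> x) = 0"
  obtains r where "0 < r" "\<And>y. y \<in> ball x0 r \<Longrightarrow> h y = h x0"
proof -
  obtain a c where Q: "x0 \<in> box a c" "cbox a c \<subseteq> V"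
    using open_contains_cbox[OF V] by metis
  obtain R where R: "0 < R" "ball x0 R \<subseteq> box a c"
    using Q(1) open_box open_contains_ball by metis
  have Qint: "integral (cbox a c) (\<lambda>x. g x * F x) = integral\<^sup>L lebesgue (\<lambda>x. g x * F x)"
    if g: "continuous_on (cbox a c) g" and F: "test_fun (box a c) F" for g F
  proof -
    have "integrable lborel (\<lambda>x. indicator (cbox a c) x *\<^sub>R (g x * F x))"
      by (intro borel_integrable_compact continuous_on_mult g test_fun_continuous[OF F]) auto
    then have i: "set_integrable lborel (cbox a c) (\<lambda>x. g x * F x)" by (simp add: set_integrable_def)
    have "(\<lambda>x. g x * F x) = (\<lambda>x. indicator (cbox a c) x *\<^sub>R (g x * F x))"
      using test_fun_outside[OF F] box_subset_cbox[of a c] by (auto simp: fun_eq_iff indicator_def)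
    then have "integral\<^sup>L lebesgue (\<lambda>x. g x * F x) = integral\<^sup>L lebesgue (\<lambda>x. indicator (cbox a c) x *\<^sub>R (g x * F x))"
      by simp
    also have "\<dots> = (LINT x:cbox a c|lborel. g x * F x)"
      unfolding set_lebesgue_integral_def
      using i by (intro integral_completion) (auto simp: set_integrable_def)
    also have "\<dots> = integral (cbox a c) (\<lambda>x. g x * F x)"
      by (rule set_borel_integral_eq_integral(2)[OF i])
    finally show ?thesis by simp
  qed
  have const: "h y = h x0" if y: "y \<in> ball x0 (R / 2)" for y
  proof (rule ccontr)
    assume ne: "h y \<noteq> h x0"
    \<comment> \<open>The midpoint m and the sign s make g negative at x0 and positive at y. Being
      affine in h, g inherits the hypothesis, because derivatives of test functions have integral
      0.\<close>
    define m where "m = (h x0 + h y) / 2"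
    define s :: real where "s = (if h x0 < h y then 1 else -1)"
    define g where "g x = s * (h x - m)" for x
    have gx0: "g x0 < 0" and gy: "0 < g y"
      using ne by (auto simp: g_def s_def m_def field_simps)
    have cg: "continuous_on V g" unfolding g_def by (intro continuous_intros h)
    have cgQ: "continuous_on (cbox a c) g" using cg Q(2) continuous_on_subset by blast
    have yV: "y \<in> V" using y R Q(2) box_subset_cbox[of a c] by (auto simp: subset_iff)
    have "\<exists>d>0. \<forall>x\<in>ball x0 d. g x < 0"
    proof -
      have "\<forall>\<^sub>F x in at x0. g x < 0"
        using cg V gx0 by (auto simp: continuous_on_eq_continuous_at isCont_def intro: order_tendstoD(2))
      then obtain d where "0 < d" "\<forall>x. x \<noteq> x0 \<and> dist x x0 < d \<longrightarrow> g x < 0"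
        by (auto simp: eventually_at)
      with gx0 show ?thesis by (metis dist_commute mem_ball)
    qed
    then obtain d1 where d1: "0 < d1" "\<And>x. x \<in> ball x0 d1 \<Longrightarrow> g x < 0" by blast
    have "\<exists>d>0. \<forall>x\<in>ball y d. 0 < g x"
    proof -
      have "\<forall>\<^sub>F x in at y. 0 < g x"
        using cg V(1) yV gy by (auto simp: continuous_on_eq_continuous_at isCont_def intro: order_tendstoD(1))
      then obtain d where "0 < d" "\<forall>x. x \<noteq> y \<and> dist x y < d \<longrightarrow> 0 < g x"
        by (auto simp: eventually_at)
      with gy show ?thesis by (metis dist_commute mem_ball)
    qed
    then obtain d2 where d2: "0 < d2" "\<And>x. x \<in> ball y d2 \<Longrightarrow> 0 < g x" by blast
    \<comment> \<open>Small enough for g to keep its sign on both end balls. The bound R/4 keeps the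
      moving ball inside \<open>ball x0 R\<close>, since its centre moves by less than R/2.\<close>
    define \<rho> where "\<rho> = min (min d1 d2) (R / 4)"
    have \<rho>: "0 < \<rho>" "\<rho> \<le> d1" "\<rho> \<le> d2" "\<rho> \<le> R / 4" using d1(1) d2(1) R(1) by (auto simp: \<rho>_def)
    define v where "v = y - x0"
    have nv: "norm v < R / 2" using y by (simp add: v_def dist_norm norm_minus_commute)
    have tb: "test_fun (box a c) (bump (x0 + t *\<^sub>R v) \<rho>)" if "0 \<le> t" "t \<le> 1" for t
    proof (rule test_fun_bump[OF \<rho>(1)])
      have "z \<in> ball x0 R" if "z \<in> cball (x0 + t *\<^sub>R v) \<rho>" for z
      proof -
        have "norm (t *\<^sub>R v) \<le> norm v" using \<open>0 \<le> t\<close> \<open>t \<le> 1\<close> by (simp add: mult_left_le_one_le)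
        moreover have "norm (x0 + t *\<^sub>R v - z) \<le> \<rho>" using that by (simp add: dist_norm)
        moreover have "norm (x0 - z) \<le> norm (x0 + t *\<^sub>R v - z) + norm (t *\<^sub>R v)"
          using norm_triangle_ineq4[of "x0 + t *\<^sub>R v - z" "t *\<^sub>R v"] by (simp add: algebra_simps)
        ultimately have "norm (x0 - z) < R" using nv \<rho>(4) R(1) by linarith
        then show ?thesis by (simp add: dist_norm)
      qed
      then show "cball (x0 + t *\<^sub>R v) \<rho> \<subseteq> box a c" using R(2) by blast
    qed
    define G where "G t = integral (cbox a c) (\<lambda>x. g x * bump (x0 + t *\<^sub>R v) \<rho> x)" for t
    have zg: "integral\<^sup>L lebesgue (\<lambda>x. g x * partial k F x) = 0" if F: "test_fun (box a c) F" for F k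
    proof -
      have FV: "test_fun V F" by (rule test_fun_mono[OF F]) (use Q(2) box_subset_cbox[of a c] in blast)
      have 1: "integral\<^sup>L lebesgue (partial k F) = 0"
        using integral_partial_eq_0[OF test_fun_mono[OF FV subset_UNIV], of k]
        by (simp add: set_lebesgue_integral_def)
      have i: "integrable lebesgue (partial k F)" by (rule test_fun_integrable(2)[OF test_fun_partial[OF FV]])
      have "set_integrable lebesgue V (\<lambda>x. h x * partial k F x)"
        by (rule L1_loc_mult_test[OF continuous_on_L1_loc[OF h] test_fun_partial[OF FV]])
      moreover have "(\<lambda>x. indicator V x *\<^sub>R (h x * partial k F x)) = (\<lambda>x. h x * partial k F x)"
        using test_fun_outside[OF test_fun_partial[OF FV]] by (auto simp: fun_eq_iff indicator_def)
      ultimately have ih: "integrable lebesgue (\<lambda>x. h x * partial k F x)" by (simp add: set_integrable_def)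
      have "(\<lambda>x. g x * partial k F x) = (\<lambda>x. s * (h x * partial k F x) - (s * m) * partial k F x)"
        by (simp add: g_def fun_eq_iff algebra_simps)
      then show ?thesis using z[OF FV, of k] 1 i ih by simp
    qed
    have DG: "(G has_real_derivative 0) (at t)" if "0 \<le> t" "t \<le> 1" for t
    proof -
      let ?F = "bump (x0 + t *\<^sub>R v) \<rho>"
      \<comment> \<open>Moving the centre of the bump by \<tau> v amounts to evaluating the fixed
        bump \<open>?F\<close> at x - \<tau> v, so the derivative at 0 is an integral of g against
        derivatives of a test function.\<close>
      have "((\<lambda>\<tau>. integral (cbox a c) (\<lambda>x. g x * ?F (x + \<tau> *\<^sub>R (- v)))) has_real_derivative
          integral (cbox a c) (\<lambda>x. g x * (\<Sum>k\<in>UNIV. (- v) $ k * partial k ?F (x + 0 *\<^sub>R (- v))))) (at 0)"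
        by (rule DERIV_integral_translate[OF test_fun_smooth[OF tb[OF that]] cgQ])
      moreover have "(\<lambda>x. g x * ?F (x + \<tau> *\<^sub>R (- v))) = (\<lambda>x. g x * bump (x0 + (\<tau> + t) *\<^sub>R v) \<rho> x)" for \<tau>
        by (simp add: bump_def algebra_simps)
      moreover have "integral (cbox a c) (\<lambda>x. g x * (\<Sum>k\<in>UNIV. (- v) $ k * partial k ?F (x + 0 *\<^sub>R (- v)))) = 0"
      proof -
        have tp: "test_fun (box a c) (\<lambda>x. (- v) $ k * partial k ?F x)" for k
          by (intro test_fun_cmult test_fun_partial tb that)
        have "integral (cbox a c) (\<lambda>x. g x * (\<Sum>k\<in>UNIV. (- v) $ k * partial k ?F x))
            = integral (cbox a c) (\<lambda>x. \<Sum>k\<in>UNIV. g x * ((- v) $ k * partial k ?F x))"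
          by (simp add: sum_distrib_left)
        also have "\<dots> = (\<Sum>k\<in>UNIV. integral (cbox a c) (\<lambda>x. g x * ((- v) $ k * partial k ?F x)))"
          by (intro integral_sum integrable_continuous continuous_on_mult cgQ test_fun_continuous[OF tp]) auto
        also have "\<dots> = 0"
        proof (rule sum.neutral, rule ballI)
          fix k
          have "integral (cbox a c) (\<lambda>x. g x * ((- v) $ k * partial k ?F x))
              = integral\<^sup>L lebesgue (\<lambda>x. (- v) $ k * (g x * partial k ?F x))"
            by (subst Qint[OF cgQ tp]) (simp add: mult_ac)
          then show "integral (cbox a c) (\<lambda>x. g x * ((- v) $ k * partial k ?F x)) = 0"
            using zg[OF tb[OF that], of k] by simp
        qed
        finally show ?thesis by simp
      qed
      ultimately have "((\<lambda>\<tau>. G (\<tau> + t)) has_real_derivative 0) (at 0)"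
        unfolding G_def by simp
      then show ?thesis using DERIV_shift[of G 0 0 t] by (simp add: add.commute)
    qed
    \<comment> \<open>A strict sign at one end, G 0 < 0, is enough to contradict 0 \<le> G
      1.\<close>
    have "G 1 = G 0"
      using DG by (intro DERIV_isconst_end)
        (auto intro!: continuous_at_imp_continuous_on DERIV_isCont)
    moreover have "G 0 < 0"
    proof -
      let ?f = "\<lambda>x. - (g x * bump x0 \<rho> x)"
      have cf: "continuous_on (cbox a c) ?f"
        using tb[of 0] by (intro continuous_on_minus continuous_on_mult cgQ) (simp add: test_fun_continuous)
      have nn: "0 \<le> ?f x" for x
      proof (cases "x \<in> ball x0 \<rho>")
        case True
        then have "g x < 0" using d1(2) \<rho>(2) by auto
        then show ?thesis using bump_nonneg[of x0 \<rho> x] by (simp add: mult_nonpos_nonneg)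
      next
        case False
        then have "bump x0 \<rho> x = 0" using bump_pos[OF \<rho>(1), of x0 x] bump_nonneg[of x0 \<rho> x] by linarith
        then show ?thesis by simp
      qed
      have "0 < ?f x0" using gx0 bump_pos[OF \<rho>(1), of x0 x0] \<rho>(1) by (simp add: mult_neg_pos)
      moreover have "x0 \<in> cbox a c" using Q(1) box_subset_cbox by blast
      ultimately have "integral (cbox a c) ?f \<noteq> 0"
        using integral_cbox_eq_0_iff[OF cf _ nn] Q(1) by force
      moreover have "0 \<le> integral (cbox a c) ?f"
        using nn cf by (intro integral_nonneg integrable_continuous) auto
      ultimately show ?thesis by (simp add: G_def)
    qed
    moreover have "0 \<le> G 1"
    proof -
      let ?f = "\<lambda>x. g x * bump y \<rho> x"
      have cf: "continuous_on (cbox a c) ?f"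
        using tb[of 1] by (intro continuous_on_mult cgQ) (simp add: test_fun_continuous v_def)
      have nn: "0 \<le> ?f x" for x
      proof (cases "x \<in> ball y \<rho>")
        case True
        then have "0 < g x" using d2(2) \<rho>(3) by auto
        then show ?thesis using bump_nonneg[of y \<rho> x] by simp
      next
        case False
        then have "bump y \<rho> x = 0" using bump_pos[OF \<rho>(1), of y x] bump_nonneg[of y \<rho> x] by linarith
        then show ?thesis by simp
      qed
      have "0 \<le> integral (cbox a c) ?f"
        using nn cf by (intro integral_nonneg integrable_continuous) auto
      then show ?thesis by (simp add: G_def v_def)
    qed
    ultimately show False by simp
  qed
  show thesis by (rule that[OF half_gt_zero[OF R(1)] const])
qed

lemma smooth_on_det:
  fixes C :: "real ^ 'n::finite \<Rightarrow> real ^ 'm::finite ^ 'm"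
  assumes "open S" "\<And>i j. smooth_on S (\<lambda>x. C x $ i $ j)"
  shows "smooth_on S (\<lambda>x. det (C x))"
  unfolding det_def
  by (intro smooth_on_sum smooth_on_mult smooth_on_prod smooth_on_const assms)

text \<open>
  By Cramer's rule \<open>\<partial>\<^sub>k = \<Sum>\<^sub>a c\<^sub>a A\<^sub>a\<close> near \<open>x0\<close> with smooth \<open>c\<^sub>a\<close>, and the factor \<open>c\<^sub>a\<close> is moved to the
  test function.
\<close>

lemma weak_gradient_zero_of_frame:
  fixes A :: "'n::finite \<Rightarrow> real ^ 'n \<Rightarrow> real ^ 'n"
  assumes \<Omega>: "open \<Omega>" "x0 \<in> \<Omega>" and h: "continuous_on \<Omega> h"
    and A: "\<And>a. smooth_field \<Omega> (A a)"
    and z: "\<And>a \<psi>. test_fun \<Omega> \<psi> \<Longrightarrow> (LINT x:\<Omega>|lebesgue. h x * divf (A a) \<psi> x) = 0"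
    and span: "span (range (\<lambda>a. A a x0)) = UNIV"
  obtains V where "open V" "x0 \<in> V" "V \<subseteq> \<Omega>"
    "\<And>k \<psi>. test_fun V \<psi> \<Longrightarrow> integral\<^sup>L lebesgue (\<lambda>x. h x * partial k \<psi> x) = 0"
proof -
  define B where "B x = (\<chi> r a. A a x $ r)" for x
  have Bs: "smooth_on \<Omega> (\<lambda>x. B x $ i $ j)" for i j
    using A[of j] by (simp add: B_def smooth_field_def)
  have dB: "smooth_on \<Omega> (\<lambda>x. det (B x))" by (rule smooth_on_det[OF \<Omega>(1) Bs])
  have "columns (B x0) = range (\<lambda>a. A a x0)"
    by (auto simp: columns_def column_def B_def vec_lambda_eta)
  then have "\<exists>C. B x0 ** C = mat 1"
    using span by (simp add: matrix_right_invertible_span_columns span_vec_eq)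
  then have det0: "det (B x0) \<noteq> 0"
    using invertible_det_nz invertible_right_inverse by blast
  define V where "V = \<Omega> \<inter> (\<lambda>x. det (B x)) -` (- {0})"
  have V: "open V" "x0 \<in> V" "V \<subseteq> \<Omega>"
    using continuous_open_preimage[OF smooth_on_imp_continuous_on[OF dB] \<Omega>(1), of "- {0}"] \<Omega>(2) det0
    by (auto simp: V_def)
  define c where "c k a x = det (\<chi> i j. if j = a then axis k 1 $ i else B x $ i $ j) * inverse (det (B x))" for k a x
  have cs: "smooth_on V (c k a)" for k a
    unfolding c_def
  proof (rule smooth_on_mult[OF V(1)])
    show "smooth_on V (\<lambda>x. det (\<chi> i j. if j = a then axis k 1 $ i else B x $ i $ j))"
    proof (rule smooth_on_det[OF V(1)])
      show "smooth_on V (\<lambda>x. (\<chi> i j. if j = a then axis k 1 $ i else B x $ i $ j) $ i $ j)" for i j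
        by (cases "j = a") (simp_all add: smooth_on_const smooth_on_subset[OF Bs V(3)])
    qed
    show "smooth_on V (\<lambda>x. inverse (det (B x)))"
      by (rule smooth_on_comp[OF V(1) smooth_real_inverse _ smooth_on_subset[OF dB V(3)]]) (auto simp: V_def)
  qed
  have frame: "(\<Sum>a\<in>UNIV. A a x $ r * c k a x) = axis k 1 $ r" if "x \<in> V" for x r k
  proof -
    have "det (B x) \<noteq> 0" using that by (simp add: V_def)
    then have "B x *v (\<chi> a. c k a x) = axis k 1"
      by (subst cramer) (simp_all add: c_def divide_inverse)
    then have "(B x *v (\<chi> a. c k a x)) $ r = axis k 1 $ r" by simp
    then show ?thesis by (simp add: matrix_vector_mult_def B_def)
  qed
  have zero: "integral\<^sup>L lebesgue (\<lambda>x. h x * partial k \<psi> x) = 0" if \<psi>: "test_fun V \<psi>" for k \<psi>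
  proof -
    have AV: "smooth_field V (A a)" for a
      using A[of a] V(3) smooth_on_subset unfolding smooth_field_def by blast
    have tc: "test_fun V (\<lambda>y. c k a y * \<psi> y)" for a
      by (rule test_fun_mult_smooth[OF V(1) cs \<psi>]) simp
    note tc\<Omega> = test_fun_mono[OF tc V(3)]
    have tf: "test_fun V (\<lambda>y. A a y $ r * (c k a y * \<psi> y))" for a r
      by (rule test_fun_field[OF V(1) AV tc])
    have dt: "\<phi> differentiable (at y)" if "test_fun S \<phi>" for \<phi> y and S :: "(real ^ 'n) set"
      using smooth_on_differentiable[OF test_fun_smooth[OF that]] by simp
    \<comment> \<open>Adding up over the frame before differentiating turns the r-th component into
      the constant \<open>axis k 1 $ r\<close> times \<psi>, so no derivative of a coefficient c
      survives.\<close>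
    have pw: "(\<Sum>a\<in>UNIV. divf (A a) (\<lambda>y. c k a y * \<psi> y) x) = partial k \<psi> x" for x
    proof (cases "x \<in> V")
      case True
      have "(\<Sum>a\<in>UNIV. divf (A a) (\<lambda>y. c k a y * \<psi> y) x)
          = (\<Sum>r\<in>UNIV. \<Sum>a\<in>UNIV. partial r (\<lambda>y. A a y $ r * (c k a y * \<psi> y)) x)"
        unfolding divf_def by (rule sum.swap)
      also have "\<dots> = (\<Sum>r\<in>UNIV. partial r (\<lambda>y. \<Sum>a\<in>UNIV. A a y $ r * (c k a y * \<psi> y)) x)"
        by (intro sum.cong refl partial_sum[symmetric] finite dt[OF tf])
      also have "\<dots> = (\<Sum>r\<in>UNIV. partial r (\<lambda>y. axis k 1 $ r * \<psi> y) x)"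
      proof (intro sum.cong refl partial_cong(1)[OF V(1) True])
        show "(\<Sum>a\<in>UNIV. A a y $ r * (c k a y * \<psi> y)) = axis k 1 $ r * \<psi> y" if "y \<in> V" for r y
          by (simp add: frame[OF that, symmetric] sum_distrib_right mult.assoc)
        show "(\<lambda>y. \<Sum>a\<in>UNIV. A a y $ r * (c k a y * \<psi> y)) differentiable at x" for r
          by (rule dt[OF test_fun_sum[OF tf]])
      qed
      also have "\<dots> = (\<Sum>r\<in>UNIV. axis k 1 $ r * partial r \<psi> x)"
        by (intro sum.cong refl) (subst partial_mult[OF differentiable_const dt[OF \<psi>]], simp)
      also have "\<dots> = partial k \<psi> x"
        by (subst sum.remove[of _ k]) (auto simp: axis_def intro!: sum.neutral)
      finally show ?thesis .
    next
      case False
      then show ?thesis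
        using test_fun_outside[OF test_fun_divf[OF V(1) AV tc]] test_fun_outside[OF test_fun_partial[OF \<psi>]]
        by simp
    qed
    have i: "integrable lebesgue (\<lambda>x. indicator \<Omega> x *\<^sub>R (h x * divf (A a) (\<lambda>y. c k a y * \<psi> y) x))" for a
      using L1_loc_mult_test[OF continuous_on_L1_loc[OF h] test_fun_divf[OF \<Omega>(1) A tc\<Omega>]]
      by (simp add: set_integrable_def)
    have "(\<lambda>x. h x * partial k \<psi> x) = (\<lambda>x. \<Sum>a\<in>UNIV. indicator \<Omega> x *\<^sub>R (h x * divf (A a) (\<lambda>y. c k a y * \<psi> y) x))"
    proof
      fix x
      have "h x * partial k \<psi> x = indicator \<Omega> x *\<^sub>R (h x * partial k \<psi> x)"
        using test_fun_outside[OF test_fun_mono[OF test_fun_partial[OF \<psi>] V(3)], of x] by (cases "x \<in> \<Omega>") auto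
      then show "h x * partial k \<psi> x = (\<Sum>a\<in>UNIV. indicator \<Omega> x *\<^sub>R (h x * divf (A a) (\<lambda>y. c k a y * \<psi> y) x))"
        by (simp only: pw[symmetric] sum_distrib_left scaleR_sum_right)
    qed
    then have "integral\<^sup>L lebesgue (\<lambda>x. h x * partial k \<psi> x)
        = (\<Sum>a\<in>UNIV. integral\<^sup>L lebesgue (\<lambda>x. indicator \<Omega> x *\<^sub>R (h x * divf (A a) (\<lambda>y. c k a y * \<psi> y) x)))"
      using i by (simp only: Bochner_Integration.integral_sum)
    also have "\<dots> = 0"
      using z[OF tc\<Omega>] by (simp only: set_lebesgue_integral_def sum.neutral_const)
    finally show ?thesis .
  qed
  show thesis by (rule that[OF V zero])
qed

text \<open>Applying \<open>divf\<close> along a smooth field to a test function gives a test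
  function again, so the hypothesis for one field may be used on the output of the other;
  \<open>divf_lie_bracket\<close> combines the two. The function h is never differentiated.\<close>

lemma iter_comm_annihilates:
  fixes b :: "'m::finite \<Rightarrow> real ^ 'n::finite \<Rightarrow> real ^ 'n"
  assumes \<Omega>: "open \<Omega>" and h: "continuous_on \<Omega> h"
    and b: "\<And>i. smooth_field \<Omega> (b i)"
    and z: "\<And>i \<psi>. test_fun \<Omega> \<psi> \<Longrightarrow> (LINT x:\<Omega>|lebesgue. h x * divf (b i) \<psi> x) = 0"
  shows "J \<noteq> [] \<Longrightarrow> smooth_field \<Omega> (iter_comm b J) \<and>
    (\<forall>\<psi>. test_fun \<Omega> \<psi> \<longrightarrow> (LINT x:\<Omega>|lebesgue. h x * divf (iter_comm b J) \<psi> x) = 0)"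
proof (induction J rule: induct_list012)
  case (3 j j' J)
  let ?Z = "iter_comm b (j' # J)"
  have Z: "smooth_field \<Omega> ?Z" "\<And>\<psi>. test_fun \<Omega> \<psi> \<Longrightarrow> (LINT x:\<Omega>|lebesgue. h x * divf ?Z \<psi> x) = 0"
    using "3.IH"(2) by auto
  note Lh = continuous_on_L1_loc[OF h]
  have "(LINT x:\<Omega>|lebesgue. h x * divf (lie_bracket (b j) ?Z) \<psi> x) = 0" if \<psi>: "test_fun \<Omega> \<psi>" for \<psi>
  proof -
    note tY = test_fun_divf[OF \<Omega> b[of j] \<psi>] and tZ = test_fun_divf[OF \<Omega> Z(1) \<psi>]
    have "(LINT x:\<Omega>|lebesgue. h x * divf (lie_bracket (b j) ?Z) \<psi> x)
        = (LINT x:\<Omega>|lebesgue. h x * divf (b j) (divf ?Z \<psi>) x - h x * divf ?Z (divf (b j) \<psi>) x)"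
      using divf_lie_bracket[OF \<Omega> b Z(1) \<psi>] open_in_sets_lebesgue[OF \<Omega>]
      by (intro set_lebesgue_integral_cong) (auto simp: right_diff_distrib)
    also have "\<dots> = (LINT x:\<Omega>|lebesgue. h x * divf (b j) (divf ?Z \<psi>) x) - (LINT x:\<Omega>|lebesgue. h x * divf ?Z (divf (b j) \<psi>) x)"
      by (rule set_integral_diff(2)[OF L1_loc_mult_test[OF Lh test_fun_divf[OF \<Omega> b tZ]]
            L1_loc_mult_test[OF Lh test_fun_divf[OF \<Omega> Z(1) tY]]])
    also have "\<dots> = 0" by (simp only: z[OF tZ] Z(2)[OF tY] diff_self)
    finally show ?thesis .
  qed
  with smooth_field_lie_bracket[OF \<Omega> b Z(1)] show ?case by simp
qed (use b z in auto)

text \<open>At each x0 a basis is extracted from the spanning commutators. The choice depends on x0,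
  but the chosen fields remain a frame nearby, which yields local constancy; connectedness makes it
  global.\<close>

theorem constant_of_weak_X_zero:
  fixes b :: "'m::finite \<Rightarrow> real ^ 'n::finite \<Rightarrow> real ^ 'n"
  assumes \<Omega>: "open \<Omega>" "connected \<Omega>" and h: "continuous_on \<Omega> h"
    and b: "smooth_fields \<Omega> b" and span: "commutators_span \<Omega> b s"
    and z: "\<And>i. has_weak_X b \<Omega> i h (\<lambda>_. 0)"
  shows "h constant_on \<Omega>"
proof (rule locally_constant_imp_constant[OF \<Omega>(2)])
  fix x0 assume x0: "x0 \<in> \<Omega>"
  have sb: "smooth_field \<Omega> (b i)" for i using b unfolding smooth_fields_def smooth_field_def by blast
  have zb: "(LINT x:\<Omega>|lebesgue. h x * divf (b i) \<psi> x) = 0" if "test_fun \<Omega> \<psi>" for i \<psi>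
  proof -
    have "(LINT x:\<Omega>|lebesgue. h x * adjoint_X b i \<psi> x) = 0"
      using z[of i] that unfolding has_weak_X_def by (simp add: set_lebesgue_integral_def)
    moreover have "adjoint_X b i \<psi> = (\<lambda>x. - divf (b i) \<psi> x)"
      by (simp add: fun_eq_iff adjoint_X_def divf_def)
    ultimately show ?thesis by (simp add: set_lebesgue_integral_def)
  qed
  let ?S = "{iter_comm b J x0 | J. J \<noteq> [] \<and> length J \<le> s}"
  have "span ?S = UNIV" using span x0 unfolding commutators_span_def by blast
  obtain C where C: "C \<subseteq> ?S" "independent C" "?S \<subseteq> span C"
    using maximal_independent_subset[of ?S] by blast
  have "span ?S \<subseteq> span C" by (rule span_minimal[OF C(3) subspace_span])
  then have sC: "span C = UNIV" using \<open>span ?S = UNIV\<close> by blast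
  have "card C = CARD('n)"
    using basis_card_eq_dim[of C UNIV] C(2) sC by simp
  moreover have "finite C" using C(2) by (rule independent_imp_finite)
  \<comment> \<open>The basis has as many elements as there are coordinates, so it can be indexed by
    \<open>'n\<close> itself; its matrix is then square, as Cramer's rule requires.\<close>
  ultimately obtain f where f: "bij_betw f (UNIV :: 'n set) C"
    using finite_same_card_bij[of "UNIV :: 'n set" C] by auto
  then have fC: "range f = C" by (simp add: bij_betw_def)
  have "\<forall>a. \<exists>J. f a = iter_comm b J x0 \<and> J \<noteq> []"
    using fC C(1) by blast
  then obtain J where J: "\<And>a. f a = iter_comm b (J a) x0" "\<And>a. J a \<noteq> []" by metis
  note ann = iter_comm_annihilates[OF \<Omega>(1) h sb zb J(2)]
  have sp: "span (range (\<lambda>a. iter_comm b (J a) x0)) = UNIV"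
    using sC fC J(1) by simp
  show "\<exists>T. openin (top_of_set \<Omega>) T \<and> x0 \<in> T \<and> (\<forall>x\<in>T. h x = h x0)"
  proof (rule weak_gradient_zero_of_frame[OF \<Omega>(1) x0 h conjunct1[OF ann] conjunct2[OF ann, rule_format] sp])
    fix V
    assume V: "open V" "x0 \<in> V" "V \<subseteq> \<Omega>"
      and zV: "\<And>k \<psi>. test_fun V \<psi> \<Longrightarrow> integral\<^sup>L lebesgue (\<lambda>x. h x * partial k \<psi> x) = 0"
    obtain r where r: "0 < r" "\<And>y. y \<in> ball x0 r \<Longrightarrow> h y = h x0"
      using locally_constant_of_weak_gradient[OF V(1,2) continuous_on_subset[OF h V(3)] zV] by blast
    show ?thesis
    proof (intro exI[of _ "\<Omega> \<inter> ball x0 r"] conjI ballI)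
      show "openin (top_of_set \<Omega>) (\<Omega> \<inter> ball x0 r)" by (simp add: openin_open_Int)
      show "x0 \<in> \<Omega> \<inter> ball x0 r" using x0 r(1) by simp
      show "h x = h x0" if "x \<in> \<Omega> \<inter> ball x0 r" for x by (rule r(2)) (use that in simp)
    qed
  qed
qed

section \<open>Proportionality of positive first eigenfunctions\<close>

theorem theorem4p1:
  fixes b :: "'m::finite \<Rightarrow> real ^ 'n::finite \<Rightarrow> real ^ 'n"
    and U \<Omega> :: "(real ^ 'n) set"
    and p :: real and s :: nat
    and u1 v1 :: "real ^ 'n \<Rightarrow> real"
  assumes "1 < p"
    and "2 \<le> CARD('n)" and "CARD('m) \<le> CARD('n)"
    and "open U" and "connected U" and "U \<noteq> {}" and "bounded U"
    and "smooth_fields U b" and "hormander_step U b s"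
    and "open \<Omega>" and "connected \<Omega>" and "compact (closure \<Omega>)" and "closure \<Omega> \<subseteq> U"
    and "eigenfunction b p \<Omega> (lambda1 b p \<Omega>) u1"
    and "continuous_on \<Omega> u1" and "\<forall>x\<in>\<Omega>. 0 < u1 x"
    and "eigenfunction b p \<Omega> (lambda1 b p \<Omega>) v1"
    and "continuous_on \<Omega> v1" and "\<forall>x\<in>\<Omega>. 0 < v1 x"
  shows "\<exists>c. c \<noteq> 0 \<and> (\<forall>x\<in>\<Omega>. u1 x = c * v1 x)"
proof -
  have \<Omega>U: "\<Omega> \<subseteq> U" using assms(13) closure_subset by blast
  have smooth: "smooth_fields \<Omega> b"
    using assms(8) \<Omega>U smooth_on_subset unfolding smooth_fields_def by blast
  have span: "commutators_span \<Omega> b s"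
    using assms(9) \<Omega>U unfolding hormander_step_def commutators_span_def by blast
  interpret open_fields b \<Omega> p
    by unfold_locales (use assms smooth bounded_subset[OF compact_imp_bounded closure_subset] in auto)
  have pos: "\<And>x. x \<in> \<Omega> \<Longrightarrow> 0 < u1 x" "\<And>x. x \<in> \<Omega> \<Longrightarrow> 0 < v1 x" using assms(16,19) by auto
  have W: "u1 \<in> W1p0 b p \<Omega>" "v1 \<in> W1p0 b p \<Omega>"
    using assms(14,17) unfolding eigenfunction_def by auto
  define h where "h x = ln (u1 x) - ln (v1 x)" for x
  have ch: "continuous_on \<Omega> h"
    unfolding h_def using pos
    by (intro continuous_on_diff continuous_on_ln assms(15,18)) (metis less_irrefl)+
  have "has_weak_X b \<Omega> i h (\<lambda>_. 0)" for i
  proof -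
    let ?g = "\<lambda>x. grad_X b \<Omega> u1 x $ i / u1 x - grad_X b \<Omega> v1 x $ i / v1 x"
    have hw: "has_weak_X b \<Omega> i h ?g"
      unfolding h_def[abs_def]
      by (rule has_weak_X_diff[OF weak_X_ln[OF W(1) assms(15) pos(1)] weak_X_ln[OF W(2) assms(18) pos(2)]])
    have "AE x in M. grad_X b \<Omega> u1 x /\<^sub>R u1 x = grad_X b \<Omega> v1 x /\<^sub>R v1 x"
      by (rule log_gradients_agree[OF assms(14,17) pos])
    then have g0: "AE x in M. ?g x = 0"
    proof eventually_elim
      case (elim x)
      then have "(grad_X b \<Omega> u1 x /\<^sub>R u1 x) $ i = (grad_X b \<Omega> v1 x /\<^sub>R v1 x) $ i" by simp
      then show ?case by (simp add: divide_inverse mult.commute)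
    qed
    \<comment> \<open>The weak derivative \<open>?g\<close> vanishes only almost everywhere; under
      the integral it can be replaced by the function 0 itself.\<close>
    have "(LINT x:\<Omega>|lebesgue. 0 * \<psi> x) = (LINT x:\<Omega>|lebesgue. h x * adjoint_X b i \<psi> x)"
      if \<psi>: "test_fun \<Omega> \<psi>" for \<psi>
    proof -
      have "AE x in M. ?g x * \<psi> x = 0" using g0 by eventually_elim simp
      then have "integral\<^sup>L M (\<lambda>x. ?g x * \<psi> x) = 0" by (rule integral_eq_zero_AE)
      then show ?thesis using hw \<psi> unfolding has_weak_X_def set_integral_M by simp
    qed
    moreover have "L1_loc \<Omega> (\<lambda>_. 0)" by (rule continuous_on_L1_loc) simp
    ultimately show ?thesis using hw unfolding has_weak_X_def by blast
  qed
  from constant_of_weak_X_zero[OF assms(10,11) ch smooth span this]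
  obtain c where c: "\<And>x. x \<in> \<Omega> \<Longrightarrow> h x = c" unfolding constant_on_def by blast
  have "u1 x = exp c * v1 x" if x: "x \<in> \<Omega>" for x
  proof -
    have "ln (u1 x) = c + ln (v1 x)" using c[OF x] by (simp add: h_def)
    then have "exp (ln (u1 x)) = exp c * exp (ln (v1 x))" by (simp add: exp_add)
    then show ?thesis using pos[OF x] by simp
  qed
  then show ?thesis by (intro exI[of _ "exp c"]) auto
qed

end
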